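(* Let $p$ be a prime, $k$ an even integer, and $z\in\mathbb H$. The completed and doubly-completed Eisenstein series for $R(p)$ satisfy, as meromorphic functions of $s\in\mathbb C$, $$\widehat G_{p,k}(z,1-k-s)=\widehat G_{p,k}(z,s)\quad\text{and}\quad\widetilde G_{p,k}(z,1-k-s)=\widetilde G_{p,k}(z,s).$$
   Context: Let $(\mathbb Z\times\mathbb Z)_{p,L}=\bigsqcup_{t\ge1}\{(m,n)\in t\mathbb Z\times t\mathbb Z:\gcd(pm,n)=t\}$ and $(\mathbb Z\times\mathbb Z)_{p,R}=\bigsqcup_{t\ge1}\{(m,n)\in t\mathbb Z\times t\mathbb Z:\gcd(m,pn)=t\}$. For $\Re(s)>1-\frac k2$ and $z=x+iy\in\mathbb H$ define $$G_{p,k}(z,s)=\frac12\sum_{(m,n)\in(\mathbb Z\times\mathbb Z)_{p,L}}\frac{y^s}{|\sqrt p\,mz+n|^{2s}(\sqrt p\,mz+n)^k}+\frac12\sum_{(m,n)\in(\mathbb Z\times\mathbb Z)_{p,R}}\frac{y^s}{|mz+\sqrt p\,n|^{2s}(mz+\sqrt p\,n)^k}.$$ Put $f_p(s)=\left(1-p^{(s-1)+\frac k2}\right)(1-p^{2s+k-2})^{-1}$ and $$\widehat G_{p,k}(z,s)=\left(\frac{\pi}{\sqrt p}\right)^{-s-\frac k2}\Gamma\!\left(s+\frac k2+\frac{|k|}2\right)f_p(s)\,G_{p,k}(z,s),\qquad\widetilde G_{p,k}(z,s)=\left(s+\frac k2\right)\left(s+\frac k2-1\right)\widehat G_{p,k}(z,s).$$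 For fixed $z$ these functions are extended from $\Re(s)>1-\frac k2$ to $s\in\mathbb C$ by meromorphic continuation (via their Fourier expansions in $x=\Re z$). $R(p)\subset\mathrm{SL}_2(\mathbb R)$ is the group of determinant-one matrices of the form $\begin{pmatrix} a & b\sqrt p\\ c\sqrt p & d\end{pmatrix}$ or $\begin{pmatrix} a\sqrt p & b\\ c & d\sqrt p\end{pmatrix}$, $a,b,c,d\in\mathbb Z$. *)

theory Defs
  imports "HOL-Complex_Analysis.Complex_Analysis"
begin

definition pairs_L :: "nat \<Rightarrow> (int \<times> int) set" where
  "pairs_L p = (\<Union>t\<in>{1..}. {(m, n). t dvd m \<and> t dvd n \<and> gcd (int p * m) n = t})"

definition pairs_R :: "nat \<Rightarrow> (int \<times> int) set" where
  "pairs_R p = (\<Union>t\<in>{1..}. {(m, n). t dvd m \<and> t dvd n \<and> gcd m (int p * n) = t})"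

text \<open>The real numbers \<open>y\<close>, \<open>|w|\<close>, \<open>p\<close> and \<open>\<pi> / \<surd>p\<close> raised to complex powers below are positive
  (for \<open>Im z > 0\<close> and \<open>p > 0\<close>), so the principal branch used by \<^const>\<open>powr\<close> is the usual power.\<close>

definition eisenstein_term :: "int \<Rightarrow> real \<Rightarrow> complex \<Rightarrow> complex \<Rightarrow> complex" where
  "eisenstein_term k y s w =
     of_real y powr s / (of_real (norm w) powr (2 * s) * w powi k)"

definition halfplane :: "int \<Rightarrow> complex set" where
  "halfplane k = {s. Re s > 1 - of_int k / 2}"

text \<open>The formulas defining the Eisenstein series and its completions; they are meaningful
  for \<open>s \<in> halfplane k\<close>, where the two series converge absolutely.\<close>

definition G_series :: "nat \<Rightarrow> int \<Rightarrow> complex \<Rightarrow> complex \<Rightarrow> complex" where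
  "G_series p k z s =
     1 / 2 * (\<Sum>\<^sub>\<infinity>(m, n)\<in>pairs_L p.
        eisenstein_term k (Im z) s (of_real (sqrt (real p)) * of_int m * z + of_int n)) +
     1 / 2 * (\<Sum>\<^sub>\<infinity>(m, n)\<in>pairs_R p.
        eisenstein_term k (Im z) s (of_int m * z + of_real (sqrt (real p)) * of_int n))"

definition f_factor :: "nat \<Rightarrow> int \<Rightarrow> complex \<Rightarrow> complex" where
  "f_factor p k s =
     (1 - of_nat p powr ((s - 1) + of_int k / 2)) * inverse (1 - of_nat p powr (2 * s + of_int k - 2))"

definition G_hat_series :: "nat \<Rightarrow> int \<Rightarrow> complex \<Rightarrow> complex \<Rightarrow> complex" where
  "G_hat_series p k z s =
     of_real (pi / sqrt (real p)) powr (- s - of_int k / 2) *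
     Gamma (s + of_int k / 2 + of_int \<bar>k\<bar> / 2) * f_factor p k s * G_series p k z s"

definition G_tilde_series :: "nat \<Rightarrow> int \<Rightarrow> complex \<Rightarrow> complex \<Rightarrow> complex" where
  "G_tilde_series p k z s =
     (s + of_int k / 2) * (s + of_int k / 2 - 1) * G_hat_series p k z s"

text \<open>Meromorphic functions on the plane are represented by their normalised representatives:
  \<^const>\<open>nicely_meromorphic_on\<close> requires removable singularities to be filled in and the value
  at each pole to be \<open>0\<close>. Two such functions are equal iff they agree as meromorphic functions, so
  a continuation from a nonempty open set is unique by the identity theorem.\<close>

definition is_meromorphic_continuation ::
    "(complex \<Rightarrow> complex) \<Rightarrow> complex set \<Rightarrow> (complex \<Rightarrow> complex) \<Rightarrow> bool" where
  "is_meromorphic_continuation f A F \<longleftrightarrow>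
     F nicely_meromorphic_on UNIV \<and> (\<forall>s\<in>A. F s = f s)"

definition meromorphic_continuation ::
    "(complex \<Rightarrow> complex) \<Rightarrow> complex set \<Rightarrow> complex \<Rightarrow> complex" where
  "meromorphic_continuation f A = (THE F. is_meromorphic_continuation f A F)"

definition G_hat :: "nat \<Rightarrow> int \<Rightarrow> complex \<Rightarrow> complex \<Rightarrow> complex" where
  "G_hat p k z = meromorphic_continuation (G_hat_series p k z) (halfplane k)"

definition G_tilde :: "nat \<Rightarrow> int \<Rightarrow> complex \<Rightarrow> complex \<Rightarrow> complex" where
  "G_tilde p k z = meromorphic_continuation (G_tilde_series p k z) (halfplane k)"

end

theory Submission
  imports Defs "HOL-Probability.Distributions" "HOL-Real_Asymp.Real_Asymp"
begin

text \<open>Put \<open>u = s + k/2\<close>. A nonzero pair lies either in \<open>pairs_L p\<close> or is \<open>(m, p n)\<close> with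
  \<open>(m, n) \<in> pairs_R p\<close>, and symmetrically with the two sets exchanged. As the terms are
  homogeneous, adding the two decompositions turns \<open>(1 + p powr - u) * G\<close> into a sum of two
  ordinary Eisenstein series, taken over all nonzero points of the lattices of
  \<open>\<surd>p z\<close> and \<open>z / \<surd>p\<close>. On the half plane \<open>f_p\<close> equals \<open>1 / (1 + p powr (u - 1))\<close>, so the
  product of the two denominators is invariant under \<open>u \<mapsto> 1 - u\<close>, and it remains to treat a
  single lattice. There Riemann's argument applies: the completed series is the Mellin transform of a theta
  series with the harmonic weight \<open>(cnj w) ^ k\<close> or \<open>w ^ (- k)\<close>. Poisson summation in one of
  the two lattice coordinates makes the inversion formula of this theta series visible as the
  exchange of the two summation variables.\<close>

section \<open>Fourier expansion of periodic entire functions\<close>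

text \<open>The weight is a polynomial of degree |k| in \<open>w\<close> or \<open>cnj w\<close>, so
  its theta series has weight |k| + 1 under t -> 1/t. The natural Mellin variable is therefore v = u
  + |k|/2, which is the argument of the Gamma factor, and v -> |k| + 1 - v is the same as u -> 1 -
  u. Poles of a completed lattice sum can come only from the theta term at the lattice point 0,
  which is nonzero only for k = 0. Poisson summation is applied to a Gaussian times exp(alpha * cnj
  w). Completing the square moves the centre of the Gaussian off the real line, so the
  one-dimensional inversion formula is needed for complex shifts; it is obtained from Cauchy's
  theorem for a 1-periodic entire function. The functional equations are asserted for normalised
  functions at every point, poles included. The continuation is therefore written as an explicit
  expression that is symmetric everywhere, also under the convention x / 0 = 0, and normalisation
  preserves this symmetry.\<close>

lemma exp_2pii_eq_1_iff_int: "exp (2 * of_real pi * \<i> * z) = 1 \<longleftrightarrow> z \<in> \<int>"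
proof
  assume "exp (2 * of_real pi * \<i> * z) = 1"
  then obtain n :: int where "Im (2 * of_real pi * \<i> * z) = of_int (2 * n) * pi"
      "Re (2 * of_real pi * \<i> * z) = 0"
    by (auto simp: exp_eq_1)
  then have "z = of_int n" by (auto simp: complex_eq_iff)
  then show "z \<in> \<int>" by simp
next
  assume "z \<in> \<int>"
  then obtain n where n: "z = of_int n" by (auto elim: Ints_cases)
  show "exp (2 * of_real pi * \<i> * z) = 1"
    by (auto simp: exp_eq_1 n)
qed

text \<open>The simple-pole rule used for \<open>aux\<close> asks for a numerator that does not
  vanish at the pole. If f 0 = 0, the rule is applied to f + 1 and to 1, and the residue of f is
  their difference.\<close>

lemma residue_div_exp_2pii:
  fixes f :: "complex \<Rightarrow> complex"
  assumes hol: "f holomorphic_on UNIV"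
  shows "residue (\<lambda>z. f z / (exp (2 * of_real pi * \<i> * z) - 1)) 0 = f 0 / (2 * of_real pi * \<i>)"
proof -
  have aux: "residue (\<lambda>z. h z / (exp (2 * of_real pi * \<i> * z) - 1)) 0 = h 0 / (2 * of_real pi * \<i>)"
    if "h holomorphic_on UNIV" "h 0 \<noteq> 0" for h
  proof (rule residue_simple_pole_deriv[where s = UNIV])
    show "((\<lambda>z. exp (2 * of_real pi * \<i> * z) - 1) has_field_derivative 2 * of_real pi * \<i>) (at 0)"
      by (auto intro!: derivative_eq_intros)
  qed (use that in \<open>auto intro!: holomorphic_intros\<close>)
  show ?thesis
  proof (cases "f 0 = 0")
    case True
    define S where "S = ball (0::complex) 1"
    have nz: "exp (2 * of_real pi * \<i> * z) - 1 \<noteq> 0" if "z \<in> S - {0}" for z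
      using that exp_2pii_eq_1_iff_int[of z] by (auto simp: S_def elim!: Ints_cases)
    have fS: "f holomorphic_on A" for A using hol holomorphic_on_subset by blast
    have "residue (\<lambda>z. f z / (exp (2 * of_real pi * \<i> * z) - 1) + 1 / (exp (2 * of_real pi * \<i> * z) - 1)) 0
        = residue (\<lambda>z. f z / (exp (2 * of_real pi * \<i> * z) - 1)) 0
        + residue (\<lambda>z. 1 / (exp (2 * of_real pi * \<i> * z) - 1)) 0"
      by (rule residue_add[of S]) (use nz in \<open>auto simp: S_def intro!: holomorphic_intros fS\<close>)
    moreover have "residue (\<lambda>z. 1 / (exp (2 * of_real pi * \<i> * z) - 1)) 0 = 1 / (2 * of_real pi * \<i>)"
      using aux[of "\<lambda>_. 1"] by simp
    moreover have "residue (\<lambda>z. (f z + 1) / (exp (2 * of_real pi * \<i> * z) - 1)) 0 = 1 / (2 * of_real pi * \<i>)"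
      using aux[OF holomorphic_on_add[OF hol holomorphic_on_const[of 1]]] True by simp
    ultimately show ?thesis using True by (simp add: add_divide_distrib)
  qed (use aux hol in blast)
qed

text \<open>Cauchy's theorem on \<open>[-1/2, 1/2] \<times> [-1, 1]\<close>; by periodicity the vertical sides cancel.\<close>

lemma periodic_residue_formula:
  fixes f :: "complex \<Rightarrow> complex"
  assumes hol: "f holomorphic_on UNIV" and per: "\<And>z. f (z + 1) = f z"
  defines "g \<equiv> \<lambda>z. f z / (exp (2 * of_real pi * \<i> * z) - 1)"
  shows "f 0 = contour_integral (linepath (Complex (-1/2) (-1)) (Complex (1/2) (-1))) g -
               contour_integral (linepath (Complex (-1/2) 1) (Complex (1/2) 1)) g"
proof -
  define a b c d where "a = Complex (-1/2) (-1)" and "b = Complex (1/2) (-1)"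
    and "c = Complex (1/2) 1" and "d = Complex (-1/2) 1"
  \<comment> \<open>The bound 3/4 lies between 1/2, so that the rectangle fits into the strip, and
    1, so that 0 is the only integer and hence the only possible pole of \<open>g\<close> in
    it.\<close>
  define S where "S = {z::complex. \<bar>Re z\<bar> < 3/4}"
  have S_alt: "S = {z. Re z < 3/4} \<inter> {z. Re z > - (3/4)}" unfolding S_def by auto
  have opS: "open S" unfolding S_alt by (intro open_Int open_halfspace_Re_lt open_halfspace_Re_gt)
  have convS: "convex S" unfolding S_alt
    by (intro convex_Int convex_halfspace_Re_lt convex_halfspace_Re_gt)
  have ints: "z = 0" if "z \<in> S" "z \<in> \<int>" for z
    using that by (auto simp: S_def elim!: Ints_cases)
  have nz: "exp (2 * of_real pi * \<i> * z) - 1 \<noteq> 0" if "z \<in> S - {0}" for z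
    using that ints exp_2pii_eq_1_iff_int[of z] by auto
  have fS: "f holomorphic_on A" for A using hol holomorphic_on_subset by blast
  have gS: "g holomorphic_on S - {0}"
    unfolding g_def by (intro holomorphic_intros fS nz)
  have pim: "path_image (rectpath a c) \<subseteq> S - {0}"
    unfolding a_def c_def by (subst path_image_rectpath) (auto simp: S_def)
  have rect0: "contour_integral (rectpath a c) g = 2 * pi * \<i> * (\<Sum>p\<in>{0}. winding_number (rectpath a c) p * residue g p)"
  proof (rule Residue_theorem[OF opS])
    show "\<forall>z. z \<notin> S \<longrightarrow> winding_number (rectpath a c) z = 0"
    proof (intro allI impI)
      fix z assume "z \<notin> S"
      then show "winding_number (rectpath a c) z = 0"
        by (intro winding_number_rectpath_outside) (auto simp: a_def c_def S_def in_cbox_complex_iff)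
    qed
  qed (use convS pim gS in \<open>auto simp: convex_connected\<close>)
  have "winding_number (rectpath a c) 0 = 1"
    by (rule winding_number_rectpath) (auto simp: a_def c_def in_box_complex_iff)
  then have rect: "contour_integral (rectpath a c) g = f 0"
    using residue_div_exp_2pii[OF hol] rect0 by (simp add: g_def)
  have gper: "g (z + 1) = g z" for z
    by (simp add: g_def per distrib_left exp_add exp_two_pi_i' mult_ac)
  have cont: "continuous_on A g" if "A \<subseteq> S - {0}" for A
    using gS that holomorphic_on_imp_continuous_on continuous_on_subset by blast
  have seg: "closed_segment u v \<subseteq> path_image (rectpath a c)"
    if "(u, v) \<in> {(a, b), (b, c), (c, d), (d, a)}" for u v
    using that by (auto simp: a_def b_def c_def d_def path_image_rectpath closed_segment_same_Re
       closed_segment_same_Im closed_segment_eq_real_ivl split: if_splits)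
  have ci: "g contour_integrable_on linepath u v"
    if "(u, v) \<in> {(a, b), (b, c), (c, d), (d, a)}" for u v
    using seg[OF that] pim by (intro contour_integrable_continuous_linepath cont) blast
  have rp: "rectpath a c = linepath a b +++ linepath b c +++ linepath c d +++ linepath d a"
    by (simp add: rectpath_def Let_def a_def b_def c_def d_def)
  have "contour_integral (rectpath a c) g = contour_integral (linepath a b) g +
     (contour_integral (linepath b c) g + (contour_integral (linepath c d) g + contour_integral (linepath d a) g))"
    unfolding rp using ci by (simp add: contour_integrable_joinI)
  moreover have "contour_integral (linepath b c) g = contour_integral (linepath a d) g"
  proof -
    have "linepath b c t = linepath a d t + 1" for t
      by (simp add: linepath_def a_def b_def c_def d_def complex_eq_iff) (simp add: field_simps)
    then show ?thesis
      unfolding contour_integral_integral gper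
      by (simp add: gper) (simp add: a_def b_def c_def d_def complex_eq_iff)
  qed
  moreover have "contour_integral (linepath c d) g = - contour_integral (linepath d c) g"
      "contour_integral (linepath d a) g = - contour_integral (linepath a d) g"
    using ci by (metis contour_integral_reversepath reversepath_linepath valid_path_linepath)+
  ultimately show ?thesis using rect by (simp add: a_def b_def c_def d_def)
qed

text \<open>The window consists of N indices j >= 1 and N indices j <= 0, the blocks produced by N
  steps of the geometric series on the lower and upper side of the rectangle. The same windows serve
  to telescope integrals over unit intervals.\<close>

lemma filterlim_int_intervals_finite_subsets:
  "filterlim (\<lambda>N::nat. {1 - int N..int N}) (finite_subsets_at_top UNIV) sequentially"
  unfolding filterlim_finite_subsets_at_top
proof (intro allI impI)
  fix X :: "int set" assume "finite X \<and> X \<subseteq> UNIV"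
  then have fin: "finite X" by simp
  define M where "M = nat (\<Sum>x\<in>X. \<bar>x\<bar>) + 1"
  have M: "\<bar>x\<bar> < int M" if "x \<in> X" for x
    using member_le_sum[OF that _ fin, of abs] by (simp add: M_def)
  show "\<forall>\<^sub>F N in sequentially. finite {1 - int N..int N} \<and> X \<subseteq> {1 - int N..int N} \<and> {1 - int N..int N} \<subseteq> UNIV"
    using eventually_ge_at_top[of M]
  proof eventually_elim
    case (elim N)
    show ?case using M elim by (fastforce simp: abs_less_iff)
  qed
qed

text \<open>Expanding \<open>1 / (q - 1)\<close> with \<open>q = e\<^sup>2\<^sup>\<pi>\<^sup>i\<^sup>z\<close> into geometric series, in powers of \<open>1 / q\<close> on the
  lower and of \<open>q\<close> on the upper side of the rectangle, turns the residue formula into the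
  Fourier expansion at \<open>0\<close>.\<close>

lemma fourier_expansion_at_0:
  fixes f :: "complex \<Rightarrow> complex" and a :: "int \<Rightarrow> complex"
  assumes hol: "f holomorphic_on UNIV" and per: "\<And>z. f (z + 1) = f z"
    and Q: "\<And>j z. (Q j has_field_derivative f z * exp (- 2 * of_real pi * \<i> * of_int j * z)) (at z)"
    and a: "\<And>j w. Q j (w + 1) - Q j w = a j"
    and summ: "a summable_on UNIV"
  shows "(a has_sum f 0) UNIV"
proof -
  define q where "q = (\<lambda>z. exp (2 * of_real pi * \<i> * z))"
  define g where "g = (\<lambda>z. f z / (q z - 1))"
  define \<gamma> where "\<gamma> = (\<lambda>h. linepath (Complex (-1/2) h) (Complex (1/2) h))"
  define seg where "seg = (\<lambda>h. closed_segment (Complex (-1/2) h) (Complex (1/2) h))"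
  have seg_Im: "Im z = h" if "z \<in> seg h" for z h
    using that by (auto simp: seg_def closed_segment_same_Im)
  have q0: "q z \<noteq> 0" for z by (simp add: q_def)
  have nq: "norm (q z) = exp (- 2 * pi * Im z)" for z by (simp add: q_def norm_exp_eq_Re)
  have q1: "q z \<noteq> 1" if "Im z \<noteq> 0" for z
    using that exp_2pii_eq_1_iff_int[of z] by (auto simp: q_def elim!: Ints_cases)
  have contf: "continuous_on A f" for A
    using hol holomorphic_on_imp_continuous_on continuous_on_subset by blast
  have contq: "continuous_on A q" for A unfolding q_def by (intro continuous_intros)
  have contg: "continuous_on (seg h) g" if "h \<noteq> 0" for h
    unfolding g_def using that q1 seg_Im by (intro continuous_intros contf contq) fastforce
  have f0: "f 0 = contour_integral (\<gamma> (-1)) g - contour_integral (\<gamma> 1) g"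
    using periodic_residue_formula[OF hol per] by (simp add: g_def \<gamma>_def q_def)
  have qj: "exp (- 2 * of_real pi * \<i> * of_int j * z) = q z powi (-j)" for j z
  proof -
    have "q z powi (-j) = exp (of_int (-j) * (2 * of_real pi * \<i> * z))"
      by (simp only: q_def exp_power_int)
    then show ?thesis by (simp add: mult_ac)
  qed
  \<comment> \<open>\<open>Q j\<close> is a primitive of the integrand of the j-th Fourier
    coefficient, so the integral over a horizontal unit segment is an increment of
    \<open>Q j\<close>, namely \<open>a j\<close>, at every height \<open>h\<close>. The same
    coefficients thus appear on both sides of the rectangle.\<close>
  have int_a: "((\<lambda>z. f z * q z powi (-j)) has_contour_integral a j) (\<gamma> h)" for j h
  proof -
    have "((\<lambda>z. f z * q z powi (-j)) has_contour_integral
        (Q j (pathfinish (\<gamma> h)) - Q j (pathstart (\<gamma> h)))) (\<gamma> h)"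
      using Q[of j] unfolding qj
      by (intro contour_integral_primitive[where S = UNIV]) (auto simp: \<gamma>_def)
    also have "Q j (pathfinish (\<gamma> h)) - Q j (pathstart (\<gamma> h)) = a j"
      using a[of j "Complex (-1/2) h"] by (simp add: \<gamma>_def complex_eq_iff Complex_eq)
    finally show ?thesis .
  qed
  have bnd: "\<exists>B\<ge>0. \<forall>z\<in>seg h. norm (g z) \<le> B" if "h \<noteq> 0" for h
  proof -
    have "compact (g ` seg h)"
      using contg[OF that] by (intro compact_continuous_image) (auto simp: seg_def)
    then obtain B where "\<forall>z\<in>seg h. norm (g z) \<le> B"
      by (auto dest!: compact_imp_bounded simp: bounded_iff)
    then show ?thesis by (intro exI[of _ "max B 0"]) auto
  qed
  \<comment> \<open>These integrals are the remainders of the geometric expansions: after N steps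
    \<open>g\<close> is left multiplied by q^(-N) on the lower side and by q^N on the upper
    side.\<close>
  define R where "R = (\<lambda>h (e::int). contour_integral (\<gamma> h) (\<lambda>z. g z * q z powi e))"
  have Rci: "(\<lambda>z. g z * q z powi e) contour_integrable_on \<gamma> h" if "h \<noteq> 0" for e h
    unfolding \<gamma>_def using that q0
    by (intro contour_integrable_continuous_linepath continuous_intros contq contg[unfolded seg_def]) auto
  \<comment> \<open>Used with (s, h) = (1, 1) and (-1, -1). On the segment |q| = exp (-2 pi h), so
    |q^(s N)| = exp (-2 pi)^N in both cases.\<close>
  have Rbound: "\<exists>B. \<forall>N::nat. norm (R h (s * int N)) \<le> B * exp (- 2 * pi) ^ N"
    if h: "h \<noteq> 0" and s: "of_int s * h = 1" for h s
  proof -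
    obtain B where B: "B \<ge> 0" "\<And>z. z \<in> seg h \<Longrightarrow> norm (g z) \<le> B" using bnd[OF h] by blast
    have "norm (R h (s * int N)) \<le> B * exp (- 2 * pi) ^ N" for N
    proof -
      have le: "norm (g z * q z powi (s * int N)) \<le> B * exp (- 2 * pi) ^ N" if "z \<in> seg h" for z
      proof -
        have "norm (q z powi (s * int N)) = exp (of_int (s * int N) * (- 2 * pi * h))"
          using nq[of z] seg_Im[OF that] by (simp add: norm_power_int exp_power_int)
        also have "of_int (s * int N) * (- 2 * pi * h) = real N * (- 2 * pi) * (of_int s * h)"
          by simp
        also have "exp \<dots> = exp (- 2 * pi) ^ N" by (simp only: s mult_1_right exp_of_nat_mult)
        finally show ?thesis using B(2)[OF that] by (simp add: norm_mult mult_right_mono)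
      qed
      have "norm (R h (s * int N)) \<le> (B * exp (- 2 * pi) ^ N) * norm (Complex (1/2) h - Complex (-1/2) h)"
        unfolding R_def \<gamma>_def using B(1) le Rci[OF h]
        by (intro contour_integral_bound_linepath) (auto simp: \<gamma>_def seg_def)
      also have "Complex (1/2) h - Complex (-1/2) h = 1" by (simp add: complex_eq_iff)
      finally show ?thesis by simp
    qed
    then show ?thesis by blast
  qed
  have bot: "contour_integral (\<gamma> (-1)) g = (\<Sum>j\<in>{1..int N}. a j) + R (-1) (- int N)" for N :: nat
  proof (induction N)
    case 0
    show ?case by (simp add: R_def)
  next
    case (Suc N)
    \<comment> \<open>One geometric step in 1/q: g (q - 1) = f gives g = f/q + g/q.\<close>
    have "R (-1) (- int N) = contour_integral (\<gamma> (-1)) (\<lambda>z. f z * q z powi (- (int N + 1)) + g z * q z powi (- (int N + 1)))"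
      unfolding R_def
    proof (rule contour_integral_cong[OF refl])
      fix z assume "z \<in> path_image (\<gamma> (-1))"
      then have "q z - 1 \<noteq> 0" using q1[of z] seg_Im[of z "-1"] by (auto simp: \<gamma>_def seg_def)
      then have "g z * (q z - 1) = f z" by (simp add: g_def)
      then have e1: "f z + g z = g z * q z" by (simp add: algebra_simps)
      have e2: "q z powi (- int N) = q z * q z powi (- (int N + 1))"
        using q0[of z] power_int_add_1[of "q z" "- (int N + 1)"] by (simp add: mult.commute)
      show "g z * q z powi - int N = f z * q z powi - (int N + 1) + g z * q z powi - (int N + 1)"
        by (simp only: distrib_right[symmetric] e1 e2 mult.assoc)
    qed
    also have "\<dots> = a (int N + 1) + R (-1) (- (int N + 1))"
      unfolding R_def using int_a[of "int N + 1" "-1"] Rci[of "-1"]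
      by (subst contour_integral_add) (auto simp: contour_integral_unique has_contour_integral_integrable)
    finally have "R (-1) (- int N) = a (int N + 1) + R (-1) (- (int N + 1))" .
    moreover have "{1..int (Suc N)} = insert (int N + 1) {1..int N}" by auto
    ultimately show ?case using Suc.IH by (simp add: algebra_simps)
  qed
  have top: "contour_integral (\<gamma> 1) g = - (\<Sum>j\<in>{1 - int N..0}. a j) + R 1 (int N)" for N :: nat
  proof (induction N)
    case 0
    show ?case by (simp add: R_def)
  next
    case (Suc N)
    \<comment> \<open>The same identity solved the other way, g = g q - f, is one geometric step in
      q; its sign turns into a plus because the upper side is subtracted.\<close>
    have "R 1 (int N) = contour_integral (\<gamma> 1) (\<lambda>z. g z * q z powi (int N + 1) - f z * q z powi (- (- int N)))"
      unfolding R_def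
    proof (rule contour_integral_cong[OF refl])
      fix z assume "z \<in> path_image (\<gamma> 1)"
      then have "q z - 1 \<noteq> 0" using q1[of z] seg_Im[of z "1"] by (auto simp: \<gamma>_def seg_def)
      then have "g z * (q z - 1) = f z" by (simp add: g_def)
      then have e1: "f z = g z * q z - g z" by (simp add: algebra_simps)
      have e2: "q z powi (int N + 1) = q z * q z powi (int N)"
        using q0[of z] power_int_add_1[of "q z" "int N"] by (simp add: mult.commute)
      show "g z * q z powi int N = g z * q z powi (int N + 1) - f z * q z powi (- (- int N))"
        by (simp only: e1 e2 minus_minus left_diff_distrib mult.assoc) simp
    qed
    also have "\<dots> = R 1 (int N + 1) - a (- int N)"
      unfolding R_def using int_a[of "- int N" "1"] Rci[of "1"]
      by (subst contour_integral_diff) (auto simp: contour_integral_unique has_contour_integral_integrable)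
    finally have step: "R 1 (int N) = R 1 (int (Suc N)) - a (- int N)" by (simp add: add.commute)
    have "{1 - int (Suc N)..0} = insert (- int N) {1 - int N..0}" by auto
    then have "(\<Sum>j\<in>{1 - int (Suc N)..0}. a j) = a (- int N) + (\<Sum>j\<in>{1 - int N..0}. a j)"
      by (simp del: of_nat_Suc)
    then show ?case by (simp only: Suc.IH step) simp
  qed
  have part: "(\<Sum>j\<in>{1 - int N..int N}. a j) = f 0 - R (-1) ((-1) * int N) + R 1 (1 * int N)" for N :: nat
  proof -
    have "{1 - int N..int N} = {1 - int N..0} \<union> {1..int N}" by auto
    then have "(\<Sum>j\<in>{1 - int N..int N}. a j) = (\<Sum>j\<in>{1 - int N..0}. a j) + (\<Sum>j\<in>{1..int N}. a j)"
      by (simp add: sum.union_disjoint)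
    then show ?thesis using f0 bot[of N] top[of N] by simp
  qed
  have R0: "(\<lambda>N. R h (s * int N)) \<longlonglongrightarrow> 0" if h: "h \<noteq> 0" and s: "of_int s * h = 1" for h s
  proof -
    obtain B where B: "\<And>N. norm (R h (s * int N)) \<le> B * exp (- 2 * pi) ^ N"
      using Rbound[OF h s] by blast
    have "(\<lambda>N. B * exp (- 2 * pi) ^ N) \<longlonglongrightarrow> B * 0"
      by (intro tendsto_intros LIMSEQ_realpow_zero) auto
    then show ?thesis
      by (intro Lim_null_comparison[OF always_eventually[OF allI[OF B]]]) simp
  qed
  have "(\<lambda>N. \<Sum>j\<in>{1 - int N..int N}. a j) \<longlonglongrightarrow> f 0 - 0 + 0"
    unfolding part by (intro tendsto_intros R0) auto
  \<comment> \<open>Summability is a hypothesis, so only the value of the sum has to be found, and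
    convergence along one cofinal family of windows suffices.\<close>
  moreover obtain S where S: "(a has_sum S) UNIV" using summ by (auto simp: summable_on_def)
  have "(\<lambda>N. \<Sum>j\<in>{1 - int N..int N}. a j) \<longlonglongrightarrow> S"
    using S unfolding has_sum_def
    by (rule filterlim_compose[OF _ filterlim_int_intervals_finite_subsets])
  ultimately have "S = f 0" using LIMSEQ_unique by fastforce
  then show ?thesis using S by simp
qed

section \<open>The one-dimensional theta function\<close>

text \<open>Truncation by \<open>max 1\<close> gives n = 0 the value 1, so that products of such
  terms also majorise a planar lattice on the coordinate axes.\<close>

lemma summable_on_int_powr:
  fixes \<sigma> :: real
  assumes "\<sigma> > 1"
  shows "(\<lambda>n::int. max 1 \<bar>of_int n\<bar> powr (-\<sigma>)) summable_on UNIV"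
proof -
  have nat: "(\<lambda>n::nat. max 1 (real n) powr (-\<sigma>)) summable_on UNIV"
  proof (rule norm_summable_imp_summable_on)
    have "summable (\<lambda>n. real n powr (-\<sigma>))"
      using assms by (simp add: summable_real_powr_iff)
    moreover have "eventually (\<lambda>n. real n powr (-\<sigma>) = norm (max 1 (real n) powr (-\<sigma>))) sequentially"
      using eventually_ge_at_top[of 1] by eventually_elim (simp add: max_def)
    ultimately show "summable (\<lambda>n. norm (max 1 (real n) powr (-\<sigma>)))"
      using summable_cong by force
  qed
  have 1: "(\<lambda>n::int. max 1 \<bar>of_int n\<bar> powr (-\<sigma>)) summable_on (int ` UNIV)"
    by (subst summable_on_reindex) (use nat in \<open>auto simp: o_def inj_on_def\<close>)
  have 2: "(\<lambda>n::int. max 1 \<bar>of_int n\<bar> powr (-\<sigma>)) summable_on ((\<lambda>n. - int n) ` UNIV)"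
    by (subst summable_on_reindex) (use nat in \<open>auto simp: o_def inj_on_def\<close>)
  have "(\<lambda>n::int. max 1 \<bar>of_int n\<bar> powr (-\<sigma>)) summable_on (int ` UNIV \<union> (\<lambda>n. - int n) ` UNIV)"
    using 1 2 by (rule summable_on_union)
  also have "int ` UNIV \<union> (\<lambda>n. - int n) ` UNIV = UNIV"
  proof -
    have "x \<in> int ` UNIV \<union> (\<lambda>n. - int n) ` UNIV" for x
      by (cases x rule: int_cases2) auto
    then show ?thesis by blast
  qed
  finally show ?thesis .
qed

text \<open>Half of the quadratic term absorbs the linear one by completing the square. The other
  half, x = c r^2 / 2, is estimated by x^2 / 2 <= exp x, which gives 2 / x^2 = 8 / (c^2 r^4). The
  exponent -4 is summable over the integers and over planar lattices.\<close>

lemma exp_neg_square_le_powr: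
  fixes c d r :: real
  assumes c: "c > 0" and r: "r > 0"
  shows "exp (- c * r\<^sup>2 + d * r) \<le> 8 / c\<^sup>2 * exp (d\<^sup>2 / (2 * c)) * r powr (-4)"
proof -
  have "d * r \<le> c * r\<^sup>2 / 2 + d\<^sup>2 / (2 * c)"
  proof -
    have "0 \<le> (c * r - d)\<^sup>2 / (2 * c)" using c by simp
    also have "\<dots> = c * r\<^sup>2 / 2 + d\<^sup>2 / (2 * c) - d * r"
      using c by (simp add: power2_eq_square field_simps)
    finally show ?thesis by simp
  qed
  then have "exp (- c * r\<^sup>2 + d * r) \<le> exp (d\<^sup>2 / (2 * c)) * exp (- (c * r\<^sup>2 / 2))"
    by (simp flip: exp_add)
  also have "exp (- (c * r\<^sup>2 / 2)) \<le> 8 / c\<^sup>2 * r powr (-4)"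
  proof -
    define x where "x = c * r\<^sup>2 / 2"
    have x: "x > 0" using c r by (simp add: x_def)
    have "x\<^sup>2 / 2 \<le> exp x" using exp_lower_Taylor_quadratic[of x] x by simp
    then have "exp (-x) \<le> 2 / x\<^sup>2" using x by (simp add: exp_minus field_simps)
    also have "2 / x\<^sup>2 = 8 / c\<^sup>2 * r powr (-4)"
      using r c by (simp add: x_def powr_minus powr_numeral field_simps power2_eq_square power4_eq_xxxx)
    finally show ?thesis by (simp add: x_def)
  qed
  finally show ?thesis by (simp add: mult_ac)
qed

lemma summable_on_int_gauss:
  fixes c d :: real
  assumes c: "c > 0"
  shows "(\<lambda>n::int. exp (- c * (of_int n)\<^sup>2 + d * \<bar>of_int n\<bar>)) summable_on UNIV"
proof (rule summable_on_comparison_test)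
  define C where "C = max 1 (8 / c\<^sup>2 * exp (d\<^sup>2 / (2 * c)))"
  show "(\<lambda>n::int. C * max 1 \<bar>of_int n\<bar> powr (-4)) summable_on UNIV"
    by (intro summable_on_cmult_right summable_on_int_powr) auto
  show "exp (- c * (of_int n)\<^sup>2 + d * \<bar>of_int n\<bar>) \<le> C * max 1 \<bar>of_int n\<bar> powr (-4)" for n :: int
  proof (cases "n = 0")
    case False
    then have "max 1 \<bar>of_int n :: real\<bar> = \<bar>of_int n\<bar>" by linarith
    then show ?thesis
      using exp_neg_square_le_powr[OF c, of "\<bar>of_int n\<bar>" d] False
        mult_right_mono[of "8 / c\<^sup>2 * exp (d\<^sup>2 / (2 * c))" C "\<bar>of_int n\<bar> powr (-4)"]
      by (simp add: C_def)
  qed (simp add: C_def)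
qed auto

text \<open>The shift \<open>b\<close> is complex: as a function of \<open>b\<close> the series is
  entire and 1-periodic, the setting of the Fourier expansion above, and the later use has a shift
  that is not real.\<close>

definition theta :: "real \<Rightarrow> complex \<Rightarrow> complex" where
  "theta A b = (\<Sum>\<^sub>\<infinity>n::int. exp (- of_real (pi * A) * (of_int n + b)\<^sup>2))"

lemma theta_term_bound:
  fixes b :: complex
  assumes "A > 0" "norm b \<le> R"
  shows "norm (exp (- of_real (pi * A) * (of_int n + b)\<^sup>2))
      \<le> exp (pi * A * R\<^sup>2) * exp (- (pi * A) * (of_int n)\<^sup>2 + 2 * pi * A * R * \<bar>of_int n\<bar>)"
proof -
  have "Re (- of_real (pi * A) * (of_int n + b)\<^sup>2) = - (pi * A) * Re ((of_int n + b)\<^sup>2)"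
    by simp
  also have "Re ((of_int n + b)\<^sup>2) = (of_int n)\<^sup>2 + 2 * of_int n * Re b + Re (b\<^sup>2)"
    by (simp add: power2_eq_square algebra_simps)
  also have "- (pi * A) * \<dots> = - (pi * A) * (of_int n)\<^sup>2 + pi * A * (- 2 * of_int n * Re b) + pi * A * (- Re (b\<^sup>2))"
    by (simp add: algebra_simps)
  also have "\<dots> \<le> - (pi * A) * (of_int n)\<^sup>2 + pi * A * (2 * \<bar>of_int n\<bar> * R) + pi * A * R\<^sup>2"
  proof (rule add_mono[OF add_mono[OF order_refl mult_left_mono] mult_left_mono])
    have "- 2 * of_int n * Re b \<le> \<bar>2 * of_int n * Re b\<bar>" by linarith
    also have "\<dots> \<le> 2 * \<bar>of_int n\<bar> * R"
      using abs_Re_le_cmod[of b] assms(2) by (simp add: abs_mult mult_left_mono)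
    finally show "- 2 * of_int n * Re b \<le> 2 * \<bar>of_int n\<bar> * R" .
    have "- Re (b\<^sup>2) \<le> norm (b\<^sup>2)" using abs_Re_le_cmod[of "b\<^sup>2"] by linarith
    also have "\<dots> \<le> R\<^sup>2" using assms(2) by (simp add: norm_power power_mono)
    finally show "- Re (b\<^sup>2) \<le> R\<^sup>2" .
  qed (use assms in auto)
  finally show ?thesis by (simp add: norm_exp_eq_Re flip: exp_add) (simp add: algebra_simps)
qed

lemma theta_bound_summable:
  assumes "A > 0"
  shows "(\<lambda>n::int. exp (pi * A * R\<^sup>2) * exp (- (pi * A) * (of_int n)\<^sup>2 + 2 * pi * A * R * \<bar>of_int n\<bar>))
     summable_on UNIV"
  by (intro summable_on_cmult_right summable_on_int_gauss) (use assms in auto)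

lemma theta_abs_summable:
  fixes b :: complex
  assumes "A > 0"
  shows "(\<lambda>n::int. norm (exp (- of_real (pi * A) * (of_int n + b)\<^sup>2))) summable_on UNIV"
  by (rule summable_on_comparison_test[OF theta_bound_summable[OF assms]])
     (use theta_term_bound[OF assms order_refl[of "norm b"]] in auto)

lemma theta_has_sum:
  assumes "A > 0"
  shows "((\<lambda>n::int. exp (- of_real (pi * A) * (of_int n + b)\<^sup>2)) has_sum theta A b) UNIV"
  unfolding theta_def
  by (rule has_sum_infsum[OF abs_summable_summable[OF theta_abs_summable[OF assms]]])

lemma theta_uniform_limit:
  assumes "A > 0"
  shows "uniform_limit (cball 0 R) (\<lambda>X b. \<Sum>n\<in>X. exp (- of_real (pi * A) * (of_int n + b)\<^sup>2))
           (theta A) (finite_subsets_at_top UNIV)"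
  by (rule Weierstrass_m_test_general'[OF theta_term_bound[OF assms] theta_has_sum[OF assms]
        theta_bound_summable[OF assms]]) auto

lemma theta_holomorphic:
  assumes "A > 0"
  shows "theta A holomorphic_on UNIV"
proof -
  have "theta A holomorphic_on ball 0 R" for R
    by (rule holomorphic_uniform_limit[OF _ theta_uniform_limit[OF assms]])
       (auto intro!: always_eventually continuous_intros holomorphic_intros)
  then have "theta A holomorphic_on (\<Union>n\<in>UNIV. ball 0 (real n))"
    by (intro holomorphic_on_UN_open) auto
  also have "(\<Union>n\<in>UNIV. ball 0 (real n)) = (UNIV :: complex set)"
    using reals_Archimedean2 by force
  finally show ?thesis .
qed

lemma theta_add_1:
  assumes "A > 0"
  shows "theta A (b + 1) = theta A b"
  unfolding theta_def
  by (rule infsum_reindex_bij_witness[of _ "\<lambda>n. n - 1" "\<lambda>n. n + 1"]) (auto simp: add_ac)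

text \<open>Quasi-periodicity in the imaginary direction. Expanding the square leaves a cross term
  exp (- 2 pi i j n) = 1. Consequently theta times the j-th character is, up to a constant, theta at
  a shifted argument, so a single primitive of theta yields all Fourier coefficients.\<close>

lemma theta_shift:
  assumes A: "A > 0"
  shows "theta A (b + \<i> * of_int j / of_real A) =
     exp (- 2 * of_real pi * \<i> * of_int j * b + of_real (pi * (of_int j)\<^sup>2 / A)) * theta A b"
proof -
  have "exp (- of_real (pi * A) * (of_int n + (b + \<i> * of_int j / of_real A))\<^sup>2) =
     exp (- 2 * of_real pi * \<i> * of_int j * b + of_real (pi * (of_int j)\<^sup>2 / A)) *
     exp (- of_real (pi * A) * (of_int n + b)\<^sup>2)" for n :: int
  proof -
    have sq: "of_real A * (x + \<i> * y / of_real A)\<^sup>2 = of_real A * x\<^sup>2 + 2 * \<i> * y * x - y\<^sup>2 / of_real A"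
      for x y :: complex
    proof -
      define c where "c = \<i> * y / of_real A"
      have c: "of_real A * c = \<i> * y" using A by (simp add: c_def)
      have "of_real A * (x + c)\<^sup>2 = of_real A * x\<^sup>2 + 2 * (of_real A * c) * x + of_real A * c * c"
        by (simp add: power2_eq_square algebra_simps)
      also have "of_real A * c * c = - (y\<^sup>2 / of_real A)"
      proof -
        have "\<i> * y * (\<i> * y) = - (y * y)" by (simp add: complex_eq_iff)
        then show ?thesis unfolding c by (simp add: c_def power2_eq_square)
      qed
      finally show ?thesis unfolding c by (simp add: c_def)
    qed
    have "- of_real (pi * A) * (of_int n + (b + \<i> * of_int j / of_real A))\<^sup>2 =
      - of_real pi * (of_real A * (of_int n + b + \<i> * of_int j / of_real A)\<^sup>2)"
      by (simp add: add.assoc)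
    also have "\<dots> = (- 2 * of_real pi * \<i> * of_int j * b + of_real (pi * (of_int j)\<^sup>2 / A))
      + - of_real (pi * A) * (of_int n + b)\<^sup>2 + - 2 * of_real pi * \<i> * (of_int (j * n))"
      unfolding sq by (simp add: algebra_simps)
    finally have "- of_real (pi * A) * (of_int n + (b + \<i> * of_int j / of_real A))\<^sup>2 =
      (- 2 * of_real pi * \<i> * of_int j * b + of_real (pi * (of_int j)\<^sup>2 / A))
      + - of_real (pi * A) * (of_int n + b)\<^sup>2 + - 2 * of_real pi * \<i> * (of_int (j * n))" .
    moreover have "exp (- 2 * of_real pi * \<i> * (of_int (j * n))) = 1"
      unfolding exp_eq_1 by (auto intro!: exI[of _ "- (j * n)"])
    ultimately show ?thesis by (simp only: exp_add mult_1_right)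
  qed
  then show ?thesis unfolding theta_def by (simp only: infsum_cmult_right')
qed

lemma has_integral_gauss:
  assumes A: "A > 0"
  shows "((\<lambda>x. exp (- of_real (pi * A) * (of_real x)\<^sup>2)) has_integral complex_of_real (1 / sqrt A)) UNIV"
proof -
  \<comment> \<open>With variance 1 / (2 pi A) the normal density is sqrt A * exp (- pi A
    x^2).\<close>
  define \<sigma> where "\<sigma> = 1 / sqrt (2 * pi * A)"
  have \<sigma>: "\<sigma> > 0" "\<sigma>\<^sup>2 = 1 / (2 * pi * A)" using A by (auto simp: \<sigma>_def power_divide)
  have "(normal_density 0 \<sigma> has_integral 1) UNIV"
    using has_integral_integral_lborel[OF integrable_normal_density[OF \<sigma>(1), of 0]]
      integral_normal_density[OF \<sigma>(1), of 0] by simp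
  then have "((\<lambda>x. normal_density 0 \<sigma> x * (1 / sqrt A)) has_integral 1 * (1 / sqrt A)) UNIV"
    by (rule has_integral_mult_left)
  moreover have "normal_density 0 \<sigma> x * (1 / sqrt A) = exp (- (pi * A) * x\<^sup>2)" for x
    using A unfolding normal_density_def \<sigma>(2) by (simp add: real_sqrt_divide)
  ultimately have "((\<lambda>x. exp (- (pi * A) * x\<^sup>2)) has_integral 1 / sqrt A) UNIV"
    by simp
  then have "((\<lambda>x. complex_of_real (exp (- (pi * A) * x\<^sup>2))) has_integral of_real (1 / sqrt A)) UNIV"
    by (rule has_integral_of_real)
  then show ?thesis by (simp flip: exp_of_real)
qed

text \<open>The zeroth Fourier coefficient by unfolding: the integral of theta over [0, 1] is the
  sum of the Gaussian integrals over [n, n + 1], and these telescope through a primitive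
  \<open>G\<close> to the integral over the whole line.\<close>

lemma theta_primitive_period:
  assumes A: "A > 0" and P: "\<And>z. (P has_field_derivative theta A z) (at z)"
  shows "P 1 - P 0 = of_real (1 / sqrt A)"
proof -
  define E :: "complex \<Rightarrow> complex" where "E = (\<lambda>z. exp (- of_real (pi * A) * z\<^sup>2))"
  have "E holomorphic_on UNIV" unfolding E_def by (intro holomorphic_intros)
  then obtain G where "\<And>z. z \<in> UNIV \<Longrightarrow> (G has_field_derivative E z) (at z within UNIV)"
    using holomorphic_convex_primitive'[OF convex_UNIV open_UNIV] by blast
  then have G: "(G has_field_derivative E z) (at z)" for z by simp
  have ftc: "((\<lambda>x. h (of_real x)) has_integral H (of_real b) - H (of_real a)) {a..b}"
    if "\<And>z. (H has_field_derivative h z) (at z)" "a \<le> b" for h H :: "complex \<Rightarrow> complex" and a b :: real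
    by (intro fundamental_theorem_of_calculus has_vector_derivative_real_field that)
  have int_n: "((\<lambda>x. E (of_int n + of_real x)) has_integral G (of_int n + 1) - G (of_int n)) {0..1}" for n
  proof -
    have "((\<lambda>z. G (z + of_int n)) has_field_derivative E (z + of_int n)) (at z)" for z
      using G[of "z + of_int n"] by (simp only: DERIV_shift)
    from ftc[OF this, of 0 1] show ?thesis by (simp add: add.commute)
  qed
  have ul: "uniform_limit (cbox 0 1) (\<lambda>X x. \<Sum>n\<in>X. E (of_int n + of_real x))
      (\<lambda>x. theta A (of_real x)) (finite_subsets_at_top UNIV)"
    using uniform_limit_compose'[OF theta_uniform_limit[OF A, of 1], of of_real "cbox 0 1"]
    by (simp add: E_def)
  have int_X: "((\<lambda>x. \<Sum>n\<in>X. E (of_int n + of_real x)) has_integral (\<Sum>n\<in>X. G (of_int n + 1) - G (of_int n))) {0..1}"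
    if "finite X" for X using that int_n by (intro has_integral_sum)
  have cont: "continuous_on (cbox 0 (1::real)) (\<lambda>x. \<Sum>n\<in>X. E (of_int n + of_real x))" for X
    unfolding E_def by (intro continuous_intros)
  have t1: "((\<lambda>X. \<Sum>n\<in>X. G (of_int n + 1) - G (of_int n)) \<longlongrightarrow> P 1 - P 0) (finite_subsets_at_top UNIV)"
  proof -
    obtain I J where I: "\<And>X. ((\<lambda>x. \<Sum>n\<in>X. E (of_int n + of_real x)) has_integral I X) (cbox (0::real) 1)"
      and J: "((\<lambda>x. theta A (of_real x)) has_integral J) (cbox 0 1)"
      and lim: "(I \<longlongrightarrow> J) (finite_subsets_at_top UNIV)"
      using uniform_limit_integral_cbox[OF ul cont] by auto
    have "J = P 1 - P 0"
      using has_integral_unique[OF J] ftc[of P "theta A" 0 1] P by simp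
    moreover have "I X = (\<Sum>n\<in>X. G (of_int n + 1) - G (of_int n))" if "finite X" for X
      using has_integral_unique[OF I] int_X[OF that] by simp
    then have "\<forall>\<^sub>F X in finite_subsets_at_top UNIV. I X = (\<Sum>n\<in>X. G (of_int n + 1) - G (of_int n))"
      by (intro eventually_finite_subsets_at_top_weakI) auto
    ultimately show ?thesis using lim by (simp add: tendsto_cong)
  qed
  have tele: "(\<Sum>n\<in>{1 - int N..int N}. G (of_int n + 1) - G (of_int n)) = G (of_nat N + 1) - G (1 - of_nat N)" for N
  proof (induction N)
    case (Suc N)
    have "{1 - int (Suc N)..int (Suc N)} = insert (- int N) (insert (int N + 1) {1 - int N..int N})"
      by auto
    then show ?case using Suc.IH by (simp add: algebra_simps)
  qed simp
  have t2: "(\<lambda>N. G (of_nat N + 1) - G (1 - of_nat N)) \<longlonglongrightarrow> P 1 - P 0"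
    using filterlim_compose[OF t1 filterlim_int_intervals_finite_subsets] by (simp add: tele)
  have "(\<lambda>N. G (of_nat N + 1) - G (1 - of_nat N)) \<longlonglongrightarrow> complex_of_real (1 / sqrt A)"
  proof (rule LIMSEQ_I)
    fix e :: real assume "e > 0"
    then obtain B where B: "B > 0" "\<And>a b. ball 0 B \<subseteq> cbox a b \<Longrightarrow>
       norm (integral (cbox a b) (\<lambda>x. E (of_real x)) - complex_of_real (1 / sqrt A)) < e"
      using has_integral_gauss[OF A] unfolding has_integral_alt'[of _ _ UNIV] E_def by auto
    show "\<exists>no. \<forall>n\<ge>no. norm (G (of_nat n + 1) - G (1 - of_nat n) - complex_of_real (1 / sqrt A)) < e"
    proof (intro exI allI impI)
      fix N assume "N \<ge> nat \<lceil>B\<rceil> + 1"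
      then have N: "real N \<ge> B + 1" "N \<ge> 1" by linarith+
      have "integral (cbox (1 - real N) (real N + 1)) (\<lambda>x. E (of_real x)) = G (of_nat N + 1) - G (1 - of_nat N)"
        using integral_unique[OF ftc[of G E "1 - real N" "real N + 1", OF G]] N by simp
      moreover have "ball 0 B \<subseteq> cbox (1 - real N) (real N + 1)" using N by auto
      ultimately show "norm (G (of_nat N + 1) - G (1 - of_nat N) - complex_of_real (1 / sqrt A)) < e"
        using B(2) by metis
    qed
  qed
  then show ?thesis using t2 LIMSEQ_unique by blast
qed

text \<open>Poisson summation for a Gaussian with complex shift. By \<open>theta_shift\<close> the
  primitive required for the j-th coefficient is \<open>K j\<close> times a translate of one
  primitive \<open>P\<close> of theta, so every coefficient is \<open>K j\<close> times the same
  unit increment 1 / sqrt A.\<close>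

theorem theta_inversion:
  assumes A: "A > 0"
  shows "((\<lambda>j::int. exp (- of_real (pi * (of_int j)\<^sup>2 / A) + 2 * of_real pi * \<i> * of_int j * b))
     has_sum of_real (sqrt A) * theta A b) UNIV"
proof -
  obtain P where "\<And>z. z \<in> UNIV \<Longrightarrow> (P has_field_derivative theta A z) (at z within UNIV)"
    using holomorphic_convex_primitive'[OF convex_UNIV open_UNIV theta_holomorphic[OF A]] by blast
  then have P: "(P has_field_derivative theta A z) (at z)" for z by simp
  \<comment> \<open>The unit increment of \<open>P\<close> has derivative 0 by periodicity of theta;
    hence it is the same at all complex points and equals its value at 0.\<close>
  have "((\<lambda>z. P (z + 1) - P z) has_field_derivative 0) (at z)" for z
    using P[of z] P[of "z + 1"] theta_add_1[OF A, of z]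
    by (auto intro!: derivative_eq_intros simp: DERIV_shift)
  then obtain c where "\<And>z. P (z + 1) - P z = c"
    using has_field_derivative_zero_constant[OF convex_UNIV, of "\<lambda>z. P (z + 1) - P z"] by auto
  then have Pdiff: "P (z + 1) - P z = of_real (1 / sqrt A)" for z
    using theta_primitive_period[OF A P] by (metis add_0)
  define s where "s = (\<lambda>j::int. \<i> * of_int j / of_real A)"
  define K where "K = (\<lambda>j::int. exp (- of_real (pi * (of_int j)\<^sup>2 / A) + 2 * of_real pi * \<i> * of_int j * b))"
  define Q where "Q = (\<lambda>j z. K j * P (z + b + s j))"
  have "((\<lambda>j. K j * of_real (1 / sqrt A)) has_sum theta A (0 + b)) UNIV"
  proof (rule fourier_expansion_at_0[where f = "\<lambda>z. theta A (z + b)" and Q = Q])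
    show "(\<lambda>z. theta A (z + b)) holomorphic_on UNIV"
    proof -
      have "(theta A \<circ> (\<lambda>z. z + b)) holomorphic_on UNIV"
        by (intro holomorphic_on_compose holomorphic_on_subset[OF theta_holomorphic[OF A]] holomorphic_intros) simp
      then show ?thesis by (simp add: o_def)
    qed
    show "theta A (z + 1 + b) = theta A (z + b)" for z
      using theta_add_1[OF A, of "z + b"] by (simp add: add_ac)
    show "(Q j has_field_derivative theta A (z + b) * exp (- 2 * of_real pi * \<i> * of_int j * z)) (at z)" for j z
    proof -
      have "(Q j has_field_derivative K j * theta A (z + b + s j)) (at z)"
        unfolding Q_def using P[of "z + b + s j"] DERIV_shift[of P _ z "b + s j"]
        by (intro DERIV_cmult) (simp add: add.assoc)
      also have "K j * theta A (z + b + s j) = theta A (z + b) * exp (- 2 * of_real pi * \<i> * of_int j * z)"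
        unfolding K_def s_def theta_shift[OF A] mult.assoc[symmetric] exp_add[symmetric]
        by (simp add: algebra_simps)
      finally show ?thesis .
    qed
    show "Q j (w + 1) - Q j w = K j * of_real (1 / sqrt A)" for j w
      using Pdiff[of "w + b + s j"] unfolding Q_def right_diff_distrib[symmetric]
      by (simp add: add_ac)
    have "(\<lambda>j. norm (K j)) summable_on UNIV"
    proof (rule summable_on_comparison_test)
      show "(\<lambda>j::int. exp (- (pi / A) * (of_int j)\<^sup>2 + (2 * pi * norm b) * \<bar>of_int j\<bar>)) summable_on UNIV"
        by (rule summable_on_int_gauss) (use A in auto)
      show "norm (K j) \<le> exp (- (pi / A) * (of_int j)\<^sup>2 + (2 * pi * norm b) * \<bar>of_int j\<bar>)" for j
      proof -
        have "- (of_int j * Im b) \<le> \<bar>of_int j * Im b\<bar>" by linarith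
        also have "\<dots> \<le> \<bar>of_int j\<bar> * norm b"
          using abs_Im_le_cmod[of b] by (simp add: abs_mult mult_left_mono)
        finally have "2 * pi * (- (of_int j * Im b)) \<le> 2 * pi * (\<bar>of_int j\<bar> * norm b)"
          by (intro mult_left_mono) auto
        then show ?thesis by (simp add: K_def norm_exp_eq_Re mult_ac)
      qed
    qed auto
    then show "(\<lambda>j. K j * of_real (1 / sqrt A)) summable_on UNIV"
      by (intro summable_on_cmult_left) (rule abs_summable_summable)
  qed
  then have "((\<lambda>j. K j * of_real (1 / sqrt A) * of_real (sqrt A)) has_sum theta A b * of_real (sqrt A)) UNIV"
    by (intro has_sum_cmult_left) simp
  moreover have "K j * of_real (1 / sqrt A) * of_real (sqrt A) = K j" for j
    using A by (simp flip: of_real_mult)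
  ultimately show ?thesis by (simp add: K_def mult.commute)
qed

section \<open>Theta series of planar lattices\<close>

definition lattice_pt :: "complex \<Rightarrow> int \<times> int \<Rightarrow> complex" where
  "lattice_pt \<tau> = (\<lambda>(m, n). of_int m * \<tau> + of_int n)"

section \<open>Comparison of lattice points with integer pairs, and convergence of lattice
  sums\<close>

lemma lattice_pt_lower_bound:
  assumes "Im \<tau> > 0"
  shows "\<exists>K>0. \<forall>m n. (of_int m)\<^sup>2 + (of_int n)\<^sup>2 \<le> K * (norm (lattice_pt \<tau> (m, n)))\<^sup>2"
proof -
  define x y where "x = Re \<tau>" and "y = Im \<tau>"
  have y: "y > 0" using assms by (simp add: y_def)
  have "2 + (2 * x\<^sup>2 + 1) / y\<^sup>2 > 0" using y by (intro add_pos_nonneg) auto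
  moreover have "(of_int m)\<^sup>2 + (of_int n)\<^sup>2 \<le> (2 + (2 * x\<^sup>2 + 1) / y\<^sup>2) * (norm (lattice_pt \<tau> (m, n)))\<^sup>2" for m n :: int
  proof -
    define a b where "a = of_int m * x + of_int n" and "b = of_int m * y"
    have w: "(norm (lattice_pt \<tau> (m, n)))\<^sup>2 = a\<^sup>2 + b\<^sup>2"
      by (simp add: lattice_pt_def cmod_power2 a_def b_def x_def y_def)
    \<comment> \<open>Solving for the integer coordinates in terms of the imaginary part
      \<open>b\<close> and the real part \<open>a\<close> of the lattice point is where y > 0
      enters; the constant K then comes from (a - c)^2 <= 2 a^2 + 2 c^2.\<close>
    have m: "of_int m = b / y" using y by (simp add: b_def)
    have n: "of_int n = a - b / y * x" using y by (simp add: a_def b_def)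
    have "(a - c)\<^sup>2 \<le> 2 * a\<^sup>2 + 2 * c\<^sup>2" for c
      using zero_le_power2[of "a + c"] by (simp add: power2_eq_square algebra_simps)
    from this[of "b / y * x"] have "(of_int m)\<^sup>2 + (of_int n)\<^sup>2 \<le> 2 * a\<^sup>2 + (2 * x\<^sup>2 + 1) / y\<^sup>2 * b\<^sup>2"
      unfolding m n by (simp add: power_divide power_mult_distrib add_divide_distrib algebra_simps)
    also have "\<dots> \<le> (2 + (2 * x\<^sup>2 + 1) / y\<^sup>2) * (a\<^sup>2 + b\<^sup>2)"
    proof -
      have "2 * a\<^sup>2 + C * b\<^sup>2 \<le> (2 + C) * (a\<^sup>2 + b\<^sup>2)" if "C \<ge> 0" for C
        using mult_nonneg_nonneg[OF that zero_le_power2[of a]] by (simp add: algebra_simps)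
      from this[of "(2 * x\<^sup>2 + 1) / y\<^sup>2"] show ?thesis by (auto simp: add_nonneg_nonneg)
    qed
    finally show ?thesis unfolding w .
  qed
  ultimately show ?thesis by blast
qed

lemma lattice_pt_eq_0_iff:
  assumes "Im \<tau> > 0"
  shows "lattice_pt \<tau> x = 0 \<longleftrightarrow> x = (0, 0)"
proof -
  obtain m n where x: "x = (m, n)" by fastforce
  have "m = 0 \<and> n = 0" if "lattice_pt \<tau> (m, n) = 0"
    using assms that by (auto simp: lattice_pt_def complex_eq_iff)
  then show ?thesis by (auto simp: x lattice_pt_def)
qed

lemma summable_on_prod_int_powr:
  fixes \<sigma> :: real
  assumes "\<sigma> > 1"
  shows "(\<lambda>(m::int, n::int). max 1 \<bar>of_int m\<bar> powr (-\<sigma>) * max 1 \<bar>of_int n\<bar> powr (-\<sigma>)) summable_on UNIV"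
proof -
  obtain S where S: "((\<lambda>n::int. max 1 \<bar>of_int n\<bar> powr (-\<sigma>)) has_sum S) UNIV"
    using summable_on_int_powr[OF assms] by (auto simp: summable_on_def)
  have "(\<lambda>(m::int, n::int). max 1 \<bar>of_int m\<bar> powr (-\<sigma>) * max 1 \<bar>of_int n\<bar> powr (-\<sigma>)) summable_on (UNIV \<times> UNIV)"
    by (rule summable_on_SigmaI[where g = "\<lambda>m. max 1 \<bar>of_int m\<bar> powr (-\<sigma>) * S"])
       (auto intro!: has_sum_cmult_right S summable_on_cmult_left summable_on_int_powr assms)
  then show ?thesis by simp
qed

text \<open>The planar sum is dominated by a product of two one-dimensional ones: with coordinates
  truncated by \<open>max 1\<close>, their product is at most m^2 + n^2 and so at most K r^2.
  Raising to the power - \<sigma> separates the variables and loses nothing of the range \<sigma> >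
  1.\<close>

lemma lattice_powr_summable:
  assumes \<tau>: "Im \<tau> > 0" and \<sigma>: "\<sigma> > 1"
  shows "(\<lambda>x. norm (lattice_pt \<tau> x) powr (- 2 * \<sigma>)) summable_on (- {(0, 0)})"
proof -
  from lattice_pt_lower_bound[OF \<tau>] obtain K where K: "K > 0"
    "\<forall>m n. (of_int m)\<^sup>2 + (of_int n)\<^sup>2 \<le> K * (norm (lattice_pt \<tau> (m, n)))\<^sup>2"
    by (elim exE conjE)
  have summ: "(\<lambda>(m::int, n::int). K powr \<sigma> * (max 1 \<bar>of_int m\<bar> powr (-\<sigma>) * max 1 \<bar>of_int n\<bar> powr (-\<sigma>))) summable_on (- {(0, 0)})"
    using summable_on_subset[OF summable_on_cmult_right[OF summable_on_prod_int_powr[OF \<sigma>],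
      of "K powr \<sigma>"] subset_UNIV]
    by (simp add: case_prod_unfold)
  have "norm (lattice_pt \<tau> x) powr (- 2 * \<sigma>) \<le> (case x of (m, n) \<Rightarrow>
      K powr \<sigma> * (max 1 \<bar>of_int m\<bar> powr (-\<sigma>) * max 1 \<bar>of_int n\<bar> powr (-\<sigma>)))"
    if x_in: "x \<in> - {(0, 0)}" for x
  proof -
  from x_in obtain m n where x: "x = (m, n)" and mn: "m \<noteq> 0 \<or> n \<noteq> 0" by (cases x) auto
  define r where "r = norm (lattice_pt \<tau> (m, n))"
  have r: "r > 0" using mn lattice_pt_eq_0_iff[OF \<tau>, of "(m, n)"] by (auto simp: r_def)
  define a b where "a = max 1 \<bar>real_of_int m\<bar>" and "b = max 1 \<bar>real_of_int n\<bar>"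
  have ab: "a \<ge> 1" "b \<ge> 1" by (auto simp: a_def b_def)
  have "a * b \<le> (of_int m)\<^sup>2 + (of_int n)\<^sup>2"
  proof -
    have sq: "\<bar>real_of_int i\<bar> \<le> (of_int i)\<^sup>2" for i :: int
    proof (cases "i = 0")
      case False
      then have "1 \<le> \<bar>real_of_int i\<bar>" by linarith
      then have "\<bar>real_of_int i\<bar> * 1 \<le> \<bar>real_of_int i\<bar> * \<bar>real_of_int i\<bar>" by (intro mult_left_mono) auto
      then show ?thesis by (simp add: power2_eq_square)
    qed auto
    show ?thesis
    proof (cases "m = 0 \<or> n = 0")
      case True
      then show ?thesis
      proof
        assume "m = 0"
        moreover from this mn have "1 \<le> \<bar>real_of_int n\<bar>" by linarith
        ultimately show ?thesis using sq[of n] by (simp add: a_def b_def max_def)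
      next
        assume "n = 0"
        moreover from this mn have "1 \<le> \<bar>real_of_int m\<bar>" by linarith
        ultimately show ?thesis using sq[of m] by (simp add: a_def b_def max_def)
      qed
    next
      case False
      then have "1 \<le> \<bar>real_of_int m\<bar>" "1 \<le> \<bar>real_of_int n\<bar>" by linarith+
      then have eqs: "a = \<bar>of_int m\<bar>" "b = \<bar>of_int n\<bar>" by (auto simp: a_def b_def)
      have "2 * (\<bar>real_of_int m\<bar> * \<bar>real_of_int n\<bar>) \<le> (of_int m)\<^sup>2 + (of_int n)\<^sup>2"
        using zero_le_power2[of "\<bar>real_of_int m\<bar> - \<bar>real_of_int n\<bar>"] by (simp add: power2_diff)
      moreover have "0 \<le> \<bar>real_of_int m\<bar> * \<bar>real_of_int n\<bar>" by simp
      ultimately show ?thesis unfolding eqs by linarith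
    qed
  qed
  also have "\<dots> \<le> K * r\<^sup>2" using K(2) by (simp add: r_def)
  finally have le: "(K * r\<^sup>2) powr (-\<sigma>) \<le> (a * b) powr (-\<sigma>)"
    using ab \<sigma> by (intro powr_mono2') auto
  have eq: "(K * r\<^sup>2) powr (-\<sigma>) = r powr (- 2 * \<sigma>) / K powr \<sigma>"
  proof -
    have "r\<^sup>2 = r powr 2" using r by (simp add: powr_numeral)
    then have "r\<^sup>2 powr (-\<sigma>) = r powr (- 2 * \<sigma>)" by (simp only: powr_powr) simp
    moreover have "(K * r\<^sup>2) powr (-\<sigma>) = K powr (-\<sigma>) * r\<^sup>2 powr (-\<sigma>)"
      by (rule powr_mult)
    ultimately show ?thesis by (simp only: powr_minus[of K] divide_inverse mult.commute)
  qed
  have "r powr (- 2 * \<sigma>) = K powr \<sigma> * (K * r\<^sup>2) powr (-\<sigma>)"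
    unfolding eq using K(1) by simp
  also have "\<dots> \<le> K powr \<sigma> * (a * b) powr (-\<sigma>)"
    using le by (intro mult_left_mono) auto
  also have "(a * b) powr (-\<sigma>) = a powr (-\<sigma>) * b powr (-\<sigma>)" by (rule powr_mult)
  finally have "r powr (- 2 * \<sigma>) \<le> K powr \<sigma> * (a powr (-\<sigma>) * b powr (-\<sigma>))" .
  then show ?thesis
    by (simp add: x r_def a_def b_def)
  qed
  then show ?thesis
    by (rule summable_on_comparison_test[OF summ]) auto
qed

text \<open>The linear term in the exponent leaves room for a factor exp(alpha * cnj w), and for
  powers of |w| through r^k <= k! * exp r.\<close>

lemma lattice_gauss_summable:
  fixes c d :: real
  assumes \<tau>: "Im \<tau> > 0" and c: "c > 0"
  shows "(\<lambda>x. exp (- c * (norm (lattice_pt \<tau> x))\<^sup>2 + d * norm (lattice_pt \<tau> x))) summable_on UNIV"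
proof -
  define f where "f = (\<lambda>x. exp (- c * (norm (lattice_pt \<tau> x))\<^sup>2 + d * norm (lattice_pt \<tau> x)))"
  have "f summable_on (- {(0, 0)})"
  proof (rule summable_on_comparison_test)
    show "(\<lambda>x. (8 / c\<^sup>2 * exp (d\<^sup>2 / (2 * c))) * norm (lattice_pt \<tau> x) powr (- 2 * 2)) summable_on (- {(0, 0)})"
      by (intro summable_on_cmult_right lattice_powr_summable \<tau>) simp
    show "f x \<le> (8 / c\<^sup>2 * exp (d\<^sup>2 / (2 * c))) * norm (lattice_pt \<tau> x) powr (- 2 * 2)" if "x \<in> - {(0, 0)}" for x
      using exp_neg_square_le_powr[OF c, of "norm (lattice_pt \<tau> x)" d] that lattice_pt_eq_0_iff[OF \<tau>, of x]
      by (simp add: f_def)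
  qed (auto simp: f_def)
  then have "f summable_on (insert (0, 0) (- {(0, 0)}))"
    by (subst summable_on_insert_iff)
  also have "insert (0, 0) (- {(0, 0)}) = (UNIV :: (int \<times> int) set)" by auto
  finally show ?thesis by (simp add: f_def)
qed

lemma power_le_fact_mult_exp:
  fixes r :: real
  assumes "r \<ge> 0"
  shows "r ^ k \<le> fact k * exp r"
proof -
  have "(\<lambda>n. r ^ n /\<^sub>R fact n) sums exp r" by (rule exp_converges)
  then have "r ^ k /\<^sub>R fact k \<le> exp r"
    using assms sum_le_suminf[of "\<lambda>n. r ^ n /\<^sub>R fact n" "{k}"]
    by (simp add: sums_iff)
  then show ?thesis by (simp add: field_simps)
qed

lemma lattice_gauss_power_summable:
  fixes c :: real
  assumes \<tau>: "Im \<tau> > 0" and c: "c > 0"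
  shows "(\<lambda>x. norm (lattice_pt \<tau> x) ^ k * exp (- c * (norm (lattice_pt \<tau> x))\<^sup>2)) summable_on UNIV"
proof (rule summable_on_comparison_test)
  show "(\<lambda>x. fact k * exp (- c * (norm (lattice_pt \<tau> x))\<^sup>2 + 1 * norm (lattice_pt \<tau> x))) summable_on UNIV"
    by (intro summable_on_cmult_right lattice_gauss_summable \<tau> c)
  show "norm (lattice_pt \<tau> x) ^ k * exp (- c * (norm (lattice_pt \<tau> x))\<^sup>2)
      \<le> fact k * exp (- c * (norm (lattice_pt \<tau> x))\<^sup>2 + 1 * norm (lattice_pt \<tau> x))" for x
    using mult_right_mono[OF power_le_fact_mult_exp[of "norm (lattice_pt \<tau> x)" k],
       of "exp (- c * (norm (lattice_pt \<tau> x))\<^sup>2)"]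
    unfolding exp_add by (simp add: mult_ac)
qed auto

text \<open>The factor \<open>exp (\<alpha> * cnj w)\<close> is harmonic in the lattice point \<open>w\<close>, so the inversion formula of \<open>lattice_gen\<close> needs no correction term, and expanding it in \<open>\<alpha>\<close> yields
  the theta series with all harmonic polynomial weights at once.\<close>

definition lattice_gen :: "complex \<Rightarrow> real \<Rightarrow> complex \<Rightarrow> complex" where
  "lattice_gen \<tau> t \<alpha> = (\<Sum>\<^sub>\<infinity>x. exp (- of_real (pi * t / Im \<tau> * (norm (lattice_pt \<tau> x))\<^sup>2) + \<alpha> * cnj (lattice_pt \<tau> x)))"

text \<open>The summand after Poisson summation in n: m is still a lattice coordinate and j is the
  frequency dual to n. The Gaussian part is invariant under t -> 1/t together with m <-> j, and the
  phase in j m is symmetric.\<close>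

definition lattice_dual_term :: "complex \<Rightarrow> real \<Rightarrow> complex \<Rightarrow> int \<times> int \<Rightarrow> complex" where
  "lattice_dual_term \<tau> t \<alpha> = (\<lambda>(m, j).
     exp (- of_real (pi * Im \<tau> * ((of_int j)\<^sup>2 / t + t * (of_int m)\<^sup>2))
       + 2 * of_real pi * \<i> * of_int j * of_int m * of_real (Re \<tau>)
       - \<i> * \<alpha> * of_real (Im \<tau> * (of_int j / t + of_int m))))"

lemma lattice_gen_term_norm:
  "norm (exp (- of_real (c * (norm (lattice_pt \<tau> x))\<^sup>2) + \<alpha> * cnj (lattice_pt \<tau> x)))
     \<le> exp (- c * (norm (lattice_pt \<tau> x))\<^sup>2 + norm \<alpha> * norm (lattice_pt \<tau> x))"
proof -
  have "Re (\<alpha> * cnj (lattice_pt \<tau> x)) \<le> norm (\<alpha> * cnj (lattice_pt \<tau> x))" by (rule complex_Re_le_cmod)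
  then show ?thesis unfolding norm_exp_eq_Re plus_complex.sel by (simp add: norm_mult)
qed

lemma lattice_gen_abs_summable:
  assumes \<tau>: "Im \<tau> > 0" and c: "c > 0"
  shows "(\<lambda>x. norm (exp (- of_real (c * (norm (lattice_pt \<tau> x))\<^sup>2) + \<alpha> * cnj (lattice_pt \<tau> x)))) summable_on UNIV"
  by (rule summable_on_comparison_test[OF lattice_gauss_summable[OF \<tau> c, of "norm \<alpha>"] lattice_gen_term_norm]) auto

text \<open>The Gaussian integers serve as a model lattice, since |lattice_pt \<i> (m, j)|^2 = m^2 +
  j^2. The constant \<open>c\<close> takes the smaller of the two coefficients t and 1/t, and
  \<open>d\<close> bounds the linear term in \<alpha>.\<close>

lemma lattice_dual_abs_summable:
  assumes \<tau>: "Im \<tau> > 0" and t: "t > 0"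
  shows "(\<lambda>x. norm (lattice_dual_term \<tau> t \<alpha> x)) summable_on UNIV"
proof -
  define y where "y = Im \<tau>"
  define c where "c = pi * y * min t (1 / t)"
  define d where "d = y * norm \<alpha> * (1 / t + 1)"
  have y: "y > 0" using \<tau> by (simp add: y_def)
  have c: "c > 0" using y t by (simp add: c_def)
  have "norm (lattice_dual_term \<tau> t \<alpha> x) \<le>
      exp (- c * (norm (lattice_pt \<i> x))\<^sup>2 + d * norm (lattice_pt \<i> x))" for x
  proof -
    obtain m j where x: "x = (m, j)" by fastforce
    define r where "r = norm (lattice_pt \<i> x)"
    have r2: "r\<^sup>2 = (of_int m)\<^sup>2 + (of_int j)\<^sup>2" by (simp add: r_def x lattice_pt_def cmod_power2)
    have r0: "r \<ge> 0" by (simp add: r_def)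
    have mj: "\<bar>of_int m\<bar> \<le> r" "\<bar>of_int j\<bar> \<le> r"
      by (rule power2_le_imp_le[OF _ r0]; simp add: r2)+
    have "norm (lattice_dual_term \<tau> t \<alpha> x) =
        exp (- (pi * y * ((of_int j)\<^sup>2 / t + t * (of_int m)\<^sup>2)) + y * (of_int j / t + of_int m) * Im \<alpha>)"
      by (simp add: lattice_dual_term_def x norm_exp_eq_Re y_def mult_ac)
    also have "\<dots> \<le> exp (- c * r\<^sup>2 + d * r)"
    proof -
      have "min t (1 / t) * (of_int j)\<^sup>2 \<le> 1 / t * (of_int j)\<^sup>2"
        "min t (1 / t) * (of_int m)\<^sup>2 \<le> t * (of_int m)\<^sup>2"
        by (intro mult_right_mono; simp)+
      then have "min t (1 / t) * r\<^sup>2 \<le> (of_int j)\<^sup>2 / t + t * (of_int m)\<^sup>2"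
        by (simp add: r2 distrib_left)
      then have "pi * y * (min t (1 / t) * r\<^sup>2) \<le> pi * y * ((of_int j)\<^sup>2 / t + t * (of_int m)\<^sup>2)"
        using y by (intro mult_left_mono) auto
      then have 1: "c * r\<^sup>2 \<le> pi * y * ((of_int j)\<^sup>2 / t + t * (of_int m)\<^sup>2)"
        by (simp only: c_def mult.assoc)
      have "\<bar>of_int j / t + of_int m\<bar> \<le> \<bar>of_int j\<bar> / t + \<bar>of_int m\<bar>"
        using abs_triangle_ineq[of "of_int j / t" "of_int m"] t by simp
      also have "\<dots> \<le> r / t + r" using mj t by (intro add_mono divide_right_mono) auto
      finally have "\<bar>of_int j / t + of_int m\<bar> * \<bar>Im \<alpha>\<bar> \<le> (r / t + r) * norm \<alpha>"
        using abs_Im_le_cmod[of \<alpha>] r0 t by (intro mult_mono) auto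
      then have "(of_int j / t + of_int m) * Im \<alpha> \<le> (r / t + r) * norm \<alpha>"
        using abs_ge_self[of "(of_int j / t + of_int m) * Im \<alpha>"] unfolding abs_mult by (rule order_trans[rotated])
      then have "y * ((of_int j / t + of_int m) * Im \<alpha>) \<le> y * ((r / t + r) * norm \<alpha>)"
        using y by (intro mult_left_mono) auto
      also have "\<dots> = d * r" by (simp add: d_def algebra_simps)
      finally have "y * (of_int j / t + of_int m) * Im \<alpha> \<le> d * r" by (simp only: mult.assoc)
      with 1 show ?thesis by simp
    qed
    finally show ?thesis by (simp add: r_def)
  qed
  then show ?thesis
    by (intro summable_on_comparison_test[OF lattice_gauss_summable[of \<i> c d]]) (use c in auto)
qed

lemma complete_square:
  fixes s X \<alpha> :: complex
  assumes "s \<noteq> 0"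
  shows "- s * (X - \<alpha> / (2 * s))\<^sup>2 = - s * X\<^sup>2 + \<alpha> * X - \<alpha>\<^sup>2 / (4 * s)"
  using assms by (simp add: power2_eq_square field_simps)

text \<open>For fixed m, completing the square in n gives a one-dimensional theta series with A = t
  / Im \<tau> and the complex shift \<open>b m\<close>; \<open>theta_inversion\<close> replaces it
  by a sum over j. The factor \<open>e\<close> left by the square does not depend on m. Absolute
  convergence of both double sums allows the inner sum to be taken separately.\<close>

lemma lattice_gen_fourier:
  assumes \<tau>: "Im \<tau> > 0" and t: "t > 0"
  shows "of_real (sqrt (t / Im \<tau>)) * lattice_gen \<tau> t \<alpha> =
     exp (\<alpha>\<^sup>2 * of_real (Im \<tau>) / of_real (4 * pi * t)) * (\<Sum>\<^sub>\<infinity>x. lattice_dual_term \<tau> t \<alpha> x)"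
proof -
  define x y A where "x = Re \<tau>" and "y = Im \<tau>" and "A = t / y"
  have y: "y > 0" using \<tau> by (simp add: y_def)
  have A: "A > 0" using y t by (simp add: A_def)
  define s where "s = complex_of_real (pi * A)"
  have s: "s \<noteq> 0" using A by (simp add: s_def)
  define e where "e = exp (\<alpha>\<^sup>2 / (4 * s))"
  define b where "b = (\<lambda>m::int. of_int m * of_real x - \<alpha> / (2 * s))"
  define C where "C = (\<lambda>m::int. exp (- of_real (pi * A * (of_int m * y)\<^sup>2) - \<i> * \<alpha> * of_real (of_int m * y)))"
  define E where "E = (\<lambda>p. exp (- of_real (pi * t / Im \<tau> * (norm (lattice_pt \<tau> p))\<^sup>2) + \<alpha> * cnj (lattice_pt \<tau> p)))"
  have E: "E (m, n) = e * C m * exp (- s * (of_int n + b m)\<^sup>2)" for m n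
  proof -
    define X where "X = of_int m * complex_of_real x + of_int n"
    have Xr: "X = of_real (of_int m * x + of_int n)" by (simp add: X_def)
    have w: "cnj (lattice_pt \<tau> (m, n)) = X - \<i> * of_real (of_int m * y)"
      by (simp add: lattice_pt_def X_def x_def y_def complex_eq_iff)
    have "of_real ((norm (lattice_pt \<tau> (m, n)))\<^sup>2) = X\<^sup>2 + of_real ((of_int m * y)\<^sup>2)"
      unfolding Xr of_real_power[symmetric] of_real_add[symmetric] of_real_eq_iff
      by (simp add: lattice_pt_def cmod_power2 x_def y_def)
    then have "- of_real (pi * t / Im \<tau> * (norm (lattice_pt \<tau> (m, n)))\<^sup>2) = - s * (X\<^sup>2 + of_real ((of_int m * y)\<^sup>2))"
      by (simp add: s_def A_def y_def)
    moreover have "of_int n + b m = X - \<alpha> / (2 * s)" by (simp add: b_def X_def)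
    ultimately have "- of_real (pi * t / Im \<tau> * (norm (lattice_pt \<tau> (m, n)))\<^sup>2) + \<alpha> * cnj (lattice_pt \<tau> (m, n))
       = \<alpha>\<^sup>2 / (4 * s) + (- of_real (pi * A * (of_int m * y)\<^sup>2) - \<i> * \<alpha> * of_real (of_int m * y)) + - s * (of_int n + b m)\<^sup>2"
      by (simp only: complete_square[OF s] w) (simp add: s_def algebra_simps)
    then show ?thesis by (simp only: E_def e_def C_def exp_add[symmetric])
  qed
  have "E summable_on UNIV"
    unfolding E_def
    by (rule abs_summable_summable, rule lattice_gen_abs_summable[OF \<tau>]) (use \<tau> t in simp)
  then have "(E has_sum lattice_gen \<tau> t \<alpha>) (UNIV \<times> UNIV)"
    unfolding lattice_gen_def E_def by (simp add: has_sum_infsum)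
  then have 1: "((\<lambda>m. e * C m * theta A (b m)) has_sum lattice_gen \<tau> t \<alpha>) UNIV"
  proof (rule has_sum_SigmaD)
    show "((\<lambda>n. E (m, n)) has_sum e * C m * theta A (b m)) UNIV" for m
      unfolding E s_def by (intro has_sum_cmult_right theta_has_sum A)
  qed
  define K where "K = lattice_dual_term \<tau> t \<alpha>"
  have K: "K (m, j) = C m * exp (- of_real (pi * (of_int j)\<^sup>2 / A) + 2 * of_real pi * \<i> * of_int j * b m)" for m j
  proof -
    have ay: "\<alpha> / (2 * s) * (2 * of_real pi) = \<alpha> * of_real (y / t)"
      using t y by (simp add: s_def A_def field_simps)
    have "2 * of_real pi * \<i> * of_int j * (v - a) = 2 * of_real pi * \<i> * of_int j * v - \<i> * of_int j * (a * (2 * of_real pi))"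
      for v a :: complex by (simp add: algebra_simps)
    then have "2 * of_real pi * \<i> * of_int j * b m =
      2 * of_real pi * \<i> * of_int j * of_int m * of_real x - \<i> * of_int j * (\<alpha> * of_real (y / t))"
      unfolding b_def ay[symmetric] by (simp only: mult.assoc)
    moreover have "pi * y * ((of_int j)\<^sup>2 / t + t * (of_int m)\<^sup>2) = pi * A * (of_int m * y)\<^sup>2 + pi * (of_int j)\<^sup>2 / A"
      using t y by (simp add: A_def field_simps power2_eq_square)
    moreover have "y * (of_int j / t + of_int m) = of_int j * (y / t) + of_int m * y"
      by (simp add: algebra_simps)
    ultimately have "- of_real (pi * Im \<tau> * ((of_int j)\<^sup>2 / t + t * (of_int m)\<^sup>2))
       + 2 * of_real pi * \<i> * of_int j * of_int m * of_real (Re \<tau>)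
       - \<i> * \<alpha> * of_real (Im \<tau> * (of_int j / t + of_int m)) =
       (- of_real (pi * A * (of_int m * y)\<^sup>2) - \<i> * \<alpha> * of_real (of_int m * y))
       + (- of_real (pi * (of_int j)\<^sup>2 / A) + 2 * of_real pi * \<i> * of_int j * b m)"
      unfolding x_def[symmetric] y_def[symmetric] by (simp add: algebra_simps)
    then show ?thesis by (simp only: K_def lattice_dual_term_def prod.case C_def exp_add[symmetric])
  qed
  have "K summable_on UNIV"
    unfolding K_def by (rule abs_summable_summable[OF lattice_dual_abs_summable[OF \<tau> t]])
  then have "(K has_sum infsum K UNIV) (UNIV \<times> UNIV)" by (simp add: has_sum_infsum)
  then have "((\<lambda>m. C m * (of_real (sqrt A) * theta A (b m))) has_sum infsum K UNIV) UNIV"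
  proof (rule has_sum_SigmaD)
    show "((\<lambda>n. K (m, n)) has_sum C m * (of_real (sqrt A) * theta A (b m))) UNIV" for m
      unfolding K by (intro has_sum_cmult_right theta_inversion A)
  qed
  then have "((\<lambda>m. e * (C m * (of_real (sqrt A) * theta A (b m)))) has_sum e * infsum K UNIV) UNIV"
    by (rule has_sum_cmult_right)
  moreover have "((\<lambda>m. of_real (sqrt A) * (e * C m * theta A (b m))) has_sum of_real (sqrt A) * lattice_gen \<tau> t \<alpha>) UNIV"
    by (rule has_sum_cmult_right[OF 1])
  ultimately have "of_real (sqrt A) * lattice_gen \<tau> t \<alpha> = e * infsum K UNIV"
    by (simp add: mult_ac) (metis has_sum_unique)
  moreover have "e = exp (\<alpha>\<^sup>2 * of_real (Im \<tau>) / of_real (4 * pi * t))"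
    using t y by (simp add: e_def s_def A_def y_def mult.assoc)
  ultimately show ?thesis by (simp add: K_def A_def y_def)
qed

text \<open>The scaling \<alpha> / t is forced: it leaves the prefactor exp (\<alpha>^2 y / (4 pi
  t)) with y = Im \<tau> unchanged and makes the linear terms of the dual series correspond under m
  <-> j. The factor t is the quotient of the two square roots in
  \<open>lattice_gen_fourier\<close>.\<close>

lemma lattice_gen_inversion:
  assumes \<tau>: "Im \<tau> > 0" and t: "t > 0"
  shows "lattice_gen \<tau> (1 / t) (\<alpha> / of_real t) = of_real t * lattice_gen \<tau> t \<alpha>"
proof -
  have dual: "(\<Sum>\<^sub>\<infinity>x. lattice_dual_term \<tau> (1 / t) (\<alpha> / of_real t) x) = (\<Sum>\<^sub>\<infinity>x. lattice_dual_term \<tau> t \<alpha> x)"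
  proof (rule infsum_reindex_bij_witness[of _ prod.swap prod.swap])
    fix x :: "int \<times> int"
    obtain m j where x: "x = (m, j)" by fastforce
    have e1: "pi * Im \<tau> * ((of_int j)\<^sup>2 / (1 / t) + 1 / t * (of_int m)\<^sup>2) = pi * Im \<tau> * ((of_int m)\<^sup>2 / t + t * (of_int j)\<^sup>2)"
      by (simp add: algebra_simps)
    have e2: "\<alpha> / of_real t * of_real (Im \<tau> * (of_int j / (1 / t) + of_int m))
       = \<alpha> * of_real (Im \<tau> * (of_int m / t + of_int j))"
      using t by (simp add: field_simps)
    show "lattice_dual_term \<tau> t \<alpha> (prod.swap x) = lattice_dual_term \<tau> (1 / t) (\<alpha> / of_real t) x"
      unfolding x lattice_dual_term_def prod.case swap_simp mult.assoc[of "\<i>"] e1 e2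
      by (simp only: mult_ac)
  qed auto
  define u where "u = t / Im \<tau>"
  have e: "(\<alpha> / of_real t)\<^sup>2 * of_real (Im \<tau>) / of_real (4 * pi * (1 / t)) = \<alpha>\<^sup>2 * of_real (Im \<tau>) / of_real (4 * pi * t)"
    using t by (simp add: power2_eq_square field_simps)
  have "of_real (sqrt (1 / t / Im \<tau>)) * lattice_gen \<tau> (1 / t) (\<alpha> / of_real t) = of_real (sqrt u) * lattice_gen \<tau> t \<alpha>"
    using lattice_gen_fourier[OF \<tau>, of "1 / t" "\<alpha> / of_real t"] lattice_gen_fourier[OF \<tau> t, of \<alpha>] t
    unfolding dual e by (simp add: u_def)
  moreover have "sqrt u = sqrt (1 / t / Im \<tau>) * t"
  proof -
    have "u = (1 / t / Im \<tau>) * t\<^sup>2" using t by (simp add: u_def power2_eq_square)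
    then show ?thesis using t by (simp only: real_sqrt_mult real_sqrt_abs)
  qed
  moreover have "sqrt (1 / t / Im \<tau>) \<noteq> 0" using t \<tau> by simp
  ultimately show ?thesis by (simp add: mult.assoc del: real_sqrt_eq_zero_cancel_iff)
qed

section \<open>Theta series with power weights, as Taylor coefficients of
  \<open>lattice_gen\<close>\<close>

definition lattice_theta :: "complex \<Rightarrow> nat \<Rightarrow> real \<Rightarrow> complex" where
  "lattice_theta \<tau> k t = (\<Sum>\<^sub>\<infinity>x. cnj (lattice_pt \<tau> x) ^ k * exp (- of_real (pi * t / Im \<tau> * (norm (lattice_pt \<tau> x))\<^sup>2)))"

text \<open>Expanding exp(alpha * cnj w) gives a double series in lattice points and exponents.
  Summing its norms over the exponents yields exp (- c |w|^2 + |\<alpha>| |w|), which is summable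
  over the lattice, so the two sums may be exchanged.\<close>

lemma lattice_gen_power_series:
  assumes \<tau>: "Im \<tau> > 0" and t: "t > 0"
  shows "(\<lambda>n. lattice_theta \<tau> n t / fact n * \<alpha> ^ n) sums lattice_gen \<tau> t \<alpha>"
proof -
  define c where "c = pi * t / Im \<tau>"
  have c: "c > 0" using \<tau> t by (simp add: c_def)
  define w where "w = lattice_pt \<tau>"
  define F where "F = (\<lambda>(x, n). exp (- of_real (c * (norm (w x))\<^sup>2)) * ((\<alpha> * cnj (w x)) ^ n /\<^sub>R fact n))"
  have expo: "((\<lambda>n. z ^ n /\<^sub>R fact n) has_sum exp z) UNIV" for z :: complex
    by (rule norm_summable_imp_has_sum[OF summable_norm_exp exp_converges])
  have expo_r: "((\<lambda>n. r ^ n /\<^sub>R fact n) has_sum exp r) UNIV" for r :: real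
    by (rule norm_summable_imp_has_sum[OF summable_norm_exp exp_converges])
  have "(\<lambda>p. norm (F p)) summable_on (UNIV \<times> UNIV)"
  proof (rule summable_on_SigmaI[where g = "\<lambda>x. exp (- c * (norm (w x))\<^sup>2 + norm \<alpha> * norm (w x))"])
    show "(\<lambda>x. exp (- c * (norm (w x))\<^sup>2 + norm \<alpha> * norm (w x))) summable_on UNIV"
      unfolding w_def by (rule lattice_gauss_summable[OF \<tau> c])
    show "((\<lambda>n. norm (F (x, n))) has_sum exp (- c * (norm (w x))\<^sup>2 + norm \<alpha> * norm (w x))) UNIV" for x
    proof -
      have "norm (F (x, n)) = exp (- c * (norm (w x))\<^sup>2) * ((norm \<alpha> * norm (w x)) ^ n /\<^sub>R fact n)" for n
        by (simp add: F_def norm_mult norm_power)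
      then show ?thesis
        unfolding exp_add using has_sum_cmult_right[OF expo_r] by simp
    qed
  qed auto
  then have summ: "F summable_on (UNIV \<times> UNIV)" by (rule abs_summable_summable)
  have FE: "((\<lambda>n. F (x, n)) has_sum exp (- of_real (c * (norm (w x))\<^sup>2) + \<alpha> * cnj (w x))) UNIV" for x
    unfolding F_def prod.case exp_add by (rule has_sum_cmult_right[OF expo])
  have total: "(F has_sum infsum F (UNIV \<times> UNIV)) (UNIV \<times> UNIV)"
    using summ by (rule has_sum_infsum)
  have "((\<lambda>x. exp (- of_real (c * (norm (w x))\<^sup>2) + \<alpha> * cnj (w x))) has_sum infsum F (UNIV \<times> UNIV)) UNIV"
    by (rule has_sum_SigmaD[OF total FE])
  then have G: "infsum F (UNIV \<times> UNIV) = lattice_gen \<tau> t \<alpha>"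
    unfolding lattice_gen_def by (simp add: infsumI c_def w_def)
  have "((\<lambda>(n, x). F (x, n)) has_sum infsum F (UNIV \<times> UNIV)) (UNIV \<times> UNIV)"
    using total by (rule has_sum_swap[THEN iffD1])
  then have "((\<lambda>n. lattice_theta \<tau> n t / fact n * \<alpha> ^ n) has_sum infsum F (UNIV \<times> UNIV)) UNIV"
  proof (rule has_sum_SigmaD)
    fix n
    have "(\<lambda>x. norm (cnj (w x) ^ n * exp (- of_real (c * (norm (w x))\<^sup>2)))) summable_on UNIV"
      using lattice_gauss_power_summable[OF \<tau> c, of n]
      by (simp add: norm_mult norm_power norm_exp_eq_Re w_def)
    then have "((\<lambda>x. cnj (w x) ^ n * exp (- of_real (c * (norm (w x))\<^sup>2))) has_sum lattice_theta \<tau> n t) UNIV"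
      unfolding lattice_theta_def w_def c_def by (intro has_sum_infsum) (rule abs_summable_summable)
    from has_sum_cmult_right[OF this, of "\<alpha> ^ n / fact n"]
    show "((\<lambda>x. case (n, x) of (n, x) \<Rightarrow> F (x, n)) has_sum lattice_theta \<tau> n t / fact n * \<alpha> ^ n) UNIV"
      by (simp add: F_def scaleR_conv_of_real power_mult_distrib field_simps)
  qed
  then show ?thesis unfolding G by (rule has_sum_imp_sums)
qed

text \<open>Coefficient comparison at \<alpha>^k in \<open>lattice_gen_inversion\<close>: replacing
  \<alpha> by \<alpha> / t contributes t^(-k), which joins the factor t on the other side to give
  the exponent k + 1.\<close>

theorem lattice_theta_inversion:
  assumes \<tau>: "Im \<tau> > 0" and t: "t > 0"
  shows "lattice_theta \<tau> k (1 / t) = of_real t ^ (k + 1) * lattice_theta \<tau> k t"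
proof -
  define f where "f = (\<lambda>\<alpha>. of_real t * lattice_gen \<tau> t \<alpha>)"
  have 1: "f has_fps_expansion Abs_fps (\<lambda>n. of_real t * (lattice_theta \<tau> n t / fact n))"
    using sums_mult[OF lattice_gen_power_series[OF \<tau> t], of "of_real t"]
    by (intro has_fps_expansionI always_eventually) (simp add: f_def mult.assoc)
  have 2: "f has_fps_expansion Abs_fps (\<lambda>n. lattice_theta \<tau> n (1 / t) / fact n / of_real t ^ n)"
  proof (intro has_fps_expansionI always_eventually allI)
    fix \<alpha>
    show "(\<lambda>n. fps_nth (Abs_fps (\<lambda>n. lattice_theta \<tau> n (1 / t) / fact n / of_real t ^ n)) n * \<alpha> ^ n) sums f \<alpha>"
      using lattice_gen_power_series[OF \<tau>, of "1 / t" "\<alpha> / of_real t"] t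
      unfolding lattice_gen_inversion[OF \<tau> t] by (simp add: f_def power_divide)
  qed
  have "fps_nth (Abs_fps (\<lambda>n. lattice_theta \<tau> n (1 / t) / fact n / of_real t ^ n)) k =
     fps_nth (Abs_fps (\<lambda>n. of_real t * (lattice_theta \<tau> n t / fact n))) k"
    using fps_expansion_unique_complex[OF 1 2] by simp
  then show ?thesis using t by (simp add: field_simps)
qed

section \<open>Mellin transforms\<close>

text \<open>The power t^(v - 1) for t > 0, written with \<open>exp\<close> and \<open>ln\<close> so
  that it is visibly entire in v and products reduce to adding exponents.\<close>

definition mellin_kernel :: "complex \<Rightarrow> real \<Rightarrow> complex" where
  "mellin_kernel v t = exp ((v - 1) * of_real (ln t))"

lemma mellin_kernel_conv_powr: "t > 0 \<Longrightarrow> mellin_kernel v t = of_real t powr (v - 1)"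
  by (simp add: mellin_kernel_def powr_def flip: Ln_of_real)

lemma norm_mellin_kernel: "norm (mellin_kernel v t) = exp ((Re v - 1) * ln t)"
  by (simp add: mellin_kernel_def norm_exp_eq_Re)

lemma continuous_on_mellin_kernel [continuous_intros]:
  "(\<And>t. t \<in> A \<Longrightarrow> t > 0) \<Longrightarrow> continuous_on A (mellin_kernel v)"
  unfolding mellin_kernel_def by (intro continuous_intros) auto

lemma integral_mellin_kernel:
  assumes "a \<noteq> 0" "X \<ge> 1"
  shows "integral {1..X} (mellin_kernel a) = (exp (a * of_real (ln X)) - 1) / a"
proof -
  have "((\<lambda>t. mellin_kernel a t) has_integral exp (a * of_real (ln X)) / a - exp (a * of_real (ln 1)) / a) {1..X}"
  proof (rule fundamental_theorem_of_calculus)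
    fix t assume t: "t \<in> {1..X}"
    then have "t > 0" by simp
    have "((\<lambda>z. exp (a * z) / a) has_field_derivative exp (a * of_real (ln t))) (at (of_real (ln t)))"
      using assms(1) by (auto intro!: derivative_eq_intros)
    then have "((\<lambda>x. exp (a * of_real x) / a) has_vector_derivative exp (a * of_real (ln t))) (at (ln t))"
      by (rule has_vector_derivative_real_field)
    moreover have "(ln has_vector_derivative inverse t) (at t)"
      using t by (auto intro!: derivative_eq_intros simp: inverse_eq_divide simp flip: has_real_derivative_iff_has_vector_derivative)
    ultimately have "(((\<lambda>x. exp (a * of_real x) / a) \<circ> ln) has_vector_derivative inverse t *\<^sub>R exp (a * of_real (ln t))) (at t)"
      by (intro vector_diff_chain_at)
    moreover have "inverse t *\<^sub>R exp (a * of_real (ln t)) = mellin_kernel a t"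
    proof -
      have "complex_of_real (inverse t) = exp (- of_real (ln t))"
        using \<open>t > 0\<close> by (simp add: exp_minus exp_of_real)
      then show ?thesis
        by (simp only: scaleR_conv_of_real mellin_kernel_def exp_add[symmetric]) (simp add: algebra_simps)
    qed
    ultimately show "((\<lambda>x. exp (a * of_real (ln x)) / a) has_vector_derivative mellin_kernel a t) (at t within {1..X})"
      by (auto simp: o_def intro: has_vector_derivative_at_within)
  qed (use assms in auto)
  then show ?thesis by (simp add: integral_unique diff_divide_distrib)
qed

lemma tendsto_integral_mellin_kernel:
  assumes "Re a < 0"
  shows "(\<lambda>n. integral {1..1 + real n} (mellin_kernel a)) \<longlonglongrightarrow> - 1 / a"
proof -
  have a: "a \<noteq> 0" using assms by auto
  have "(\<lambda>n. norm (exp (a * of_real (ln (1 + real n))))) \<longlonglongrightarrow> 0"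
  proof -
    have "(\<lambda>n. exp (Re a * ln (1 + real n))) \<longlonglongrightarrow> 0" using assms by real_asymp
    then show ?thesis by (simp add: norm_exp_eq_Re)
  qed
  then have "(\<lambda>n. exp (a * of_real (ln (1 + real n)))) \<longlonglongrightarrow> 0"
    by (rule tendsto_norm_zero_cancel)
  then have "(\<lambda>n. (exp (a * of_real (ln (1 + real n))) - 1) / a) \<longlonglongrightarrow> (0 - 1) / a"
    by (intro tendsto_intros a)
  then show ?thesis using integral_mellin_kernel[OF a] by simp
qed

section \<open>Truncated Gamma integrals and their limit\<close>

abbreviation gamma_integrand :: "complex \<Rightarrow> real \<Rightarrow> complex" where
  "gamma_integrand v s \<equiv> exp (- of_real s) * mellin_kernel v s"

lemma gamma_integrand_eq: "s > 0 \<Longrightarrow> gamma_integrand v s = of_real s powr (v - 1) / of_real (exp s)"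
  by (simp add: mellin_kernel_conv_powr exp_minus exp_of_real field_simps)

lemma gamma_integrand_integrable: "0 < a \<Longrightarrow> gamma_integrand v integrable_on {a..b}"
  by (intro integrable_continuous_real continuous_intros) auto

text \<open>The dilation s = c t. Staying on compact segments away from 0 keeps every integrand
  continuous; the improper integral is reached only in the limit.\<close>

lemma gamma_segment_scale:
  assumes "c > 0" "0 < a" "a \<le> b"
  shows "integral {a..b} (\<lambda>t. exp (- of_real (c * t)) * mellin_kernel v t)
    = of_real c powr (- v) * integral {c * a..c * b} (gamma_integrand v)"
proof -
  define E where "E = exp (v * of_real (ln c))"
  have E: "of_real c powr (- v) = inverse E"
    using assms by (simp add: E_def powr_def exp_minus flip: Ln_of_real)
  have "((\<lambda>t. c *\<^sub>R gamma_integrand v (c * t)) has_integral integral {c * a..c * b} (gamma_integrand v)) {a..b}"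
  proof (rule has_integral_substitution[where c = "c * a" and d = "c * b"])
    show "continuous_on {c * a..c * b} (gamma_integrand v)"
      using assms by (intro continuous_intros) (auto intro: less_le_trans[of 0 "c * a"])
  qed (use assms in \<open>auto intro!: derivative_eq_intros\<close>)
  moreover have "c *\<^sub>R gamma_integrand v (c * t) = E * (exp (- of_real (c * t)) * mellin_kernel v t)"
    if "t \<in> {a..b}" for t
  proof -
    have t: "t > 0" using that assms by auto
    have "complex_of_real c = exp (of_real (ln c))" using assms by (simp add: exp_of_real)
    then show ?thesis
      using assms t
      by (simp only: scaleR_conv_of_real mellin_kernel_def E_def exp_add[symmetric])
         (simp add: ln_mult algebra_simps)
  qed
  ultimately have "((\<lambda>t. E * (exp (- of_real (c * t)) * mellin_kernel v t)) has_integral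
      integral {c * a..c * b} (gamma_integrand v)) {a..b}"
    by (subst has_integral_cong) auto
  then have "E * integral {a..b} (\<lambda>t. exp (- of_real (c * t)) * mellin_kernel v t) =
      integral {c * a..c * b} (gamma_integrand v)"
    by (simp only: integral_unique integral_mult_right[symmetric])
  then show ?thesis by (auto simp: E E_def field_simps)
qed

lemma gamma_segment_bound:
  assumes "Re v > 0" "0 < a" "a \<le> b"
  shows "norm (integral {a..b} (gamma_integrand v)) \<le> Gamma (Re v)"
proof -
  define h where "h = (\<lambda>t::real. t powr (Re v - 1) / exp t)"
  have h: "(h has_integral Gamma (Re v)) {0..}"
    unfolding h_def using Gamma_integral_real assms by simp
  have hint: "h integrable_on {a..b}"
    unfolding h_def using assms by (intro integrable_continuous_real continuous_intros) auto
  have "norm (integral {a..b} (gamma_integrand v)) \<le> integral {a..b} h"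
  proof (rule integral_norm_bound_integral[OF gamma_integrand_integrable hint])
    fix x assume "x \<in> {a..b}"
    then have "x > 0" using assms by auto
    moreover have "norm (gamma_integrand v x) = exp (- x) * exp ((Re v - 1) * ln x)"
      by (simp add: norm_mult norm_mellin_kernel)
    ultimately show "norm (gamma_integrand v x) \<le> h x"
      by (simp add: h_def powr_def exp_minus divide_inverse mult.commute)
  qed (use assms in auto)
  also have "\<dots> \<le> integral {0..} h"
    by (intro integral_subset_le) (use assms hint h in \<open>auto simp: h_def\<close>)
  also have "\<dots> = Gamma (Re v)" using h by (simp add: integral_unique)
  finally show ?thesis .
qed

text \<open>The segments exhaust (0, \<infinity>) for every scale c > 0, and the Gamma integrand
  itself is the dominating function. In the application c is \<open>l i\<close>, which the limit no
  longer sees.\<close>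

lemma gamma_segment_tendsto:
  assumes v: "Re v > 0" and c: "c > 0"
  shows "(\<lambda>n. integral {c * (1 / (1 + real n))..c * (1 + real n)} (gamma_integrand v)) \<longlonglongrightarrow> Gamma v"
proof -
  define g where "g = (\<lambda>t. complex_of_real t powr (v - 1) / of_real (exp t))"
  define S where "S = (\<lambda>n::nat. {c * (1 / (1 + real n))..c * (1 + real n)})"
  have pos: "s > 0" if "s \<in> S n" for s n
    using that c less_le_trans[of 0 "c * (1 / (1 + real n))" s] by (auto simp: S_def)
  have eq: "gamma_integrand v s = g s" if "s > 0" for s
    using that by (simp only: g_def gamma_integrand_eq)
  have "(\<lambda>n. integral {0<..} (\<lambda>s. if s \<in> S n then g s else 0)) \<longlonglongrightarrow> integral {0<..} g"
  proof (rule dominated_convergence(2))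
    show "(\<lambda>s. norm (g s)) integrable_on {0<..}"
      using absolutely_integrable_Gamma_integral'[OF v] unfolding g_def absolutely_integrable_on_def by simp
    show "(\<lambda>s. if s \<in> S n then g s else 0) integrable_on {0<..}" for n
    proof -
      have "gamma_integrand v integrable_on S n"
        unfolding S_def by (rule gamma_integrand_integrable) (use c in simp)
      then have "g integrable_on S n"
        by (rule integrable_eq) (use eq pos in blast)
      moreover have "S n \<inter> {0<..} = S n" using pos by auto
      ultimately show ?thesis by (simp add: integrable_restrict_Int)
    qed
    show "norm (if s \<in> S n then g s else 0) \<le> norm (g s)" for n s by simp
    fix s :: real assume s: "s \<in> {0<..}"
    have "eventually (\<lambda>n. s \<in> S n) sequentially"
    proof -
      have 1: "eventually (\<lambda>n. c * (1 / (1 + real n)) < s) sequentially"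
        by (rule order_tendstoD(2)[where y = 0]) (use s in \<open>real_asymp | simp\<close>)+
      have 2: "eventually (\<lambda>n. c * (1 + real n) > s) sequentially"
        using c by real_asymp
      show ?thesis using 1 2 by eventually_elim (auto simp: S_def)
    qed
    then have "eventually (\<lambda>n. g s = (if s \<in> S n then g s else 0)) sequentially"
      by eventually_elim simp
    then show "(\<lambda>n. if s \<in> S n then g s else 0) \<longlonglongrightarrow> g s"
      by (rule Lim_transform_eventually[OF tendsto_const])
  qed
  moreover have "integral {0<..} g = Gamma v"
    using Gamma_integral_complex'[OF v] by (simp add: g_def integral_unique)
  moreover have "integral {0<..} (\<lambda>s. if s \<in> S n then g s else 0) = integral (S n) (gamma_integrand v)" for n
  proof -
    have "integral {0<..} (\<lambda>s. if s \<in> S n then g s else 0) = integral ({0<..} \<inter> S n) g"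
      by (subst integral_restrict_Int) (simp add: Int_commute)
    also have "{0<..} \<inter> S n = S n" using pos by auto
    also have "integral (S n) g = integral (S n) (gamma_integrand v)"
      by (rule integral_cong) (use eq pos in metis)
    finally show ?thesis .
  qed
  ultimately show ?thesis by (simp add: S_def)
qed

text \<open>The number \<open>d\<close> is the constant term of the theta function, kept apart because \<open>I\<close> omits the
  lattice point \<open>0\<close>.\<close>

locale modular_dirichlet_series =
  fixes I :: "'i set" and c :: "'i \<Rightarrow> complex" and l :: "'i \<Rightarrow> real"
    and \<mu> \<sigma>0 :: real and r :: nat and d :: complex
  assumes \<mu>_pos: "\<mu> > 0" and l_ge: "\<And>i. i \<in> I \<Longrightarrow> l i \<ge> \<mu>"
    and dirichlet_summable: "\<And>\<sigma>. \<sigma> > \<sigma>0 \<Longrightarrow> (\<lambda>i. norm (c i) * l i powr (- \<sigma>)) summable_on I"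
    and theta_summable: "\<And>t. t > 0 \<Longrightarrow> (\<lambda>i. norm (c i) * exp (- (l i * t))) summable_on I"
    and inversion: "\<And>t. t > 0 \<Longrightarrow>
      d + (\<Sum>\<^sub>\<infinity>i\<in>I. c i * exp (- of_real (l i * (1 / t)))) =
      of_real t ^ r * (d + (\<Sum>\<^sub>\<infinity>i\<in>I. c i * exp (- of_real (l i * t))))"
begin

definition \<Theta> :: "real \<Rightarrow> complex" where
  "\<Theta> t = (\<Sum>\<^sub>\<infinity>i\<in>I. c i * exp (- of_real (l i * t)))"

lemma l_pos: "i \<in> I \<Longrightarrow> l i > 0"
  using l_ge \<mu>_pos by force

lemma \<Theta>_abs_summable:
  assumes "t > 0"
  shows "(\<lambda>i. norm (c i * exp (- of_real (l i * t)))) summable_on I"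
  using theta_summable[OF assms] by (simp add: norm_mult norm_exp_eq_Re)

lemma \<Theta>_has_sum: "t > 0 \<Longrightarrow> ((\<lambda>i. c i * exp (- of_real (l i * t))) has_sum \<Theta> t) I"
  unfolding \<Theta>_def by (rule has_sum_infsum[OF abs_summable_summable[OF \<Theta>_abs_summable]])

text \<open>The bounded factor \<open>h\<close> covers two uses: \<open>h\<close> = 1 gives
  continuity of \<open>\<Theta>\<close>, and the Mellin kernel gives integration term by
  term.\<close>

lemma \<Theta>_uniform_limit:
  assumes a: "a > 0" and bnd: "\<And>t. t \<in> A \<Longrightarrow> a \<le> t \<and> norm (h t) \<le> B"
  shows "uniform_limit A (\<lambda>X t. \<Sum>i\<in>X. c i * exp (- of_real (l i * t)) * h t) (\<lambda>t. \<Theta> t * h t)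
           (finite_subsets_at_top I)"
proof (rule Weierstrass_m_test_general'[where M = "\<lambda>i. norm (c i) * exp (- (l i * a)) * B"])
  fix i t assume i: "i \<in> I" and t: "t \<in> A"
  have "norm (c i * exp (- of_real (l i * t)) * h t) = norm (c i) * exp (- (l i * t)) * norm (h t)"
    by (simp add: norm_mult norm_exp_eq_Re)
  also have "\<dots> \<le> norm (c i) * exp (- (l i * a)) * B"
    using bnd[OF t] l_pos[OF i] by (intro mult_mono mult_nonneg_nonneg) auto
  finally show "norm (c i * exp (- of_real (l i * t)) * h t) \<le> norm (c i) * exp (- (l i * a)) * B" .
next
  fix t assume "t \<in> A"
  then have "t > 0" using a bnd[of t] by auto
  then show "((\<lambda>i. c i * exp (- of_real (l i * t)) * h t) has_sum \<Theta> t * h t) I"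
    by (intro has_sum_cmult_left \<Theta>_has_sum)
next
  show "(\<lambda>i. norm (c i) * exp (- (l i * a)) * B) summable_on I"
    by (intro summable_on_cmult_left theta_summable a)
qed

lemma continuous_on_\<Theta>: "continuous_on {0<..} \<Theta>"
proof -
  have "continuous_on {a<..} \<Theta>" if "a > 0" for a
  proof (rule uniform_limit_theorem)
    show "uniform_limit {a<..} (\<lambda>X t. \<Sum>i\<in>X. c i * exp (- of_real (l i * t))) \<Theta> (finite_subsets_at_top I)"
      using \<Theta>_uniform_limit[OF that, of "{a<..}" "\<lambda>_. 1" 1] by simp
  qed (auto intro!: always_eventually continuous_intros)
  then have "isCont \<Theta> t" if "t > 0" for t
    using that by (intro continuous_on_interior[of "{t/2<..}"]) (auto simp: interior_open)
  then show ?thesis by (simp add: continuous_at_imp_continuous_on)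
qed

lemma continuous_on_\<Theta>' [continuous_intros]:
  "continuous_on A g \<Longrightarrow> (\<And>x. x \<in> A \<Longrightarrow> g x > 0) \<Longrightarrow> continuous_on A (\<lambda>x. \<Theta> (g x))"
  by (rule continuous_on_compose2[OF continuous_on_\<Theta>]) auto

text \<open>Split exp (- l t) into exp (- l (t - 1)) and exp (- l), and use the gap l >= \<mu> in
  the first factor only; the second keeps the series convergent.\<close>

lemma \<Theta>_bound: "\<exists>B\<ge>0. \<forall>t\<ge>1. norm (\<Theta> t) \<le> B * exp (- (\<mu> * t))"
proof (intro exI conjI allI impI)
  define S where "S = (\<Sum>\<^sub>\<infinity>i\<in>I. norm (c i) * exp (- (l i * 1)))"
  have S: "((\<lambda>i. norm (c i) * exp (- (l i * 1))) has_sum S) I"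
    unfolding S_def by (rule has_sum_infsum[OF theta_summable]) simp
  show "exp \<mu> * S \<ge> 0" unfolding S_def by (intro mult_nonneg_nonneg infsum_nonneg) auto
  fix t :: real assume t: "t \<ge> 1"
  have "norm (\<Theta> t) \<le> exp (- (\<mu> * (t - 1))) * S"
    unfolding \<Theta>_def
  proof (rule norm_infsum_le[OF \<Theta>_has_sum[unfolded \<Theta>_def]])
    show "((\<lambda>i. exp (- (\<mu> * (t - 1))) * (norm (c i) * exp (- (l i * 1)))) has_sum exp (- (\<mu> * (t - 1))) * S) I"
      by (rule has_sum_cmult_right[OF S])
    fix i assume i: "i \<in> I"
    have "\<mu> * (t - 1) + l i \<le> l i * (t - 1) + l i"
      using l_ge[OF i] t by (intro add_mono mult_right_mono) auto
    then have "exp (- (l i * t)) \<le> exp (- (\<mu> * (t - 1))) * exp (- (l i * 1))"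
      unfolding exp_add[symmetric] by (simp add: algebra_simps)
    then have "norm (c i) * exp (- (l i * t)) \<le> norm (c i) * (exp (- (\<mu> * (t - 1))) * exp (- (l i * 1)))"
      by (intro mult_left_mono) auto
    then show "norm (c i * exp (- of_real (l i * t))) \<le> exp (- (\<mu> * (t - 1))) * (norm (c i) * exp (- (l i * 1)))"
      by (simp add: norm_mult norm_exp_eq_Re mult_ac)
  qed (use t in auto)
  also have "\<dots> = exp \<mu> * S * exp (- (\<mu> * t))"
    by (simp add: algebra_simps exp_diff exp_minus field_simps)
  finally show "norm (\<Theta> t) \<le> exp \<mu> * S * exp (- (\<mu> * t))" .
qed

lemma has_sum_integral:
  assumes "0 < a" "a \<le> b"
  shows "((\<lambda>i. c i * integral {a..b} (\<lambda>t. exp (- of_real (l i * t)) * mellin_kernel v t))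
           has_sum integral {a..b} (\<lambda>t. \<Theta> t * mellin_kernel v t)) I"
proof -
  have pos: "t > 0" if "t \<in> {a..b}" for t using that assms by auto
  have cont: "continuous_on {a..b} (mellin_kernel v)"
    by (intro continuous_intros pos)
  have "compact (mellin_kernel v ` {a..b})"
    using cont by (rule compact_continuous_image) simp
  then obtain B where B: "\<forall>t\<in>{a..b}. norm (mellin_kernel v t) \<le> B"
    by (auto dest!: compact_imp_bounded simp: bounded_iff)
  have ul: "uniform_limit {a..b} (\<lambda>X t. \<Sum>i\<in>X. c i * exp (- of_real (l i * t)) * mellin_kernel v t)
      (\<lambda>t. \<Theta> t * mellin_kernel v t) (finite_subsets_at_top I)"
    by (rule \<Theta>_uniform_limit[OF assms(1)]) (use B in auto)
  have ci: "continuous_on {a..b} (\<lambda>t. c i * exp (- of_real (l i * t)) * mellin_kernel v t)" for i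
    by (intro continuous_intros cont)
  then have cX: "continuous_on {a..b} (\<lambda>t. \<Sum>i\<in>X. c i * exp (- of_real (l i * t)) * mellin_kernel v t)" for X
    by (intro continuous_on_sum)
  obtain P J where P: "\<And>X. ((\<lambda>t. \<Sum>i\<in>X. c i * exp (- of_real (l i * t)) * mellin_kernel v t) has_integral P X) {a..b}"
    and J: "((\<lambda>t. \<Theta> t * mellin_kernel v t) has_integral J) {a..b}"
    and lim: "(P \<longlongrightarrow> J) (finite_subsets_at_top I)"
    by (rule uniform_limit_integral[OF ul cX]) auto
  have "P X = (\<Sum>i\<in>X. c i * integral {a..b} (\<lambda>t. exp (- of_real (l i * t)) * mellin_kernel v t))"
    if "finite X" for X
  proof -
    have "P X = integral {a..b} (\<lambda>t. \<Sum>i\<in>X. c i * exp (- of_real (l i * t)) * mellin_kernel v t)"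
      by (rule integral_unique[OF P, symmetric])
    also have "\<dots> = (\<Sum>i\<in>X. integral {a..b} (\<lambda>t. c i * exp (- of_real (l i * t)) * mellin_kernel v t))"
      using that ci by (intro integral_sum integrable_continuous_real)
    also have "\<dots> = (\<Sum>i\<in>X. c i * integral {a..b} (\<lambda>t. exp (- of_real (l i * t)) * mellin_kernel v t))"
      by (simp only: mult.assoc integral_mult_right)
    finally show ?thesis .
  qed
  then have "\<forall>\<^sub>F X in finite_subsets_at_top I. P X =
      (\<Sum>i\<in>X. c i * integral {a..b} (\<lambda>t. exp (- of_real (l i * t)) * mellin_kernel v t))"
    by (intro eventually_finite_subsets_at_top_weakI) auto
  with lim show ?thesis unfolding has_sum_def using J by (simp add: tendsto_cong integral_unique)
qed

text \<open>\<open>J v\<close> is the integral of \<open>\<Theta> t * t powr (v - 1)\<close> over \<open>[1, \<infinity>)\<close>; cutting it into unit intervals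
  reduces holomorphy to locally uniform convergence of a series.\<close>

definition J_part :: "nat \<Rightarrow> complex \<Rightarrow> complex" where
  "J_part n v = integral {1 + real n..2 + real n} (\<lambda>t. \<Theta> t * mellin_kernel v t)"

definition J :: "complex \<Rightarrow> complex" where
  "J v = (\<Sum>n. J_part n v)"

lemma J_part_holomorphic: "J_part n holomorphic_on UNIV"
proof -
  have "(\<lambda>v. integral (cbox (1 + real n) (2 + real n)) (\<lambda>t. \<Theta> t * mellin_kernel v t)) holomorphic_on UNIV"
  proof (rule leibniz_rule_holomorphic)
    fix v t assume "t \<in> cbox (1 + real n) (2 + real n)"
    show "((\<lambda>v. \<Theta> t * mellin_kernel v t) has_field_derivative
       \<Theta> t * (exp ((v - 1) * of_real (ln t)) * of_real (ln t))) (at v within UNIV)"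
      unfolding mellin_kernel_def by (auto intro!: derivative_eq_intros)
  next
    show "(\<lambda>t. \<Theta> t * mellin_kernel v t) integrable_on cbox (1 + real n) (2 + real n)" for v
      by (intro integrable_continuous continuous_intros) auto
    show "continuous_on (UNIV \<times> cbox (1 + real n) (2 + real n))
        (\<lambda>(v, t). \<Theta> t * (exp ((v - 1) * of_real (ln t)) * of_real (ln t)))"
      unfolding case_prod_unfold by (intro continuous_intros) auto
  qed auto
  then show ?thesis by (simp add: J_part_def[abs_def])
qed

lemma J_part_bound:
  "\<exists>M. summable M \<and> (\<forall>n v. norm v \<le> R \<longrightarrow> norm (J_part n v) \<le> M n)"
proof -
  obtain B where B: "B \<ge> 0" "\<And>t. t \<ge> 1 \<Longrightarrow> norm (\<Theta> t) \<le> B * exp (- (\<mu> * t))"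
    using \<Theta>_bound by blast
  \<comment> \<open>The decay of \<open>\<Theta>\<close> is taken at the left end of the interval
    and the kernel at the right end. The exponent |R| is admissible because Re v - 1 <= |R| and ln t
    >= 0.\<close>
  define M where "M = (\<lambda>n::nat. B * (exp (- (\<mu> * (1 + real n))) * (2 + real n) powr \<bar>R\<bar>))"
  have "summable M"
    unfolding M_def
  proof (rule summable_mult, rule summable_comparison_test_bigo)
    show "summable (\<lambda>n. norm (1 / real n ^ 2))"
      using inverse_power_summable[of 2, where 'a = real] by (simp add: field_simps)
    show "(\<lambda>n. exp (- (\<mu> * (1 + real n))) * (2 + real n) powr \<bar>R\<bar>) \<in> O(\<lambda>n. 1 / real n ^ 2)"
      using \<mu>_pos by real_asymp
  qed
  moreover have "norm (J_part n v) \<le> M n" if v: "norm v \<le> R" for n v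
  proof -
    have "norm (J_part n v) \<le> (B * exp (- (\<mu> * (1 + real n))) * (2 + real n) powr \<bar>R\<bar>) * (2 + real n - (1 + real n))"
      unfolding J_part_def
    proof (rule integral_bound)
      show "continuous_on {1 + real n..2 + real n} (\<lambda>t. \<Theta> t * mellin_kernel v t)"
        by (intro continuous_intros) auto
      fix t assume t: "t \<in> {1 + real n..2 + real n}"
      then have t1: "t \<ge> 1" by auto
      have "norm (\<Theta> t) \<le> B * exp (- (\<mu> * t))" using B(2) t1 .
      also have "\<dots> \<le> B * exp (- (\<mu> * (1 + real n)))"
        using t \<mu>_pos B(1) by (intro mult_left_mono) auto
      finally have 1: "norm (\<Theta> t) \<le> B * exp (- (\<mu> * (1 + real n)))" .
      have "(Re v - 1) * ln t \<le> \<bar>R\<bar> * ln (2 + real n)"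
        using t t1 v complex_Re_le_cmod[of v] by (intro mult_mono) auto
      then have "norm (mellin_kernel v t) \<le> (2 + real n) powr \<bar>R\<bar>"
        by (simp add: norm_mellin_kernel powr_def)
      with 1 show "norm (\<Theta> t * mellin_kernel v t) \<le> B * exp (- (\<mu> * (1 + real n))) * (2 + real n) powr \<bar>R\<bar>"
        unfolding norm_mult by (intro mult_mono) (use B(1) in auto)
    qed auto
    then show ?thesis by (simp add: M_def mult.assoc)
  qed
  ultimately show ?thesis by blast
qed

lemma J_uniform_limit: "uniform_limit (cball 0 R) (\<lambda>N v. \<Sum>n<N. J_part n v) J sequentially"
proof -
  obtain M where M: "summable M" "\<And>n v. norm v \<le> R \<Longrightarrow> norm (J_part n v) \<le> M n"
    using J_part_bound by metis
  show ?thesis unfolding J_def[abs_def]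
    by (rule Weierstrass_m_test[OF _ M(1)]) (use M(2) in auto)
qed

lemma J_holomorphic: "J holomorphic_on UNIV"
proof (rule holomorphic_uniform_sequence[OF open_UNIV])
  show "(\<lambda>v. \<Sum>n<N. J_part n v) holomorphic_on UNIV" for N
    by (intro holomorphic_intros J_part_holomorphic)
  fix v :: complex
  show "\<exists>e>0. cball v e \<subseteq> UNIV \<and> uniform_limit (cball v e) (\<lambda>N v. \<Sum>n<N. J_part n v) J sequentially"
  proof (intro exI[of _ 1] conjI uniform_limit_on_subset[OF J_uniform_limit[of "norm v + 1"]])
    show "cball v 1 \<subseteq> cball 0 (norm v + 1)"
    proof
      fix x assume "x \<in> cball v 1"
      then show "x \<in> cball 0 (norm v + 1)"
        using norm_triangle_sub[of x v] by (simp add: dist_norm norm_minus_commute)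
    qed
  qed auto
qed

lemma integral_tendsto_J:
  "(\<lambda>N. integral {1..1 + real N} (\<lambda>t. \<Theta> t * mellin_kernel v t)) \<longlonglongrightarrow> J v"
proof -
  have "integral {1..1 + real N} (\<lambda>t. \<Theta> t * mellin_kernel v t) = (\<Sum>n<N. J_part n v)" for N
  proof (induction N)
    case (Suc N)
    have "integral {1..1 + real N} (\<lambda>t. \<Theta> t * mellin_kernel v t) + integral {1 + real N..1 + real (Suc N)} (\<lambda>t. \<Theta> t * mellin_kernel v t)
      = integral {1..1 + real (Suc N)} (\<lambda>t. \<Theta> t * mellin_kernel v t)"
      by (intro Henstock_Kurzweil_Integration.integral_combine integrable_continuous_real continuous_intros) auto
    then show ?case using Suc.IH by (simp add: J_part_def)
  qed simp
  moreover have "(\<lambda>N. \<Sum>n<N. J_part n v) \<longlonglongrightarrow> J v"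
    by (rule tendsto_uniform_limitI[OF J_uniform_limit[of "norm v"]]) simp
  ultimately show ?thesis by simp
qed

text \<open>Riemann's folding: t -> 1/t carries [1/X, 1] to [1, X], where the inversion formula
  expresses \<Theta>(1/t) through \<Theta>(t). The constant d leaves two elementary integrals. With
  X finite, v is unrestricted.\<close>

lemma integral_fold:
  assumes X: "X \<ge> 1"
  shows "integral {1 / X..1} (\<lambda>t. \<Theta> t * mellin_kernel v t) =
    integral {1..X} (\<lambda>t. \<Theta> t * mellin_kernel (of_nat r - v) t)
    + d * (integral {1..X} (mellin_kernel (of_nat r - v)) - integral {1..X} (mellin_kernel (- v)))"
proof -
  define f where "f = (\<lambda>t. \<Theta> t * mellin_kernel v t)"
  have "((\<lambda>s. - (1 / s ^ 2) *\<^sub>R f (1 / s)) has_integral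
      (integral {1 / 1..1 / X} f - integral {1 / X..1 / 1} f)) {1..X}"
  proof (rule has_integral_substitution_general[where s = "{}" and c = "1 / X" and d = 1])
    show "(\<lambda>s. 1 / s) ` {1..X} \<subseteq> {1 / X..1}"
      using X by (auto intro!: divide_left_mono)
    show "continuous_on {1 / X..1} f"
      unfolding f_def using X by (intro continuous_intros) (auto intro: less_le_trans[of 0 "1 / X"])
    show "continuous_on {1..X} (\<lambda>s. 1 / s)" by (intro continuous_intros) auto
    show "((\<lambda>s. 1 / s) has_field_derivative - (1 / s ^ 2)) (at s within {1..X})" if "s \<in> {1..X} - {}" for s
      using that by (auto intro!: derivative_eq_intros simp: power2_eq_square)
  qed (use X in auto)
  \<comment> \<open>Since 1/s decreases, the substitution rule also lists the integral over the
    reversed interval, which is empty or, for X = 1, a point.\<close>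
  moreover have "integral {1 / 1..1 / X} f = 0"
    using X by (cases "X = 1") auto
  ultimately have "((\<lambda>s. - (1 / s ^ 2) *\<^sub>R f (1 / s)) has_integral - integral {1 / X..1} f) {1..X}"
    by simp
  from has_integral_neg[OF this]
  have 1: "((\<lambda>s. (1 / s ^ 2) *\<^sub>R f (1 / s)) has_integral integral {1 / X..1} f) {1..X}"
    by simp
  have "integral {1 / X..1} f = integral {1..X} (\<lambda>s. (1 / s ^ 2) *\<^sub>R f (1 / s))"
    using 1 by (simp add: integral_unique)
  also have "\<dots> = integral {1..X} (\<lambda>t. \<Theta> t * mellin_kernel (of_nat r - v) t
      + d * (mellin_kernel (of_nat r - v) t - mellin_kernel (- v) t))"
  proof (rule integral_cong)
    fix s assume "s \<in> {1..X}"
    then have s: "s > 0" by auto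
    have pw: "complex_of_real s ^ n = exp (of_nat n * of_real (ln s))" for n
      using s by (simp add: exp_of_nat_mult exp_of_real)
    have k1: "(1 / s ^ 2) *\<^sub>R mellin_kernel v (1 / s) = mellin_kernel (- v) s"
    proof -
      have e1: "complex_of_real (1 / s ^ 2) = exp (- (of_nat 2 * of_real (ln s)))"
        unfolding exp_minus pw[symmetric] by (simp add: divide_inverse)
      have e2: "ln (1 / s) = - ln s" using s by (simp add: ln_div)
      show ?thesis
        unfolding scaleR_conv_of_real mellin_kernel_def e1 e2 exp_add[symmetric]
        by (rule arg_cong[of _ _ exp]) (simp add: algebra_simps)
    qed
    have k2: "\<Theta> (1 / s) = of_real s ^ r * (d + \<Theta> s) - d"
      using inversion[OF s] by (simp add: \<Theta>_def algebra_simps)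
    have k3: "of_real s ^ r * mellin_kernel (- v) s = mellin_kernel (of_nat r - v) s"
      unfolding pw mellin_kernel_def exp_add[symmetric] by (simp add: algebra_simps)
    have "(1 / s ^ 2) *\<^sub>R f (1 / s) = \<Theta> (1 / s) * ((1 / s ^ 2) *\<^sub>R mellin_kernel v (1 / s))"
      by (simp add: f_def)
    also have "\<dots> = (d + \<Theta> s) * (of_real s ^ r * mellin_kernel (- v) s) - d * mellin_kernel (- v) s"
      unfolding k1 k2 by (simp add: algebra_simps)
    finally show "(1 / s ^ 2) *\<^sub>R f (1 / s) = \<Theta> s * mellin_kernel (of_nat r - v) s
      + d * (mellin_kernel (of_nat r - v) s - mellin_kernel (- v) s)"
      unfolding k3 by (simp add: algebra_simps)
  qed
  also have "\<dots> = integral {1..X} (\<lambda>t. \<Theta> t * mellin_kernel (of_nat r - v) t) +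
      integral {1..X} (\<lambda>t. d * (mellin_kernel (of_nat r - v) t - mellin_kernel (- v) t))"
    by (intro integral_add integrable_continuous_real continuous_intros) auto
  also have "integral {1..X} (\<lambda>t. d * (mellin_kernel (of_nat r - v) t - mellin_kernel (- v) t))
     = d * (integral {1..X} (mellin_kernel (of_nat r - v)) - integral {1..X} (mellin_kernel (- v)))"
    unfolding integral_mult_right
    by (subst integral_diff) (auto intro!: integrable_continuous_real continuous_intros)
  finally show ?thesis by (simp add: f_def)
qed

text \<open>The integral over [1/(1 + n), 1 + n] is evaluated in the limit in two ways: folding at 1
  gives the right-hand side, integration term by term gives the Dirichlet series. For d nonzero, Re
  v > r makes the integral of t^(r - v - 1) over [1, \<infinity>) converge.\<close>

theorem mellin_transform:
  assumes v: "Re v > \<sigma>0" "d \<noteq> 0 \<Longrightarrow> Re v > real r" "Re v > 0"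
  shows "Gamma v * (\<Sum>\<^sub>\<infinity>i\<in>I. c i * of_real (l i) powr (- v))
       = J v + J (of_nat r - v) + d * (1 / (v - of_nat r) - 1 / v)"
proof -
  define F where "F = (\<lambda>n. integral {1 / (1 + real n)..1 + real n} (\<lambda>t. \<Theta> t * mellin_kernel v t))"
  define g where "g = (\<lambda>i (n::nat). integral {1 / (1 + real n)..1 + real n} (\<lambda>t. exp (- of_real (l i * t)) * mellin_kernel v t))"
  have "F \<longlonglongrightarrow> J (of_nat r - v) + d * (- 1 / (of_nat r - v) - (- 1 / (- v))) + J v"
  proof -
    have "F n = integral {1..1 + real n} (\<lambda>t. \<Theta> t * mellin_kernel (of_nat r - v) t)
        + d * (integral {1..1 + real n} (mellin_kernel (of_nat r - v)) - integral {1..1 + real n} (mellin_kernel (- v)))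
        + integral {1..1 + real n} (\<lambda>t. \<Theta> t * mellin_kernel v t)" for n
    proof -
      have "F n = integral {1 / (1 + real n)..1} (\<lambda>t. \<Theta> t * mellin_kernel v t)
           + integral {1..1 + real n} (\<lambda>t. \<Theta> t * mellin_kernel v t)"
        unfolding F_def
        by (intro Henstock_Kurzweil_Integration.integral_combine[symmetric] integrable_continuous_real continuous_intros)
           (auto intro: less_le_trans[of 0 "1 / (1 + real n)"])
      then show ?thesis by (simp add: integral_fold)
    qed
    then have "F = (\<lambda>n. integral {1..1 + real n} (\<lambda>t. \<Theta> t * mellin_kernel (of_nat r - v) t)
        + d * (integral {1..1 + real n} (mellin_kernel (of_nat r - v)) - integral {1..1 + real n} (mellin_kernel (- v)))
        + integral {1..1 + real n} (\<lambda>t. \<Theta> t * mellin_kernel v t))" ..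
    moreover have "(\<lambda>n. d * (integral {1..1 + real n} (mellin_kernel (of_nat r - v)) - integral {1..1 + real n} (mellin_kernel (- v))))
        \<longlonglongrightarrow> d * (- 1 / (of_nat r - v) - (- 1 / (- v)))"
    proof (cases "d = 0")
      case False
      then show ?thesis using v by (intro tendsto_intros tendsto_integral_mellin_kernel) auto
    qed simp
    ultimately show ?thesis by (simp only:) (intro tendsto_add integral_tendsto_J)
  qed
  moreover have "F \<longlonglongrightarrow> Gamma v * (\<Sum>\<^sub>\<infinity>i\<in>I. c i * of_real (l i) powr (- v))"
  proof -
    have g_eq: "g i n = of_real (l i) powr (- v) * integral {l i * (1 / (1 + real n))..l i * (1 + real n)} (gamma_integrand v)"
      if "i \<in> I" for i n
      unfolding g_def by (rule gamma_segment_scale[OF l_pos[OF that]]) (auto simp: field_simps)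
    have nrm: "norm (of_real (l i) powr (- v)) = l i powr (- Re v)" if "i \<in> I" for i
      using l_pos[OF that] by (simp add: norm_powr_real_powr)
    have bound: "norm (c i * g i n) \<le> Gamma (Re v) * (norm (c i) * l i powr (- Re v))" if i: "i \<in> I" for i n
    proof -
      have "norm (integral {l i * (1 / (1 + real n))..l i * (1 + real n)} (gamma_integrand v)) \<le> Gamma (Re v)"
        using l_pos[OF i] by (intro gamma_segment_bound v) (auto simp: field_simps)
      then have "norm (c i) * l i powr (- Re v) * norm (integral {l i * (1 / (1 + real n))..l i * (1 + real n)} (gamma_integrand v))
          \<le> norm (c i) * l i powr (- Re v) * Gamma (Re v)"
        by (intro mult_left_mono) auto
      then show ?thesis by (simp only: g_eq[OF i] norm_mult nrm[OF i] mult_ac)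
    qed
    \<comment> \<open>Uniformity in n, from a majorant that does not involve n, is what allows the
      limit in n to be exchanged with the sum over \<open>I\<close>.\<close>
    have ul: "uniform_limit UNIV (\<lambda>X n. \<Sum>i\<in>X. c i * g i n) F (finite_subsets_at_top I)"
    proof (rule Weierstrass_m_test_general'[OF bound])
      show "((\<lambda>i. c i * g i n) has_sum F n) I" for n
        unfolding g_def F_def by (rule has_sum_integral) (auto simp: field_simps)
      show "(\<lambda>i. Gamma (Re v) * (norm (c i) * l i powr (- Re v))) summable_on I"
        by (intro summable_on_cmult_right dirichlet_summable v)
    qed auto
    have lim_i: "(\<lambda>n. c i * g i n) \<longlonglongrightarrow> c i * (of_real (l i) powr (- v) * Gamma v)" if "i \<in> I" for i
      using g_eq[OF that] gamma_segment_tendsto[OF v(3) l_pos[OF that]] by (auto intro!: tendsto_intros)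
    show ?thesis
    proof (rule swap_uniform_limit'[OF _ _ ul])
      show "\<forall>\<^sub>F X in finite_subsets_at_top I. (\<lambda>n. \<Sum>i\<in>X. c i * g i n) \<longlonglongrightarrow> (\<Sum>i\<in>X. c i * (of_real (l i) powr (- v) * Gamma v))"
        by (intro eventually_finite_subsets_at_top_weakI tendsto_sum lim_i) auto
      have "(\<lambda>i. c i * of_real (l i) powr (- v)) summable_on I"
      proof (rule abs_summable_summable)
        show "(\<lambda>i. norm (c i * of_real (l i) powr (- v))) summable_on I"
          using dirichlet_summable[OF v(1)] by (rule summable_on_cong[THEN iffD1, rotated]) (simp add: norm_mult nrm)
      qed
      then have "((\<lambda>i. Gamma v * (c i * of_real (l i) powr (- v))) has_sum Gamma v * (\<Sum>\<^sub>\<infinity>i\<in>I. c i * of_real (l i) powr (- v))) I"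
        by (intro has_sum_cmult_right has_sum_infsum)
      then show "((\<lambda>X. \<Sum>i\<in>X. c i * (of_real (l i) powr (- v) * Gamma v)) \<longlongrightarrow> Gamma v * (\<Sum>\<^sub>\<infinity>i\<in>I. c i * of_real (l i) powr (- v)))
         (finite_subsets_at_top I)"
        unfolding has_sum_def by (simp add: mult_ac)
    qed auto
  qed
  ultimately have "Gamma v * (\<Sum>\<^sub>\<infinity>i\<in>I. c i * of_real (l i) powr (- v)) =
      J (of_nat r - v) + d * (- 1 / (of_nat r - v) - (- 1 / (- v))) + J v"
    by (metis LIMSEQ_unique)
  moreover have "- 1 / (of_nat r - v) = 1 / (v - of_nat r)" 
    using minus_divide_divide[of 1 "v - of_nat r"] by simp
  ultimately show ?thesis by simp
qed

end

section \<open>Completed lattice sums\<close>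

text \<open>The polynomial part of w^(-k): for w nonzero, w^(-k) is the weight divided by |w|^(k +
  |k|). Both branches are harmonic and homogeneous of degree |k|.\<close>

definition weight :: "int \<Rightarrow> complex \<Rightarrow> complex" where
  "weight k w = (if k \<ge> 0 then cnj w ^ nat k else w ^ nat (- k))"

lemma norm_weight: "norm (weight k w) = norm w ^ nat \<bar>k\<bar>"
  by (auto simp: weight_def norm_power)

text \<open>Dividing by Im \<tau> normalises the covolume of the lattice to 1 and the factor pi
  makes the Gaussian self-dual, so the inversion is t -> 1/t for every \<tau>.\<close>

definition lattice_length :: "complex \<Rightarrow> int \<times> int \<Rightarrow> real" where
  "lattice_length \<tau> x = pi / Im \<tau> * (norm (lattice_pt \<tau> x))\<^sup>2"

text \<open>For negative k the weighted series is the complex conjugate of the one for |k|, and the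
  power of t is real.\<close>

lemma weighted_theta_inversion:
  assumes \<tau>: "Im \<tau> > 0" and t: "t > 0"
  shows "(\<Sum>\<^sub>\<infinity>x. weight k (lattice_pt \<tau> x) * exp (- of_real (lattice_length \<tau> x * (1 / t)))) =
    of_real t ^ (nat \<bar>k\<bar> + 1) * (\<Sum>\<^sub>\<infinity>x. weight k (lattice_pt \<tau> x) * exp (- of_real (lattice_length \<tau> x * t)))"
proof -
  have len: "lattice_length \<tau> x * u = pi * u / Im \<tau> * (norm (lattice_pt \<tau> x))\<^sup>2" for x u
    by (simp add: lattice_length_def)
  have *: "(\<Sum>\<^sub>\<infinity>x. weight k (lattice_pt \<tau> x) * exp (- of_real (lattice_length \<tau> x * u))) =
     (if k \<ge> 0 then lattice_theta \<tau> (nat \<bar>k\<bar>) u else cnj (lattice_theta \<tau> (nat \<bar>k\<bar>) u))" for u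
    unfolding lattice_theta_def len weight_def infsum_cnj[symmetric] by (simp add: exp_cnj)
  define n where "n = nat \<bar>k\<bar>"
  show ?thesis
    unfolding * n_def[symmetric] lattice_theta_inversion[OF \<tau> t, of n] by simp
qed

lemma lattice_length_lower_bound:
  assumes \<tau>: "Im \<tau> > 0"
  shows "\<exists>\<mu>>0. \<forall>x\<in>- {(0, 0)}. lattice_length \<tau> x \<ge> \<mu>"
proof -
  obtain K where K: "K > 0" "\<forall>m n. (of_int m)\<^sup>2 + (of_int n)\<^sup>2 \<le> K * (norm (lattice_pt \<tau> (m, n)))\<^sup>2"
    using lattice_pt_lower_bound[OF \<tau>] by blast
  have "lattice_length \<tau> x \<ge> pi / Im \<tau> / K" if x0: "x \<in> - {(0, 0)}" for x
  proof -
    obtain m n where x: "x = (m, n)" by fastforce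
    have "m \<noteq> 0 \<or> n \<noteq> 0" using x0 x by auto
    then have "m\<^sup>2 + n\<^sup>2 > 0" by (simp add: sum_power2_gt_zero_iff)
    then have "m\<^sup>2 + n\<^sup>2 \<ge> 1" by linarith
    then have "real_of_int (m\<^sup>2 + n\<^sup>2) \<ge> 1" by linarith
    then have "1 \<le> K * (norm (lattice_pt \<tau> x))\<^sup>2" using K(2)[rule_format, of m n] x by simp
    then have "1 / K \<le> (norm (lattice_pt \<tau> x))\<^sup>2" using K(1) by (simp add: field_simps)
    then have "pi / Im \<tau> * (1 / K) \<le> pi / Im \<tau> * (norm (lattice_pt \<tau> x))\<^sup>2"
      using \<tau> by (intro mult_left_mono) auto
    then show ?thesis by (simp add: lattice_length_def)
  qed
  then show ?thesis using \<tau> K(1) by (intro exI[of _ "pi / Im \<tau> / K"]) auto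
qed

lemma lattice_length_pos:
  "Im \<tau> > 0 \<Longrightarrow> x \<noteq> (0, 0) \<Longrightarrow> lattice_length \<tau> x > 0"
  using lattice_length_lower_bound[of \<tau>] by force

text \<open>The weight costs |k|/2 in the exponent: it turns |w|^(-2 \<sigma>) into |w|^(-2 \<rho>)
  with \<rho> = \<sigma> - |k|/2 > 1.\<close>

lemma weighted_dirichlet_summable:
  assumes \<tau>: "Im \<tau> > 0" and \<sigma>: "\<sigma> > 1 + of_int \<bar>k\<bar> / 2"
  shows "(\<lambda>x. norm (weight k (lattice_pt \<tau> x)) * lattice_length \<tau> x powr (- \<sigma>)) summable_on - {(0, 0)}"
proof -
  define \<rho> where "\<rho> = \<sigma> - of_int \<bar>k\<bar> / 2"
  have eq: "norm (weight k (lattice_pt \<tau> x)) * lattice_length \<tau> x powr (- \<sigma>) =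
     (pi / Im \<tau>) powr (- \<sigma>) * norm (lattice_pt \<tau> x) powr (- 2 * \<rho>)" if "x \<in> - {(0, 0)}" for x
  proof -
    define r where "r = norm (lattice_pt \<tau> x)"
    have r: "r > 0" using that lattice_pt_eq_0_iff[OF \<tau>, of x] by (simp add: r_def)
    have "r ^ nat \<bar>k\<bar> = r powr of_int \<bar>k\<bar>" using r by (simp add: powr_realpow[symmetric])
    moreover have "(pi / Im \<tau> * r\<^sup>2) powr (- \<sigma>) = (pi / Im \<tau>) powr (- \<sigma>) * r powr (- 2 * \<sigma>)"
    proof -
      have "r\<^sup>2 = r powr 2" using r by (simp add: powr_numeral)
      then have "r\<^sup>2 powr (- \<sigma>) = r powr (- 2 * \<sigma>)" by (simp only: powr_powr) simp
      then show ?thesis by (simp only: powr_mult)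
    qed
    ultimately show ?thesis
      using r by (simp add: norm_weight lattice_length_def \<rho>_def flip: r_def powr_add)
  qed
  have "(\<lambda>x. (pi / Im \<tau>) powr (- \<sigma>) * norm (lattice_pt \<tau> x) powr (- 2 * \<rho>)) summable_on - {(0, 0)}"
    using \<sigma> by (intro summable_on_cmult_right lattice_powr_summable \<tau>) (simp add: \<rho>_def)
  then show ?thesis by (subst summable_on_cong[OF eq])
qed

lemma weighted_theta_summable:
  assumes \<tau>: "Im \<tau> > 0" and t: "t > 0"
  shows "(\<lambda>x. norm (weight k (lattice_pt \<tau> x)) * exp (- (lattice_length \<tau> x * t))) summable_on UNIV"
  using lattice_gauss_power_summable[OF \<tau>, of "pi * t / Im \<tau>" "nat \<bar>k\<bar>"] \<tau> t
  by (simp add: norm_weight lattice_length_def mult_ac)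

text \<open>The lattice point 0 has weight 0^|k|, which is the constant \<open>d\<close>; left out
  of the Dirichlet series, it returns as the polar part when k = 0. Under v -> |k| + 1 - v the two
  \<open>J\<close> terms are exchanged, and so are the two polar terms.\<close>

lemma completed_lattice_series:
  fixes k :: int
  assumes \<tau>: "Im \<tau> > 0"
  shows "\<exists>J. J holomorphic_on UNIV \<and> (\<forall>v. Re v > 1 + of_int \<bar>k\<bar> / 2 \<longrightarrow>
       Gamma v * (\<Sum>\<^sub>\<infinity>x\<in>- {(0, 0)}. weight k (lattice_pt \<tau> x) * of_real (lattice_length \<tau> x) powr (- v))
       = J v + J (of_int (\<bar>k\<bar> + 1) - v) + (if k = 0 then 1 else 0) * (1 / (v - of_int (\<bar>k\<bar> + 1)) - 1 / v))"
proof -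
  define d :: complex where "d = (if k = 0 then 1 else 0)"
  obtain \<mu> where \<mu>: "\<mu> > 0" "\<And>x. x \<in> - {(0, 0)} \<Longrightarrow> lattice_length \<tau> x \<ge> \<mu>"
    using lattice_length_lower_bound[OF \<tau>] by metis
  have w0: "weight k (lattice_pt \<tau> (0, 0)) = d"
    by (auto simp: weight_def lattice_pt_def d_def power_0_left)
  have split: "(\<Sum>\<^sub>\<infinity>x. weight k (lattice_pt \<tau> x) * exp (- of_real (lattice_length \<tau> x * t)))
     = d + (\<Sum>\<^sub>\<infinity>x\<in>- {(0, 0)}. weight k (lattice_pt \<tau> x) * exp (- of_real (lattice_length \<tau> x * t)))"
    if t: "t > 0" for t
  proof -
    have "(\<lambda>x. weight k (lattice_pt \<tau> x) * exp (- of_real (lattice_length \<tau> x * t))) summable_on UNIV"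
      by (rule abs_summable_summable) (use weighted_theta_summable[OF \<tau> t] in \<open>simp add: norm_mult norm_exp_eq_Re\<close>)
    then have "(\<lambda>x. weight k (lattice_pt \<tau> x) * exp (- of_real (lattice_length \<tau> x * t))) summable_on - {(0, 0)}"
      by (rule summable_on_subset) auto
    then have "(\<Sum>\<^sub>\<infinity>x\<in>insert (0, 0) (- {(0, 0)}). weight k (lattice_pt \<tau> x) * exp (- of_real (lattice_length \<tau> x * t)))
      = weight k (lattice_pt \<tau> (0, 0)) * exp (- of_real (lattice_length \<tau> (0, 0) * t))
       + (\<Sum>\<^sub>\<infinity>x\<in>- {(0, 0)}. weight k (lattice_pt \<tau> x) * exp (- of_real (lattice_length \<tau> x * t)))"
      by (rule infsum_insert) auto
    moreover have "insert (0, 0) (- {(0, 0)}) = (UNIV :: (int \<times> int) set)" by auto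
    moreover have "lattice_length \<tau> (0, 0) = 0" by (simp add: lattice_length_def lattice_pt_def)
    ultimately show ?thesis by (simp add: w0)
  qed
  interpret modular_dirichlet_series "- {(0, 0)}" "\<lambda>x. weight k (lattice_pt \<tau> x)" "lattice_length \<tau>"
    \<mu> "1 + of_int \<bar>k\<bar> / 2" "nat \<bar>k\<bar> + 1" d
  proof
    show "d + (\<Sum>\<^sub>\<infinity>x\<in>- {(0, 0)}. weight k (lattice_pt \<tau> x) * exp (- of_real (lattice_length \<tau> x * (1 / t)))) =
      of_real t ^ (nat \<bar>k\<bar> + 1) * (d + (\<Sum>\<^sub>\<infinity>x\<in>- {(0, 0)}. weight k (lattice_pt \<tau> x) * exp (- of_real (lattice_length \<tau> x * t))))"
      if "t > 0" for t
      using weighted_theta_inversion[OF \<tau> that, of k] split[OF that] split[of "1 / t"] that by simp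
    show "(\<lambda>x. norm (weight k (lattice_pt \<tau> x)) * exp (- (lattice_length \<tau> x * t))) summable_on - {(0, 0)}"
      if "t > 0" for t
      using weighted_theta_summable[OF \<tau> that] by (rule summable_on_subset) auto
  qed (use \<mu> weighted_dirichlet_summable[OF \<tau>] in auto)
  have r: "of_nat (nat \<bar>k\<bar> + 1) = (of_int (\<bar>k\<bar> + 1) :: complex)"
    by simp
  show ?thesis
    unfolding d_def[symmetric]
  proof (intro exI[of _ J] conjI allI impI J_holomorphic)
    fix v :: complex assume v: "Re v > 1 + of_int \<bar>k\<bar> / 2"
    \<comment> \<open>A nonzero \<open>d\<close> means k = 0, and then both conditions read Re v >
      1.\<close>
    moreover have "Re v > real (nat \<bar>k\<bar> + 1)" if "d \<noteq> 0"
      using that v by (simp add: d_def split: if_splits)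
    moreover have "Re v > 0" using v by (rule le_less_trans[rotated]) simp
    ultimately show "Gamma v * (\<Sum>\<^sub>\<infinity>x\<in>- {(0, 0)}. weight k (lattice_pt \<tau> x) * of_real (lattice_length \<tau> x) powr (- v))
       = J v + J (of_int (\<bar>k\<bar> + 1) - v) + d * (1 / (v - of_int (\<bar>k\<bar> + 1)) - 1 / v)"
      using mellin_transform[of v] unfolding r by blast
  qed
qed

text \<open>All powers depending on s fit into the Dirichlet term because b^2 / (q y) = 1 / Im
  \<tau>; the remaining factor is independent of s and does not disturb the functional equation. The
  parameter \<open>b\<close> lets one identity serve both lattices, with b = 1 and b = q.\<close>

lemma eisenstein_term_scaled:
  fixes q y b :: real and k :: int and s :: complex
  assumes q: "q > 0" and y: "y > 0" and b: "b > 0" and \<tau>: "Im \<tau> = q * y / b\<^sup>2" and x: "x \<noteq> (0, 0)"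
  defines "u \<equiv> s + of_int k / 2"
  shows "of_real (pi / q) powr (- u) * eisenstein_term k y s (of_real b * lattice_pt \<tau> x) =
    of_real (y powr (- of_int k / 2) * (pi / Im \<tau>) powr (of_int \<bar>k\<bar> / 2)) *
    (weight k (lattice_pt \<tau> x) * of_real (lattice_length \<tau> x) powr (- (u + of_int \<bar>k\<bar> / 2)))"
proof -
  have \<tau>0: "Im \<tau> > 0" unfolding \<tau> using q y b by simp
  define w where "w = lattice_pt \<tau> x"
  define r where "r = norm w"
  have w: "w \<noteq> 0" using x lattice_pt_eq_0_iff[OF \<tau>0, of x] by (simp add: w_def)
  have r: "r > 0" using w by (simp add: r_def)
  have pw: "complex_of_real a powr e = exp (e * of_real (ln a))" if "a > 0" for a e
    using that by (simp add: powr_def flip: Ln_of_real)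
  \<comment> \<open>For k >= 0 this is 1/w = cnj w / |w|^2 raised to the power k; for k < 0 the
    exponent k + |k| vanishes.\<close>
  have inv_w: "inverse (w powi k) = weight k w * exp (- of_int (k + \<bar>k\<bar>) * of_real (ln r))"
  proof (cases "k \<ge> 0")
    case True
    define n where "n = nat k"
    have k: "k = int n" using True by (simp add: n_def)
    have "exp (of_int (k + \<bar>k\<bar>) * complex_of_real (ln r)) = of_real r ^ (2 * n)"
      using r by (simp add: k exp_of_nat_mult[of "2 * n", simplified] exp_of_real)
    also have "\<dots> = (w * cnj w) ^ n"
      by (simp add: r_def complex_norm_square[symmetric] power_mult)
    finally have "exp (- of_int (k + \<bar>k\<bar>) * complex_of_real (ln r)) = inverse ((w * cnj w) ^ n)"
      by (simp only: mult_minus_left exp_minus)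
    then show ?thesis using w by (simp add: weight_def k power_mult_distrib field_simps)
  next
    case False
    define n where "n = nat (- k)"
    have k: "k = - int n" using False by (simp add: n_def)
    then show ?thesis using False by (simp add: weight_def power_int_minus)
  qed
  have b_k: "of_real b powi k = exp (of_int k * complex_of_real (ln b))"
    using b by (simp add: exp_power_int[symmetric] exp_of_real)
  have lnr: "ln (norm (of_real b * w)) = ln b + ln r"
    using b r by (simp add: norm_mult r_def ln_mult)
  have ln\<tau>: "ln (Im \<tau>) = ln q + ln y - 2 * ln b"
    unfolding \<tau> using q y b by (simp add: ln_div ln_mult ln_realpow)
  have lnl: "ln (lattice_length \<tau> x) = ln pi - ln (Im \<tau>) + 2 * ln r"
    unfolding lattice_length_def w_def[symmetric] r_def[symmetric]
    using \<tau>0 r by (simp add: ln_mult ln_div ln_realpow)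
  have len: "lattice_length \<tau> x > 0" by (rule lattice_length_pos[OF \<tau>0 x])
  have C: "complex_of_real (y powr (- of_int k / 2) * (pi / Im \<tau>) powr (of_int \<bar>k\<bar> / 2)) =
     exp (- of_int k / 2 * of_real (ln y) + of_int \<bar>k\<bar> / 2 * (of_real (ln pi) - of_real (ln (Im \<tau>))))"
  proof -
    have "y powr (- of_int k / 2) * (pi / Im \<tau>) powr (of_int \<bar>k\<bar> / 2) =
       exp (- of_int k / 2 * ln y + of_int \<bar>k\<bar> / 2 * (ln pi - ln (Im \<tau>)))"
      using y \<tau>0 unfolding exp_add by (simp add: powr_def ln_div)
    then show ?thesis by (simp only: exp_of_real[symmetric]) (simp flip: of_int_abs)
  qed
  have p1: "of_real (pi / q) powr (- u) = exp (- u * of_real (ln pi - ln q))"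
    using pw[of "pi / q" "- u"] q by (simp add: ln_div)
  have p2: "of_real y powr s = exp (s * of_real (ln y))" by (rule pw[OF y])
  have p3: "of_real (norm (of_real b * w)) powr (2 * s) = exp (2 * s * of_real (ln b + ln r))"
    unfolding lnr[symmetric] by (rule pw) (use b w in simp)
  have p4: "(of_real b * w) powi k = exp (of_int k * complex_of_real (ln b)) * w powi k"
    by (simp only: power_int_mult_distrib b_k)
  have "of_real (pi / q) powr (- u) * eisenstein_term k y s (of_real b * w) =
     exp (- u * of_real (ln pi - ln q)) * exp (s * of_real (ln y)) * inverse (exp (2 * s * of_real (ln b + ln r)))
     * inverse (exp (of_int k * complex_of_real (ln b))) * inverse (w powi k)"
    unfolding eisenstein_term_def p1 p2 p3 p4 by (simp add: divide_inverse mult_ac)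
  also have "\<dots> = weight k w * exp (- u * of_real (ln pi - ln q) + s * of_real (ln y) - 2 * s * of_real (ln b + ln r)
     - of_int k * complex_of_real (ln b) - of_int (k + \<bar>k\<bar>) * of_real (ln r))"
    unfolding inv_w by (simp add: exp_add exp_diff exp_minus field_simps)
  also have "- u * of_real (ln pi - ln q) + s * of_real (ln y) - 2 * s * of_real (ln b + ln r)
     - of_int k * complex_of_real (ln b) - of_int (k + \<bar>k\<bar>) * of_real (ln r) =
     (- of_int k / 2 * of_real (ln y) + of_int \<bar>k\<bar> / 2 * (of_real (ln pi) - of_real (ln (Im \<tau>))))
     + - (u + of_int \<bar>k\<bar> / 2) * of_real (ln (lattice_length \<tau> x))"
    unfolding lnl ln\<tau> u_def by (simp add: field_simps)
  finally show ?thesis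
    unfolding C pw[OF len] w_def[symmetric] by (simp only: exp_add mult_ac)
qed

section \<open>Reduction of the level structure to full lattices\<close>

text \<open>The parameter t is forced: it divides gcd m n, which in turn divides gcd (p m) n =
  t.\<close>

lemma pairs_L_eq: "pairs_L p = {(m, n). (m, n) \<noteq> (0, 0) \<and> gcd (int p * m) n = gcd m n}" if "p > 0" for p
proof -
  have "(m, n) \<in> pairs_L p \<longleftrightarrow> (m, n) \<noteq> (0, 0) \<and> gcd (int p * m) n = gcd m n" for m n
  proof
    assume "(m, n) \<in> pairs_L p"
    then obtain t where t: "t \<ge> 1" "t dvd m" "t dvd n" "gcd (int p * m) n = t"
      by (auto simp: pairs_L_def)
    have "gcd m n dvd gcd (int p * m) n" by (simp add: gcd_dvdI1)
    moreover have "t dvd gcd m n" using t by simp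
    ultimately have "gcd m n = t" using t by (intro zdvd_antisym_nonneg) auto
    with t show "(m, n) \<noteq> (0, 0) \<and> gcd (int p * m) n = gcd m n" by auto
  next
    assume *: "(m, n) \<noteq> (0, 0) \<and> gcd (int p * m) n = gcd m n"
    then have "gcd m n \<noteq> 0" by auto
    then have "gcd m n \<ge> 1" using gcd_ge_0_int[of m n] by linarith
    with * show "(m, n) \<in> pairs_L p" by (auto simp: pairs_L_def intro!: bexI[of _ "gcd m n"])
  qed
  then show ?thesis by auto
qed

lemma pairs_R_eq_swap: "pairs_R p = prod.swap ` pairs_L p"
proof -
  have "(m, n) \<in> pairs_R p \<longleftrightarrow> (n, m) \<in> pairs_L p" for m n
    by (auto simp: pairs_R_def pairs_L_def gcd.commute)
  then show ?thesis by (force simp: image_iff)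
qed

lemma pairs_R_eq: "pairs_R p = {(m, n). (m, n) \<noteq> (0, 0) \<and> gcd m (int p * n) = gcd m n}" if "p > 0" for p
  unfolding pairs_R_eq_swap pairs_L_eq[OF that] by (auto simp: image_iff gcd.commute)

text \<open>After division by g = gcd m n the coordinates a, b are coprime. If the factor p changes
  the gcd, then p divides b, so a is prime to b and to b / p, and n' = n / p works. The second part
  supplies disjointness: for (m, p n), a further factor p on m multiplies the gcd by p.\<close>

lemma prime_gcd_mult_left:
  fixes m n :: int
  assumes p: "prime p"
  shows "gcd (int p * m) n \<noteq> gcd m n \<Longrightarrow> (\<exists>n'. n = int p * n' \<and> gcd m (int p * n') = gcd m n')"
    and "gcd m (int p * n) = gcd m n \<Longrightarrow> (m, n) \<noteq> (0, 0) \<Longrightarrow>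
      gcd (int p * m) (int p * n) \<noteq> gcd m (int p * n)"
proof -
  have p': "prime (int p)" using p by simp
  show "\<exists>n'. n = int p * n' \<and> gcd m (int p * n') = gcd m n'" if ne: "gcd (int p * m) n \<noteq> gcd m n"
  proof -
    define g where "g = gcd m n"
    have g0: "g \<noteq> 0" using ne by (auto simp: g_def)
    from gcd_coprime_exists[of m n] g0 obtain a b where "m = a * g" "n = b * g" and cop_ab: "coprime a b"
      unfolding g_def by blast
    then have ab: "m = g * a" "n = g * b" "coprime a b" by (simp_all only: mult.commute)
    have gp: "g > 0" using g0 gcd_ge_0_int[of m n] by (simp add: g_def)
    have gm: "gcd (g * x) (g * y) = g * gcd x y" for x y
      using gcd_mult_distrib_int[of g x y] gp by simp
    have "gcd (int p * m) n = g * gcd (int p * a) b"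
      unfolding ab(1,2) by (simp add: gm mult.left_commute[of "int p"])
    then have "gcd (int p * a) b \<noteq> 1" using ne by (auto simp: g_def)
    then have "\<not> coprime (int p * a) b" by (simp add: coprime_iff_gcd_eq_1)
    then have "\<not> coprime (int p) b" using ab(3) by simp
    then have "int p dvd b" using p' prime_imp_coprime by blast
    then obtain b' where b': "b = int p * b'" by auto
    have cop: "coprime a (int p * b')" using ab(3) b' by simp
    then have cop': "coprime a b'" by simp
    have "gcd m (int p * (g * b')) = g * gcd a (int p * b')"
      unfolding ab(1) by (simp add: gm mult.left_commute[of "int p"])
    moreover have "gcd m (g * b') = g * gcd a b'"
      unfolding ab(1) by (rule gm)
    ultimately show ?thesis
      using cop cop' by (intro exI[of _ "g * b'"]) (simp add: ab(2) b' mult.left_commute)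
  qed
  show "gcd (int p * m) (int p * n) \<noteq> gcd m (int p * n)" if "gcd m (int p * n) = gcd m n" "(m, n) \<noteq> (0, 0)"
  proof -
    have "gcd (int p * m) (int p * n) = int p * gcd m n"
      using gcd_mult_distrib_int[of "int p" m n] by simp
    moreover have "gcd m n \<noteq> 0" using that(2) by auto
    moreover have "int p \<noteq> 1" using p by auto
    ultimately show ?thesis using that(1) by auto
  qed
qed

lemma nonzero_pairs_split_L:
  assumes p: "prime p"
  shows "- {(0, 0)} = pairs_L p \<union> (\<lambda>(m, n). (m, int p * n)) ` pairs_R p"
    and "pairs_L p \<inter> (\<lambda>(m, n). (m, int p * n)) ` pairs_R p = {}"
proof -
  have p0: "p > 0" using p prime_gt_0_nat by blast
  show "- {(0, 0)} = pairs_L p \<union> (\<lambda>(m, n). (m, int p * n)) ` pairs_R p"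
  proof (intro equalityI subsetI)
    fix x :: "int \<times> int" assume "x \<in> - {(0, 0)}"
    then obtain m n where x: "x = (m, n)" "(m, n) \<noteq> (0, 0)" by (cases x) auto
    show "x \<in> pairs_L p \<union> (\<lambda>(m, n). (m, int p * n)) ` pairs_R p"
    proof (cases "gcd (int p * m) n = gcd m n")
      case False
      from prime_gcd_mult_left(1)[OF p False] obtain n' where
        "n = int p * n'" "gcd m (int p * n') = gcd m n'" by blast
      then show ?thesis using x by (auto simp: pairs_R_eq[OF p0] intro!: image_eqI[of _ _ "(m, n')"])
    qed (use x in \<open>auto simp: pairs_L_eq[OF p0]\<close>)
  qed (use p0 in \<open>auto simp: pairs_L_eq pairs_R_eq\<close>)
  show "pairs_L p \<inter> (\<lambda>(m, n). (m, int p * n)) ` pairs_R p = {}"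
    using prime_gcd_mult_left(2)[OF p] by (auto simp: pairs_L_eq[OF p0] pairs_R_eq[OF p0])
qed

text \<open>The mirror image of the previous decomposition under exchange of the coordinates, which
  swaps \<open>pairs_L\<close> and \<open>pairs_R\<close>.\<close>

lemma nonzero_pairs_split_R:
  assumes p: "prime p"
  shows "- {(0, 0)} = pairs_R p \<union> (\<lambda>(m, n). (int p * m, n)) ` pairs_L p"
    and "pairs_R p \<inter> (\<lambda>(m, n). (int p * m, n)) ` pairs_L p = {}"
proof -
  have L: "pairs_L p = prod.swap ` pairs_R p"
    by (simp add: pairs_R_eq_swap image_image)
  have eq: "(\<lambda>(m, n). (int p * m, n)) ` pairs_L p = prod.swap ` ((\<lambda>(m, n). (m, int p * n)) ` pairs_R p)"
    unfolding L by (simp add: image_image case_prod_unfold)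
  have "prod.swap ` (- {(0, 0)}) = (- {(0, 0)} :: (int \<times> int) set)"
    by (simp add: bij_image_Compl_eq)
  then show "- {(0, 0)} = pairs_R p \<union> (\<lambda>(m, n). (int p * m, n)) ` pairs_L p"
    unfolding eq using nonzero_pairs_split_L(1)[OF p] pairs_R_eq_swap[of p] image_Un by metis
  show "pairs_R p \<inter> (\<lambda>(m, n). (int p * m, n)) ` pairs_L p = {}"
    unfolding eq pairs_R_eq_swap using nonzero_pairs_split_L(2)[OF p] 
    by (subst image_Int[symmetric]) (auto simp: pairs_R_eq_swap)
qed

text \<open>If L and R denote the two restricted sums, the full sums are L + c R and R + c L. The
  common factor c makes their total proportional to L + R; for Eisenstein terms c = p powr -
  u.\<close>

lemma infsum_pairs:
  fixes f g :: "int \<times> int \<Rightarrow> complex"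
  assumes p: "prime p" and f: "f summable_on - {(0, 0)}" and g: "g summable_on - {(0, 0)}"
    and fg: "\<And>m n. f (m, int p * n) = c * g (m, n)" and gf: "\<And>m n. g (int p * m, n) = c * f (m, n)"
  shows "(1 + c) * (infsum f (pairs_L p) + infsum g (pairs_R p)) = infsum f (- {(0, 0)}) + infsum g (- {(0, 0)})"
proof -
  have p0: "p > 0" using p prime_gt_0_nat by blast
  have injR: "inj_on (\<lambda>(m, n). (m, int p * n)) A" and injL: "inj_on (\<lambda>(m, n). (int p * m, n)) A" for A
    using p0 by (auto simp: inj_on_def)
  have "infsum f (- {(0, 0)}) = infsum f (pairs_L p) + infsum f ((\<lambda>(m, n). (m, int p * n)) ` pairs_R p)"
    unfolding nonzero_pairs_split_L(1)[OF p]
    by (rule infsum_Un_disjoint[OF _ _ nonzero_pairs_split_L(2)[OF p]];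
        rule summable_on_subset[OF f]; use nonzero_pairs_split_L(1)[OF p] in blast)
  also have "infsum f ((\<lambda>(m, n). (m, int p * n)) ` pairs_R p) = c * infsum g (pairs_R p)"
    by (subst infsum_reindex[OF injR]) (simp add: o_def case_prod_unfold fg infsum_cmult_right')
  finally have 1: "infsum f (- {(0, 0)}) = infsum f (pairs_L p) + c * infsum g (pairs_R p)" .
  have "infsum g (- {(0, 0)}) = infsum g (pairs_R p) + infsum g ((\<lambda>(m, n). (int p * m, n)) ` pairs_L p)"
    unfolding nonzero_pairs_split_R(1)[OF p]
    by (rule infsum_Un_disjoint[OF _ _ nonzero_pairs_split_R(2)[OF p]];
        rule summable_on_subset[OF g]; use nonzero_pairs_split_R(1)[OF p] in blast)
  also have "infsum g ((\<lambda>(m, n). (int p * m, n)) ` pairs_L p) = c * infsum f (pairs_L p)"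
    by (subst infsum_reindex[OF injL]) (simp add: o_def case_prod_unfold gf infsum_cmult_right')
  finally show ?thesis using 1 by (simp add: algebra_simps)
qed

section \<open>Meromorphic continuation\<close>

text \<open>A difference of normalised functions need not be normalised, as common poles may cancel.
  The identity theorem is therefore applied to \<open>remove_sings\<close> of the
  difference.\<close>

lemma nicely_meromorphic_eqI:
  assumes f: "f nicely_meromorphic_on UNIV" and g: "g nicely_meromorphic_on UNIV"
    and A: "open A" "a \<in> A" and eq: "\<And>z. z \<in> A \<Longrightarrow> f z = g z"
  shows "f = g"
proof
  fix z
  define h where "h = remove_sings (\<lambda>z. f z - g z)"
  have fg: "(\<lambda>z. f z - g z) meromorphic_on UNIV"
    using f g by (auto simp: nicely_meromorphic_on_def intro!: meromorphic_intros)
  have h: "h nicely_meromorphic_on UNIV"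
    unfolding h_def by (rule remove_sings_nicely_meromorphic[OF fg])
  have "eventually (\<lambda>w. w \<in> A) (at a)" using A by (rule eventually_at_in_open')
  moreover have iso: "isolated_singularity_at (\<lambda>z. f z - g z) w" for w
    using meromorphic_on_subset[OF fg, of "{w}"] meromorphic_on_isolated_singularity by auto
  have ev: "eventually (\<lambda>x. h x = f x - g x) (at w)" for w
    unfolding h_def by (rule eventually_remove_sings_eq_at[OF iso])
  have "eventually (\<lambda>w. h w = 0) (at a)"
    using calculation ev[of a] by eventually_elim (simp add: eq)
  then have "frequently (\<lambda>w. h w = 0) (at a)" by (intro eventually_frequently) auto
  then have h0: "h w = 0" for w
    by (rule frequently_eq_meromorphic_imp_constant[OF _ h]) auto
  have "eventually (\<lambda>w. f w = g w) (at z)"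
    using ev[of z] by eventually_elim (simp add: h0)
  then have "remove_sings f z = remove_sings g z" by (intro remove_sings_cong) auto
  \<comment> \<open>A normalised function is its own normalisation: at a pole both values are 0, and
    elsewhere it is analytic.\<close>
  moreover have "remove_sings F z = F z" if "F nicely_meromorphic_on UNIV" for F
    using that remove_sings_at_pole[of F z] unfolding nicely_meromorphic_on_def by fastforce
  ultimately show "f z = g z" using f g by simp
qed

text \<open>Holomorphy on \<open>A\<close> guarantees that normalising \<open>H\<close> changes no
  value there, so the normalised function still extends \<open>f\<close>; uniqueness then justifies
  the definite description.\<close>

lemma meromorphic_continuation_eqI:
  assumes H: "H meromorphic_on UNIV" and ana: "H holomorphic_on A" and A: "open A" "A \<noteq> {}"
    and eq: "\<And>s. s \<in> A \<Longrightarrow> f s = H s"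
  shows "is_meromorphic_continuation f A (meromorphic_continuation f A)"
    and "meromorphic_continuation f A = remove_sings H"
proof -
  have cont: "is_meromorphic_continuation f A (remove_sings H)"
    unfolding is_meromorphic_continuation_def
  proof (intro conjI ballI remove_sings_nicely_meromorphic[OF H])
    fix s assume s: "s \<in> A"
    then have "H analytic_on {s}" using ana A(1) analytic_at by blast
    then show "remove_sings H s = f s" using eq[OF s] by simp
  qed
  have uniq: "F = remove_sings H" if "is_meromorphic_continuation f A F" for F
  proof -
    obtain a where "a \<in> A" using A(2) by blast
    then show ?thesis
      using that cont unfolding is_meromorphic_continuation_def
      by (intro nicely_meromorphic_eqI[OF _ _ A(1)]) auto
  qed
  show eq: "meromorphic_continuation f A = remove_sings H"
    unfolding meromorphic_continuation_def by (rule the_equality) (fact cont, rule uniq)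
  from cont show "is_meromorphic_continuation f A (meromorphic_continuation f A)" by (simp add: eq)
qed

text \<open>\<open>remove_sings\<close> at a point depends only on the punctured neighbourhood, and
  s -> a - s carries punctured neighbourhoods to punctured neighbourhoods. This transports the
  symmetry to normalised functions, poles included.\<close>

lemma remove_sings_reflect:
  fixes H :: "complex \<Rightarrow> complex"
  assumes "\<And>s. H (a - s) = H s"
  shows "remove_sings H (a - s) = remove_sings H s"
proof -
  have "filtermap (\<lambda>s. a - s) (at s) = at (a - s)"
  proof -
    have "filtermap (\<lambda>s. a - s) (at s) = filtermap (\<lambda>x. x + a) (filtermap uminus (at s))"
      by (simp add: filtermap_filtermap)
    also have "filtermap uminus (at s) = at (- s)" by (simp add: filtermap_at_minus)
    also have "filtermap (\<lambda>x. x + a) (at (- s)) = at (a - s)"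
      using filtermap_at_shift[of "- a" "- s"] by (simp add: add.commute)
    finally show ?thesis .
  qed
  then have "remove_sings (H \<circ> (\<lambda>s. a - s)) s = remove_sings H (a - s)"
    by (rule remove_sings_compose)
  moreover have "H \<circ> (\<lambda>s. a - s) = H" using assms by auto
  ultimately show ?thesis by simp
qed

section \<open>Homogeneity of the terms, the factor at p, and the sum over one lattice\<close>

lemma eisenstein_term_homogeneous:
  assumes "a > 0"
  shows "eisenstein_term k y s (of_real a * w) = of_real a powr (- 2 * s - of_int k) * eisenstein_term k y s w"
\<comment> \<open>At w = 0 the denominators vanish and both sides are 0 by convention. The relation
  thus holds for all integer pairs, the form in which \<open>infsum_pairs\<close> asks for
  it.\<close>
proof (cases "w = 0")
  case False
  have pw: "complex_of_real c powr e = exp (e * of_real (ln c))" if "c > 0" for c e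
    using that by (simp add: powr_def flip: Ln_of_real)
  have n: "norm (of_real a * w) = a * norm w" using assms by (simp add: norm_mult)
  have p1: "of_real (norm (of_real a * w)) powr (2 * s) = of_real a powr (2 * s) * of_real (norm w) powr (2 * s)"
    unfolding n using assms False by (simp add: pw ln_mult ring_distribs exp_add del: of_real_mult)
  have p2: "(of_real a * w) powi k = of_real a powr of_int k * w powi k"
    using assms by (simp add: power_int_mult_distrib pw exp_power_int[symmetric] exp_of_real)
  have "of_real a powr (- 2 * s - of_int k) = inverse (of_real a powr (2 * s) * of_real a powr of_int k :: complex)"
    using assms by (simp add: pw ring_distribs exp_add exp_diff exp_minus field_simps)
  then show ?thesis unfolding eisenstein_term_def p1 p2 by (simp add: field_simps)
qed (simp add: eisenstein_term_def)

text \<open>With X = p^(u - 1) the denominator is 1 - X^2 = (1 - X)(1 + X), and on the half plane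
  |X| > 1, so the factor 1 - X can be cancelled.\<close>

lemma f_factor_eq:
  assumes "p > 1" "s \<in> halfplane k"
  shows "f_factor p k s = 1 / (1 + of_nat p powr (s + of_int k / 2 - 1))"
proof -
  define X where "X = complex_of_nat p powr ((s - 1) + of_int k / 2)"
  have pr: "complex_of_nat p = of_real (real p)" by simp
  have "norm X = real p powr (Re s - 1 + of_int k / 2)"
    unfolding X_def pr using assms(1) by (subst norm_powr_real_powr) simp_all
  also have "\<dots> > 1" using assms by (simp add: halfplane_def field_simps)
  finally have "norm X > 1" .
  then have "X \<noteq> 1" "X \<noteq> - 1" by auto
  then have nz: "1 - X \<noteq> 0" "1 + X \<noteq> 0" by (auto simp: add_eq_0_iff)
  have sq: "of_nat p powr (2 * s + of_int k - 2) = X ^ 2"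
    unfolding X_def powr_add[symmetric] power2_eq_square by (simp add: algebra_simps)
  have fac: "1 - X ^ 2 = (1 - X) * (1 + X)" by (simp add: power2_eq_square algebra_simps)
  have arg: "s + of_int k / 2 - 1 = (s - 1) + of_int k / 2" by simp
  show ?thesis
    unfolding f_factor_def arg X_def[symmetric] sq fac using nz by (simp add: divide_inverse)
qed

lemma eisenstein_lattice_sum:
  fixes q y b :: real and k :: int and s :: complex
  assumes q: "q > 0" and y: "y > 0" and b: "b > 0" and \<tau>: "Im \<tau> = q * y / b\<^sup>2" and s: "s \<in> halfplane k"
  defines "u \<equiv> s + of_int k / 2"
  shows "(\<lambda>x. eisenstein_term k y s (of_real b * lattice_pt \<tau> x)) summable_on - {(0, 0)}"
    and "of_real (pi / q) powr (- u) * (\<Sum>\<^sub>\<infinity>x\<in>- {(0, 0)}. eisenstein_term k y s (of_real b * lattice_pt \<tau> x)) =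
      of_real (y powr (- of_int k / 2) * (pi / Im \<tau>) powr (of_int \<bar>k\<bar> / 2)) *
      (\<Sum>\<^sub>\<infinity>x\<in>- {(0, 0)}. weight k (lattice_pt \<tau> x) * of_real (lattice_length \<tau> x) powr (- (u + of_int \<bar>k\<bar> / 2)))"
proof -
  have \<tau>0: "Im \<tau> > 0" unfolding \<tau> using q y b by simp
  define P where "P = complex_of_real (pi / q) powr (- u)"
  define C where "C = complex_of_real (y powr (- of_int k / 2) * (pi / Im \<tau>) powr (of_int \<bar>k\<bar> / 2))"
  define g where "g = (\<lambda>x. weight k (lattice_pt \<tau> x) * of_real (lattice_length \<tau> x) powr (- (u + of_int \<bar>k\<bar> / 2)))"
  have P: "P \<noteq> 0" using q by (simp add: P_def)
  have eq: "P * eisenstein_term k y s (of_real b * lattice_pt \<tau> x) = C * g x" if "x \<in> - {(0, 0)}" for x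
    unfolding P_def C_def g_def u_def
    by (rule eisenstein_term_scaled[OF q y b \<tau>]) (use that in simp)
  have ng: "norm (weight k (lattice_pt \<tau> x)) * lattice_length \<tau> x powr (- Re (u + of_int \<bar>k\<bar> / 2)) = norm (g x)"
    if "x \<in> - {(0, 0)}" for x
    using lattice_length_pos[OF \<tau>0, of x] that by (simp add: g_def norm_mult norm_powr_real_powr)
  have "Re (u + of_int \<bar>k\<bar> / 2) > 1 + of_int \<bar>k\<bar> / 2"
    using s by (simp add: u_def halfplane_def)
  from weighted_dirichlet_summable[OF \<tau>0 this] have "(\<lambda>x. norm (g x)) summable_on - {(0, 0)}"
    by (subst (asm) summable_on_cong[OF ng])
  then have g: "g summable_on - {(0, 0)}" by (rule abs_summable_summable)
  then have "(\<lambda>x. C * g x) summable_on - {(0, 0)}" by (rule summable_on_cmult_right)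
  then have 1: "(\<lambda>x. P * eisenstein_term k y s (of_real b * lattice_pt \<tau> x)) summable_on - {(0, 0)}"
    by (subst summable_on_cong[OF eq])
  from summable_on_cmult_right[OF 1, of "inverse P"]
  show "(\<lambda>x. eisenstein_term k y s (of_real b * lattice_pt \<tau> x)) summable_on - {(0, 0)}"
    using P by (simp add: mult.assoc[symmetric])
  have "P * (\<Sum>\<^sub>\<infinity>x\<in>- {(0, 0)}. eisenstein_term k y s (of_real b * lattice_pt \<tau> x)) =
     (\<Sum>\<^sub>\<infinity>x\<in>- {(0, 0)}. P * eisenstein_term k y s (of_real b * lattice_pt \<tau> x))"
    by (rule infsum_cmult_right'[symmetric])
  also have "\<dots> = (\<Sum>\<^sub>\<infinity>x\<in>- {(0, 0)}. C * g x)" by (rule infsum_cong[OF eq])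
  also have "\<dots> = C * infsum g (- {(0, 0)})" by (rule infsum_cmult_right')
  finally show "of_real (pi / q) powr (- u) * (\<Sum>\<^sub>\<infinity>x\<in>- {(0, 0)}. eisenstein_term k y s (of_real b * lattice_pt \<tau> x)) =
      of_real (y powr (- of_int k / 2) * (pi / Im \<tau>) powr (of_int \<bar>k\<bar> / 2)) *
      (\<Sum>\<^sub>\<infinity>x\<in>- {(0, 0)}. weight k (lattice_pt \<tau> x) * of_real (lattice_length \<tau> x) powr (- (u + of_int \<bar>k\<bar> / 2)))"
    by (simp only: P_def C_def g_def)
qed

lemma open_halfplane: "open (halfplane k)"
  unfolding halfplane_def by (rule open_halfspace_Re_gt)

lemma halfplane_nonempty: "halfplane k \<noteq> {}"
proof -
  have "of_int (1 - k + \<bar>k\<bar> + 1) \<in> halfplane k" by (simp add: halfplane_def field_simps)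
  then show ?thesis by blast
qed

text \<open>The continuation is the closed expression \<open>H\<close>. Its symmetry is read off
  pointwise, since each \<open>A J\<close> is invariant under v -> r - v and \<open>N\<close> under
  u -> 1 - u; this includes zeros of \<open>N\<close>, where both sides are 0.\<close>

lemma G_hat_series_continuation:
  fixes k :: int
  assumes p: "prime p" and z: "Im z > 0"
  shows "\<exists>H. H meromorphic_on UNIV \<and> H holomorphic_on halfplane k \<and>
    (\<forall>s\<in>halfplane k. G_hat_series p k z s = H s) \<and> (\<forall>s. H (1 - of_int k - s) = H s)"
proof -
  have p1: "p > 1" using p by (rule prime_gt_1_nat)
  define y q where "y = Im z" and "q = sqrt (real p)"
  have y: "y > 0" using z by (simp add: y_def)
  have q: "q > 0" using p1 by (simp add: q_def)
  have q2: "q * q = real p" using p1 by (simp add: q_def)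
  \<comment> \<open>The arguments of the terms are lattice points of \<open>\<tau>1\<close>, and q
    times lattice points of \<open>\<tau>2\<close>. Both imaginary parts have the form q y / b^2,
    with b = 1 and b = q, so the factor (pi / q)^(-u) suits both.\<close>
  define \<tau>1 \<tau>2 where "\<tau>1 = of_real q * z" and "\<tau>2 = z / of_real q"
  have Im1: "Im \<tau>1 = q * y / 1\<^sup>2" by (simp add: \<tau>1_def y_def)
  have Im2: "Im \<tau>2 = q * y / q\<^sup>2" using q by (simp add: \<tau>2_def y_def power2_eq_square Im_divide_of_real)
  have pos: "Im \<tau>1 > 0" "Im \<tau>2 > 0" unfolding Im1 Im2 using q y by auto
  define d :: complex where "d = (if k = 0 then 1 else 0)"
  define r :: complex where "r = of_int (\<bar>k\<bar> + 1)"
  define D where "D = (\<lambda>\<tau> v. \<Sum>\<^sub>\<infinity>x\<in>- {(0, 0)}. weight k (lattice_pt \<tau> x) * of_real (lattice_length \<tau> x) powr (- v))"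
  define A where "A = (\<lambda>J v. J v + J (r - v) + d * (1 / (v - r) - 1 / v) :: complex)"
  have "\<exists>J. J holomorphic_on UNIV \<and> (\<forall>v. Re v > 1 + of_int \<bar>k\<bar> / 2 \<longrightarrow> Gamma v * D \<tau>1 v = A J v)"
    unfolding D_def A_def r_def d_def by (rule completed_lattice_series[OF pos(1)])
  then obtain J1 where J1: "J1 holomorphic_on UNIV" "\<And>v. Re v > 1 + of_int \<bar>k\<bar> / 2 \<Longrightarrow> Gamma v * D \<tau>1 v = A J1 v"
    by blast
  have "\<exists>J. J holomorphic_on UNIV \<and> (\<forall>v. Re v > 1 + of_int \<bar>k\<bar> / 2 \<longrightarrow> Gamma v * D \<tau>2 v = A J v)"
    unfolding D_def A_def r_def d_def by (rule completed_lattice_series[OF pos(2)])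
  then obtain J2 where J2: "J2 holomorphic_on UNIV" "\<And>v. Re v > 1 + of_int \<bar>k\<bar> / 2 \<Longrightarrow> Gamma v * D \<tau>2 v = A J2 v"
    by blast
  define C1 C2 where "C1 = complex_of_real (y powr (- of_int k / 2) * (pi / Im \<tau>1) powr (of_int \<bar>k\<bar> / 2))"
    and "C2 = complex_of_real (y powr (- of_int k / 2) * (pi / Im \<tau>2) powr (of_int \<bar>k\<bar> / 2))"
  define E where "E = (\<lambda>w. exp (w * complex_of_real (ln (real p))))"
  have pr: "complex_of_nat p = of_real (real p)" by simp
  have E: "of_nat p powr w = E w" for w
    unfolding pr E_def powr_def using p1 by (subst Ln_of_real) auto
  define U V where "U = (\<lambda>s. s + of_int k / 2 :: complex)" and "V = (\<lambda>s. U s + of_int \<bar>k\<bar> / 2 :: complex)"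
  \<comment> \<open>The 2 comes from the halves in \<open>G_series\<close>, the first factor is 1 /
    f_p, and the second arises in passing from the restricted pairs to full lattices. The reflection
    u -> 1 - u exchanges the last two.\<close>
  define N where "N = (\<lambda>s. 2 * ((1 + E (U s - 1)) * (1 + E (- U s))))"
  define H where "H = (\<lambda>s. (C1 * A J1 (V s) + C2 * A J2 (V s)) / N s)"
  have refl_U: "U (1 - of_int k - s) = 1 - U s" for s by (simp add: U_def field_simps)
  have refl_V: "V (1 - of_int k - s) = r - V s" for s
    unfolding V_def refl_U r_def by (simp add: field_simps)
  have A_refl: "A J (r - v) = A J v" for J v
  proof -
    have "1 / (r - v) = - (1 / (v - r))" by (metis minus_diff_eq minus_divide_right)
    moreover have "r - v - r = - v" by simp
    ultimately show ?thesis unfolding A_def by simp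
  qed
  have "N (1 - of_int k - s) = N s" for s
    unfolding N_def refl_U by (simp add: mult.commute)
  then have H_refl: "H (1 - of_int k - s) = H s" for s
    unfolding H_def refl_V A_refl by simp
  have hol: "J holomorphic_on B" "(\<lambda>s. J (V s)) holomorphic_on B" "(\<lambda>s. J (r - V s)) holomorphic_on B"
    if "J holomorphic_on UNIV" for J B
  proof -
    show "J holomorphic_on B" using that holomorphic_on_subset by blast
    have "(J \<circ> V) holomorphic_on B" "(J \<circ> (\<lambda>s. r - V s)) holomorphic_on B"
      unfolding V_def U_def
      by (intro holomorphic_on_compose holomorphic_intros holomorphic_on_subset[OF that]; simp)+
    then show "(\<lambda>s. J (V s)) holomorphic_on B" "(\<lambda>s. J (r - V s)) holomorphic_on B"
      by (simp_all add: o_def)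
  qed
  have hol_A: "(\<lambda>s. A J (V s)) holomorphic_on B"
    if J: "J holomorphic_on UNIV" and B: "d \<noteq> 0 \<Longrightarrow> \<forall>s\<in>B. V s \<noteq> 0 \<and> V s - r \<noteq> 0" for J B
  proof (cases "d = 0")
    case False
    have "V holomorphic_on B" unfolding V_def U_def by (intro holomorphic_intros)
    with False B show ?thesis unfolding A_def by (intro holomorphic_intros hol[OF J]) auto
  qed (auto simp: A_def intro!: holomorphic_intros hol[OF J])
  have hol_N: "N holomorphic_on B" for B
    unfolding N_def E_def U_def by (intro holomorphic_intros)
  have mero_A: "(\<lambda>s. A J (V s)) meromorphic_on UNIV" if J: "J holomorphic_on UNIV" for J
  proof -
    have "V holomorphic_on UNIV" unfolding V_def U_def by (intro holomorphic_intros)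
    then have "V meromorphic_on UNIV"
      by (intro analytic_on_imp_meromorphic_on) (simp add: analytic_on_open)
    moreover have "(\<lambda>s. J (V s)) meromorphic_on UNIV" "(\<lambda>s. J (r - V s)) meromorphic_on UNIV"
      using hol[OF J, of UNIV] by (auto intro!: analytic_on_imp_meromorphic_on simp: analytic_on_open)
    ultimately show ?thesis unfolding A_def by (intro meromorphic_intros)
  qed
  have mero: "H meromorphic_on UNIV"
  proof -
    have "N meromorphic_on UNIV"
      using hol_N[of UNIV] by (intro analytic_on_imp_meromorphic_on) (simp add: analytic_on_open)
    then show ?thesis unfolding H_def by (intro meromorphic_intros mero_A J1 J2)
  qed
  have nE: "norm (E w) = exp (Re w * ln (real p))" for w by (simp add: E_def norm_exp_eq_Re)
  have lnp: "ln (real p) > 0" using p1 by simp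
  \<comment> \<open>For Re u > 1 one has |p^(u - 1)| > 1 and |p^(-u)| < 1, so neither power can be
    -1.\<close>
  have N_factors: "1 + E (U s - 1) \<noteq> 0 \<and> 1 + E (- U s) \<noteq> 0" if "s \<in> halfplane k" for s
  proof -
    have u: "Re (U s) > 1" using that by (simp add: halfplane_def U_def field_simps)
    have "norm (E (U s - 1)) \<noteq> norm (- 1 :: complex)" "norm (E (- U s)) \<noteq> norm (- 1 :: complex)"
      unfolding nE using u lnp by auto
    then show ?thesis by (metis add_eq_0_iff norm_minus_cancel)
  qed
  have holo: "H holomorphic_on halfplane k"
    unfolding H_def
  proof (intro holomorphic_intros hol_A J1 J2 hol_N)
    show "N s \<noteq> 0" if "s \<in> halfplane k" for s using N_factors[OF that] by (simp add: N_def)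
    \<comment> \<open>Polar terms are present only for k = 0; then V s = s and r = 1, while the half
      plane is Re s > 1.\<close>
    show "\<forall>s\<in>halfplane k. V s \<noteq> 0 \<and> V s - r \<noteq> 0" if "d \<noteq> 0"
      using that by (auto simp: d_def halfplane_def V_def U_def r_def split: if_splits)
    then show "\<forall>s\<in>halfplane k. V s \<noteq> 0 \<and> V s - r \<noteq> 0" if "d \<noteq> 0"
      using that .
  qed
  have G: "G_hat_series p k z s = H s" if s: "s \<in> halfplane k" for s
  proof -
    define T1 where "T1 = (\<lambda>x. eisenstein_term k y s (of_real 1 * lattice_pt \<tau>1 x))"
    define T2 where "T2 = (\<lambda>x. eisenstein_term k y s (of_real q * lattice_pt \<tau>2 x))"
    define P where "P = complex_of_real (pi / q) powr (- U s)"
    have P: "P \<noteq> 0" using q by (simp add: P_def)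
    have w1: "of_real 1 * lattice_pt \<tau>1 (m, n) = of_real q * of_int m * z + of_int n" for m n
      by (simp add: lattice_pt_def \<tau>1_def mult_ac)
    have w2: "of_real q * lattice_pt \<tau>2 (m, n) = of_int m * z + of_real q * of_int n" for m n
      using q by (simp add: lattice_pt_def \<tau>2_def distrib_left)
    have T1_eq: "T1 (m, n) = eisenstein_term k y s (of_real q * of_int m * z + of_int n)" for m n
      unfolding T1_def w1 ..
    have T2_eq: "T2 (m, n) = eisenstein_term k y s (of_int m * z + of_real q * of_int n)" for m n
      unfolding T2_def w2 ..
    \<comment> \<open>The exponent is -2 u and q^2 = p.\<close>
    have qc: "of_real q powr (- 2 * s - of_int k) = E (- U s)"
    proof -
      have "ln (real p) = 2 * ln q" unfolding q2[symmetric] using q by (simp add: ln_mult)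
      then show ?thesis
        using q by (simp add: E_def U_def powr_def algebra_simps flip: Ln_of_real)
    qed
    have qq: "complex_of_real q * of_real q = of_nat p" unfolding of_real_mult[symmetric] q2 by simp
    have f1: "T1 (m, int p * n) = E (- U s) * T2 (m, n)" for m n
    proof -
      have "of_real q * of_int m * z + of_int (int p * n) = of_real q * (of_int m * z + of_real q * of_int n)"
        using qq by (simp add: distrib_left mult.assoc[symmetric])
      then show ?thesis unfolding T1_eq T2_eq qc[symmetric] by (simp only: eisenstein_term_homogeneous[OF q])
    qed
    have f2: "T2 (int p * m, n) = E (- U s) * T1 (m, n)" for m n
    proof -
      have "of_int (int p * m) * z + of_real q * of_int n = of_real q * (of_real q * of_int m * z + of_int n)"
        using qq by (simp add: distrib_left mult.assoc[symmetric])
      then show ?thesis unfolding T1_eq T2_eq qc[symmetric] by (simp only: eisenstein_term_homogeneous[OF q])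
    qed
    have S1: "T1 summable_on - {(0, 0)}" "P * infsum T1 (- {(0, 0)}) = C1 * D \<tau>1 (V s)"
      unfolding T1_def P_def C1_def D_def V_def U_def
      by (rule eisenstein_lattice_sum[OF q y zero_less_one Im1 s])+
    have S2: "T2 summable_on - {(0, 0)}" "P * infsum T2 (- {(0, 0)}) = C2 * D \<tau>2 (V s)"
      unfolding T2_def P_def C2_def D_def V_def U_def
      by (rule eisenstein_lattice_sum[OF q y q Im2 s])+
    define W where "W = infsum T1 (pairs_L p) + infsum T2 (pairs_R p)"
    have W: "(1 + E (- U s)) * W = infsum T1 (- {(0, 0)}) + infsum T2 (- {(0, 0)})"
      unfolding W_def by (rule infsum_pairs[OF p S1(1) S2(1) f1 f2])
    have g1: "G_series p k z s = W / 2"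
    proof -
      have "(\<lambda>(m, n). eisenstein_term k (Im z) s (of_real (sqrt (real p)) * of_int m * z + of_int n)) = T1"
        "(\<lambda>(m, n). eisenstein_term k (Im z) s (of_int m * z + of_real (sqrt (real p)) * of_int n)) = T2"
        by (auto simp: fun_eq_iff T1_eq T2_eq y_def q_def)
      then show ?thesis unfolding G_series_def W_def by (simp only:) simp
    qed
    have g2: "f_factor p k s = 1 / (1 + E (U s - 1))"
      using f_factor_eq[OF p1 s] by (simp only: E U_def)
    have g3: "- s - of_int k / 2 = - U s" "s + of_int k / 2 + of_int \<bar>k\<bar> / 2 = V s"
      by (simp_all add: U_def V_def)
    have "G_hat_series p k z s = P * Gamma (V s) * (1 / (1 + E (U s - 1))) * (W / 2)"
      by (simp only: G_hat_series_def P_def q_def g1 g2 g3)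
    also have "\<dots> = Gamma (V s) * (P * ((1 + E (- U s)) * W)) / N s"
    proof -
      have "P * Gamma (V s) * (1 / a) * (W / 2) = Gamma (V s) * (P * (b * W)) / (2 * (a * b))"
        if "a \<noteq> 0" "b \<noteq> 0" for a b :: complex using that by (simp add: field_simps)
      then show ?thesis using N_factors[OF s] unfolding N_def by blast
    qed
    also have "\<dots> = (C1 * (Gamma (V s) * D \<tau>1 (V s)) + C2 * (Gamma (V s) * D \<tau>2 (V s))) / N s"
      unfolding W distrib_left S1(2) S2(2) by (simp add: mult_ac)
    also have "\<dots> = H s"
    proof -
      have "Re (V s) > 1 + of_int \<bar>k\<bar> / 2" using s by (simp add: halfplane_def V_def U_def)
      then show ?thesis by (simp only: J1(2) J2(2) H_def)
    qed
    finally show ?thesis .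
  qed
  show ?thesis using mero holo G H_refl by (intro exI[of _ H]) simp
qed

theorem theorem1p5:
  fixes p :: nat and k :: int and z :: complex
  assumes "prime p" and "even k" and "Im z > 0"
  shows "is_meromorphic_continuation (G_hat_series p k z) (halfplane k) (G_hat p k z)
       \<and> is_meromorphic_continuation (G_tilde_series p k z) (halfplane k) (G_tilde p k z)
       \<and> (\<forall>s. G_hat p k z (1 - of_int k - s) = G_hat p k z s)
       \<and> (\<forall>s. G_tilde p k z (1 - of_int k - s) = G_tilde p k z s)"
proof -
  obtain H where H: "H meromorphic_on UNIV" "H holomorphic_on halfplane k"
    "\<And>s. s \<in> halfplane k \<Longrightarrow> G_hat_series p k z s = H s"
    and H_refl: "\<And>s. H (1 - of_int k - s) = H s"
    using G_hat_series_continuation[OF assms(1,3), of k] by metis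
  \<comment> \<open>In u = s + k/2 this is u (u - 1), invariant under u -> 1 - u. A product with a
    normalised function need not be normalised where a zero of \<open>q\<close> cancels a pole, so
    \<open>K\<close> is built from \<open>H\<close> and normalised afterwards.\<close>
  define q where "q = (\<lambda>s. (s + of_int k / 2) * (s + of_int k / 2 - 1) :: complex)"
  define K where "K = (\<lambda>s. q s * H s)"
  have "q holomorphic_on UNIV" unfolding q_def by (intro holomorphic_intros)
  then have "q meromorphic_on UNIV"
    by (intro analytic_on_imp_meromorphic_on) (simp add: analytic_on_open)
  then have K: "K meromorphic_on UNIV" "K holomorphic_on halfplane k"
    "\<And>s. s \<in> halfplane k \<Longrightarrow> G_tilde_series p k z s = K s"
    using H by (auto simp: K_def G_tilde_series_def q_def intro!: meromorphic_intros holomorphic_intros)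
  have "q (1 - of_int k - s) = q s" for s by (simp add: q_def field_simps)
  then have K_refl: "K (1 - of_int k - s) = K s" for s
    by (simp add: K_def H_refl)
  note hat = meromorphic_continuation_eqI[OF H(1,2) open_halfplane halfplane_nonempty H(3), folded G_hat_def]
  note tilde = meromorphic_continuation_eqI[OF K(1,2) open_halfplane halfplane_nonempty K(3), folded G_tilde_def]
  show ?thesis
    using hat(1) tilde(1) remove_sings_reflect[of H, OF H_refl] remove_sings_reflect[of K, OF K_refl]
    by (simp add: hat(2) tilde(2))
qed

end
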